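(* Let $d\ge 1$ and $1<p<\infty$. Then for every $f\in L^p(\mathbb{R}^d)$, $$\lim_{\omega\to\infty}\|S_\omega(f)-f\|_{L^p(\mathbb{R}^d)}=0 .$$
   Context: $L^p(\mathbb{R}^d)$ is the space of complex-valued functions with norm $\|f\|_{L^p(\mathbb{R}^d)}=\big(\int_{\mathbb{R}^d}|f(x)|^p\,dx\big)^{1/p}$. For $\omega>0$ the Dirichlet kernel on $\mathbb{R}^d$ is $$D_\omega(x)=\prod_{j=1}^d\frac{\sin(\omega x_j)}{\pi x_j},$$ and $S_\omega(f)=D_\omega*f$, where $(D_\omega*f)(x)=\int_{\mathbb{R}^d}D_\omega(x-y)f(y)\,dy$. This is well defined for every $f\in L^p(\mathbb{R}^d)$, $1\le p<\infty$, because $D_\omega\in L^q(\mathbb{R}^d)$ for each $q>1$. *)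

theory Defs
  imports "HOL-Analysis.Analysis"
begin

(* The p-norm takes values in [0, \<infinity>], so that convergence of norms to 0 is not
   vacuous for functions outside L^p. *)
definition Lp_norm :: "real \<Rightarrow> (real ^ 'n \<Rightarrow> complex) \<Rightarrow> ennreal" where
  "Lp_norm p f =
     (let I = (\<integral>\<^sup>+ x. ennreal (cmod (f x) powr p) \<partial>lebesgue)
      in if I = \<infinity> then \<infinity> else ennreal (enn2real I powr (1 / p)))"

definition Lp_space :: "real \<Rightarrow> (real ^ 'n \<Rightarrow> complex) set" where
  "Lp_space p = {f \<in> borel_measurable lebesgue. Lp_norm p f < \<infinity>}"

(* The quotient sin (\<omega> t) / (\<pi> t) has a removable singularity at t = 0, where it is
   extended by its limit \<omega> / \<pi> (HOL division by zero would give 0 instead). *)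
definition dirichlet_kernel :: "real \<Rightarrow> real ^ 'n \<Rightarrow> real" where
  "dirichlet_kernel \<omega> x =
     (\<Prod>j\<in>UNIV. if x $ j = 0 then \<omega> / pi else sin (\<omega> * x $ j) / (pi * x $ j))"

definition convolution ::
    "(real ^ 'n \<Rightarrow> real) \<Rightarrow> (real ^ 'n \<Rightarrow> complex) \<Rightarrow> real ^ 'n \<Rightarrow> complex" where
  "convolution k f x = (LINT y|lebesgue. complex_of_real (k (x - y)) * f y)"

definition dirichlet_op :: "real \<Rightarrow> (real ^ 'n \<Rightarrow> complex) \<Rightarrow> real ^ 'n \<Rightarrow> complex" where
  "dirichlet_op \<omega> f = convolution (dirichlet_kernel \<omega>) f"

end

theory Submission
  imports Defs "HOL-Complex_Analysis.Complex_Analysis" "HOL-Probability.Sinc_Integral"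
begin

text \<open>
  The theorem has two halves: the operators $S_\omega$ are bounded on $L^p$ uniformly in $\omega$,
  and the convergence holds for indicators of boxes. Since the linear combinations of
  such indicators are dense, the two halves give convergence for every $f$ in $L^p$.

  Uniform boundedness is M. Riesz's theorem on conjugate functions. On the line, the addition
  theorem for $\sin(\omega(x-y))$ expresses $S_\omega f$ through the Hilbert transforms of
  $\cos(\omega\,\cdot)f$ and $\sin(\omega\,\cdot)f$. The singular integral is avoided by working
  with the conjugate Poisson kernel $t/(\pi(t^2+y^2))$ at a fixed height $y>0$, with bounds that do
  not depend on $y$, and letting $y\to 0$ only in the bounded kernel
  $\sin(\omega t)\,t/(\pi(t^2+y^2))$.

  For $1<p\le 2$ and $f\ge 0$ the bound comes from complex analysis. The holomorphic function
  $F=u+iv$ on the upper half-plane whose real and imaginary parts are the Poisson and the conjugate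
  Poisson integral of $f$ has $u>0$, unless $f$ vanishes almost everywhere, so $F^p$ is holomorphic; it decays like $|z|^{-p}$, so its
  integral along a horizontal line vanishes (\<open>integral_real_line_tendsto_0\<close>). The
  pointwise inequality $|v|^p\le A u^p-B\,\mathrm{Re}(F^p)$ (\<open>Im_powr_le_Re_powr\<close>) then gives
  $\int|v|^p\le A\int u^p\le A\int f^p$. The case $p>2$ follows by duality, because the Dirichlet
  kernel is even (\<open>dirichlet_bound_bounded_support_large_p\<close>).

  In several variables the Dirichlet kernel is a product, so the one-dimensional bound can be
  applied in one coordinate after the other (\<open>tensor_op_bound\<close>). For a box, $S_\omega$ applied
  to the indicator is a product of differences of sine integrals, which converges pointwise
  off the faces and is dominated by a product of functions $c/(1+|x_j|)$; these lie
  in $L^p$ because $p>1$ (\<open>cbox_convergence\<close>).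

  All estimates are stated for $\int|f|^p$ in place of the norm. The inequality
  $\int|f+g|^p\le 2^p(\int|f|^p+\int|g|^p)$ and Young's inequality then take the place of
  the inequalities of Minkowski and Hoelder.
\<close>

section \<open>Integrals of p-th powers\<close>

definition pth_integral :: "real \<Rightarrow> 'a measure \<Rightarrow> ('a \<Rightarrow> complex) \<Rightarrow> ennreal" where
  "pth_integral p M f = (\<integral>\<^sup>+x. ennreal (cmod (f x) powr p) \<partial>M)"

text \<open>A crude substitute for the triangle inequality in $L^p$: the larger of the two numbers is at least
  half of the sum. Constants do not matter anywhere below.\<close>

lemma powr_add_le:
  fixes a b p :: real
  assumes "0 \<le> a" "0 \<le> b" "0 \<le> p"
  shows "(a + b) powr p \<le> 2 powr p * (a powr p + b powr p)"
proof -
  have "(a + b) powr p \<le> (2 * max a b) powr p" using assms by (intro powr_mono2) auto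
  also have "\<dots> = 2 powr p * (max a b) powr p" using assms by (simp add: powr_mult)
  also have "(max a b) powr p \<le> a powr p + b powr p" by (auto simp: max_def)
  finally show ?thesis by simp
qed

lemma pth_integral_add_le:
  assumes [measurable]: "f \<in> borel_measurable M" "g \<in> borel_measurable M" and p: "0 \<le> p"
  shows "pth_integral p M (\<lambda>x. f x + g x) \<le> ennreal (2 powr p) * (pth_integral p M f + pth_integral p M g)"
proof -
  have "pth_integral p M (\<lambda>x. f x + g x) \<le> (\<integral>\<^sup>+x. ennreal (2 powr p) * (ennreal (cmod (f x) powr p) + ennreal (cmod (g x) powr p)) \<partial>M)"
    unfolding pth_integral_def
  proof (rule nn_integral_mono)
    fix x
    have "cmod (f x + g x) powr p \<le> (cmod (f x) + cmod (g x)) powr p"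
      using p by (intro powr_mono2 norm_triangle_ineq) auto
    also have "\<dots> \<le> 2 powr p * (cmod (f x) powr p + cmod (g x) powr p)"
      using p by (intro powr_add_le) auto
    finally show "ennreal (cmod (f x + g x) powr p) \<le> ennreal (2 powr p) * (ennreal (cmod (f x) powr p) + ennreal (cmod (g x) powr p))"
      by (simp add: ennreal_mult[symmetric] ennreal_plus[symmetric] ennreal_leI del: ennreal_plus)
  qed
  then show ?thesis by (simp add: pth_integral_def nn_integral_cmult nn_integral_add)
qed

lemma pth_integral_mono:
  assumes "0 \<le> p" "\<And>x. x \<in> space M \<Longrightarrow> cmod (f x) \<le> cmod (g x)"
  shows "pth_integral p M f \<le> pth_integral p M g"
  unfolding pth_integral_def using assms by (intro nn_integral_mono ennreal_leI powr_mono2) auto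

lemma pth_integral_scale:
  assumes [measurable]: "f \<in> borel_measurable M"
  shows "pth_integral p M (\<lambda>x. c * f x) = ennreal (cmod c powr p) * pth_integral p M f"
  unfolding pth_integral_def by (simp add: norm_mult powr_mult ennreal_mult nn_integral_cmult)

lemma pth_integral_add_finite:
  assumes "f \<in> borel_measurable M" "g \<in> borel_measurable M" "0 \<le> p" "pth_integral p M f < \<infinity>" "pth_integral p M g < \<infinity>"
  shows "pth_integral p M (\<lambda>x. f x + g x) < \<infinity>"
proof -
  have "ennreal (2 powr p) * (pth_integral p M f + pth_integral p M g) < \<infinity>"
    using assms(4,5) by (simp add: ennreal_mult_less_top)
  with pth_integral_add_le[OF assms(1,2,3)] show ?thesis by (rule le_less_trans)
qed

lemma pth_integral_indicator:
  assumes "A \<in> sets M"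
  shows "pth_integral p M (indicator A) = emeasure M A"
proof -
  have "pth_integral p M (indicator A) = (\<integral>\<^sup>+x. indicator A x \<partial>M)"
    unfolding pth_integral_def by (intro nn_integral_cong) (auto simp: indicator_def)
  then show ?thesis using assms by simp
qed

text \<open>Fatou's lemma, in the form in which bounds for approximations pass to the limit.\<close>

lemma pth_integral_le_of_tendsto:
  assumes meas: "\<And>n. h n \<in> borel_measurable M"
    and lim: "\<And>x. x \<in> space M \<Longrightarrow> (\<lambda>n. h n x) \<longlonglongrightarrow> g x"
    and le: "\<And>n::nat. pth_integral p M (h n) \<le> C" and p: "0 < p"
  shows "pth_integral p M g \<le> C"
proof -
  have "pth_integral p M g = (\<integral>\<^sup>+x. liminf (\<lambda>n. ennreal (cmod (h n x) powr p)) \<partial>M)"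
    unfolding pth_integral_def
  proof (rule nn_integral_cong)
    fix x assume "x \<in> space M"
    then have "(\<lambda>n. ennreal (cmod (h n x) powr p)) \<longlonglongrightarrow> ennreal (cmod (g x) powr p)"
      using p by (intro tendsto_intros tendsto_powr' lim) auto
    then show "ennreal (cmod (g x) powr p) = liminf (\<lambda>n. ennreal (cmod (h n x) powr p))"
      by (intro lim_imp_Liminf[symmetric]) auto
  qed
  also have "\<dots> \<le> liminf (\<lambda>n. pth_integral p M (h n))"
    unfolding pth_integral_def using meas by (intro nn_integral_liminf) measurable
  also have "\<dots> \<le> limsup (\<lambda>n. pth_integral p M (h n))" by (intro Liminf_le_Limsup) simp
  also have "\<dots> \<le> C" by (intro Limsup_bounded) (simp add: le)
  finally show ?thesis .
qed

text \<open>By Young's inequality, which for mere integrability does the work of the Hoelder inequality.\<close>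

lemma integrable_mult_of_pth_integrals:
  fixes f g :: "'a \<Rightarrow> complex"
  assumes pq: "1 < p" "1 < q" "1 / p + 1 / q = 1"
    and [measurable]: "f \<in> borel_measurable M" "g \<in> borel_measurable M"
    and fin: "pth_integral q M g < \<infinity>" "pth_integral p M f < \<infinity>"
  shows "integrable M (\<lambda>x. g x * f x)"
proof (rule integrableI_bounded)
  have "(\<integral>\<^sup>+x. ennreal (cmod (g x * f x)) \<partial>M) \<le> (\<integral>\<^sup>+x. ennreal (cmod (g x) powr q) + ennreal (cmod (f x) powr p) \<partial>M)"
  proof (rule nn_integral_mono)
    fix x
    have "cmod (f x) * cmod (g x) \<le> cmod (f x) powr p / p + cmod (g x) powr q / q"
      using pq by (intro Youngs_inequality) auto
    also have "\<dots> \<le> cmod (f x) powr p / 1 + cmod (g x) powr q / 1"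
      using pq by (intro add_mono divide_left_mono) auto
    finally have "cmod (g x * f x) \<le> cmod (g x) powr q + cmod (f x) powr p" by (simp add: norm_mult mult_ac)
    then show "ennreal (cmod (g x * f x)) \<le> ennreal (cmod (g x) powr q) + ennreal (cmod (f x) powr p)"
      by (simp add: ennreal_plus[symmetric] ennreal_leI del: ennreal_plus)
  qed
  also have "\<dots> < \<infinity>" using fin by (simp add: nn_integral_add pth_integral_def)
  finally show "(\<integral>\<^sup>+x. ennreal (cmod (g x * f x)) \<partial>M) < \<infinity>" .
qed measurable

section \<open>The Cauchy integral in the upper half-plane\<close>

text \<open>In polar coordinates $w=re^{i\theta}$ with $|\theta|<\pi/2$ the claim reads
  $|\sin\theta|^p\le A\cos^p\theta-B\cos(p\theta)$. Near $\theta=\pm\pi/2$ the term $-\cos(p\theta)$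
  is bounded below by a positive constant, because $\pi/2<p\pi/2\le\pi$, and away from these angles
  $\cos\theta$ is. This is the only place where $p\le 2$ is used.\<close>

lemma Im_powr_le_Re_powr:
  fixes p :: real
  assumes p: "1 < p" "p \<le> 2"
  shows "\<exists>A B. 0 \<le> A \<and> (\<forall>w. Re w > 0 \<longrightarrow>
           \<bar>Im w\<bar> powr p \<le> A * Re w powr p - B * Re (w powr of_real p))"
proof -
  \<comment> \<open>Any angle strictly between $\pi/(2p)$ and $\pi/2$ separates the two ranges.\<close>
  define \<theta> where "\<theta> = (pi / (2 * p) + pi / 2) / 2"
  have th: "pi / (2 * p) < \<theta>" "\<theta> < pi / 2"
    using p by (auto simp: \<theta>_def field_simps)
  moreover have "0 < pi / (2 * p)" using p by simp
  ultimately have "0 < \<theta>" by linarith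
  note th = th this
  have pth: "pi / 2 < p * \<theta>" "p * \<theta> < pi"
  proof -
    show "pi / 2 < p * \<theta>" using th(1) p by (simp add: field_simps)
    have "p * \<theta> \<le> 2 * \<theta>" using p th by simp
    then show "p * \<theta> < pi" using th(2) by linarith
  qed
  have c0: "cos (p * \<theta>) < 0"
    using cos_monotone_0_pi[of "pi / 2" "p * \<theta>"] pth by simp
  have c1: "0 < cos \<theta>" using th by (intro cos_gt_zero) auto
  define B where "B = 1 / \<bar>cos (p * \<theta>)\<bar>"
  define A where "A = (1 + B) / cos \<theta> powr p"
  have B0: "B > 0" using c0 by (simp add: B_def)
  have A0: "A > 0" using B0 c1 by (simp add: A_def)
  have key: "\<bar>sin t\<bar> powr p \<le> A * cos t powr p - B * cos (p * t)" if t: "0 \<le> t" "t < pi / 2" for t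
  proof -
    have s1: "\<bar>sin t\<bar> powr p \<le> 1"
      using powr_mono2[of p "\<bar>sin t\<bar>" 1] p by simp
    show ?thesis
    proof (cases "t \<le> \<theta>")
      case True
      have "cos \<theta> \<le> cos t" using True t th by (intro cos_monotone_0_pi_le) auto
      then have "cos \<theta> powr p \<le> cos t powr p" using c1 p by (intro powr_mono2) auto
      then have "(1 + B) * cos \<theta> powr p \<le> (1 + B) * cos t powr p"
        using B0 by (intro mult_left_mono) auto
      then have "1 + B \<le> A * cos t powr p" using c1 by (simp add: A_def pos_le_divide_eq)
      moreover have "B * cos (p * t) \<le> B * 1" using B0 by (intro mult_left_mono) auto
      ultimately show ?thesis using s1 by simp
    next
      case False
      have "p * t \<le> 2 * t" using p t by (intro mult_right_mono) auto
      moreover have "p * \<theta> \<le> p * t" using False p by auto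
      moreover have "p * t \<le> pi" using calculation(1) t by linarith
      ultimately have "cos (p * t) \<le> cos (p * \<theta>)" using pth
        by (intro cos_monotone_0_pi_le) auto
      then have "1 \<le> - B * cos (p * t)" using c0 by (simp add: B_def field_simps)
      moreover have "0 \<le> A * cos t powr p" using A0 by simp
      ultimately show ?thesis using s1 by simp
    qed
  qed
  have key': "\<bar>sin t\<bar> powr p \<le> A * cos t powr p - B * cos (p * t)" if "\<bar>t\<bar> < pi / 2" for t
    using key[of "\<bar>t\<bar>"] that by (cases "0 \<le> t") auto
  have "\<bar>Im w\<bar> powr p \<le> A * Re w powr p - B * Re (w powr of_real p)" if w: "Re w > 0" for w
  proof -
    define r t where "r = cmod w" and "t = Arg w"
    have w0: "w \<noteq> 0" using w by auto
    have r0: "r > 0" using w0 by (simp add: r_def)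
    have t: "\<bar>t\<bar> < pi / 2" using w Arg_Re_pos[of w] by (simp add: t_def)
    have weq: "w = rcis r t" by (simp add: r_def t_def rcis_cmod_Arg)
    have re: "Re w = r * cos t" and im: "Im w = r * sin t" by (simp_all add: weq)
    have ct: "0 < cos t" using t by (intro cos_gt_zero_pi) auto
    have "Re (w powr of_real p) = r powr p * cos (p * t)"
      using w0 r0 by (simp add: powr_def Re_exp Arg_eq_Im_Ln[symmetric] r_def t_def)
    moreover have "\<bar>Im w\<bar> powr p = r powr p * \<bar>sin t\<bar> powr p"
      using r0 by (simp add: im abs_mult powr_mult)
    moreover have "Re w powr p = r powr p * cos t powr p"
      using r0 ct by (simp add: re powr_mult)
    moreover have "r powr p * \<bar>sin t\<bar> powr p \<le> r powr p * (A * cos t powr p - B * cos (p * t))"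
      using key'[OF t] by (intro mult_left_mono) auto
    ultimately show ?thesis by (simp add: algebra_simps)
  qed
  then show ?thesis using A0 by (intro exI[of _ A] exI[of _ B]) auto
qed

text \<open>Cauchy's theorem for the triangle with vertices $-N$, $N$, $iN$: on the two upper sides $|z|\ge N/2$,
  so their contribution is of order $N\cdot N^{-p}$, which tends to $0$ since $p>1$.\<close>

lemma integral_real_line_tendsto_0:
  fixes G :: "complex \<Rightarrow> complex"
  assumes hol: "G holomorphic_on {z. Im z \<ge> 0}"
    and p: "1 < p"
    and decay: "\<And>z. Im z \<ge> 0 \<Longrightarrow> cmod z \<ge> R \<Longrightarrow> cmod (G z) \<le> K * cmod z powr - p"
  shows "((\<lambda>N. integral {-N..N} (\<lambda>x. G (of_real x))) \<longlongrightarrow> 0) at_top"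
proof (rule Lim_null_comparison)
  have K0: "0 \<le> K"
  proof -
    have "0 \<le> cmod (G (of_real (\<bar>R\<bar> + 1)))" by simp
    also have "\<dots> \<le> K * (\<bar>R\<bar> + 1) powr - p"
      using decay[of "of_real (\<bar>R\<bar> + 1)"] unfolding norm_of_real by simp
    finally have "0 \<le> K * (\<bar>R\<bar> + 1) powr - p" .
    moreover have "(\<bar>R\<bar> + 1) powr - p > 0" by simp
    ultimately show ?thesis by (simp add: zero_le_mult_iff)
  qed
  have bound: "cmod (integral {-N..N} (\<lambda>x. G (of_real x))) \<le> 8 * K * (N / 2) powr (1 - p)"
    if N: "N \<ge> 2 * R" "N > 0" for N
  proof -
    define a b c where "a = complex_of_real (- N)" and "b = complex_of_real N" and "c = \<i> * complex_of_real N"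
    have sub: "convex hull {a, b, c} \<subseteq> {z. Im z \<ge> 0}"
      by (intro hull_minimal convex_halfspace_Im_ge) (use N in \<open>auto simp: a_def b_def c_def\<close>)
    have hol': "G holomorphic_on convex hull {a, b, c}"
      using hol sub holomorphic_on_subset by blast
    have tri: "(G has_contour_integral 0) (linepath a b +++ linepath b c +++ linepath c a)"
      by (rule Cauchy_theorem_triangle[OF hol'])
    have sum0: "contour_integral (linepath a b) G + contour_integral (linepath b c) G
      + contour_integral (linepath c a) G = 0"
      by (rule has_chain_integral_chain_integral3[OF tri])
    have cont: "continuous_on (convex hull {a, b, c}) G"
      using hol' holomorphic_on_imp_continuous_on by blast
    have seg: "closed_segment b c \<subseteq> convex hull {a, b, c}" "closed_segment c a \<subseteq> convex hull {a, b, c}"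
      by (simp_all add: segment_convex_hull hull_mono)
    have big: "cmod (G z) \<le> K * (N / 2) powr - p" if z: "Im z \<ge> 0" "cmod z \<ge> N / 2" for z
    proof -
      have "cmod (G z) \<le> K * cmod z powr - p" using decay[of z] z N by auto
      also have "\<dots> \<le> K * (N / 2) powr - p"
        using z N p K0 by (intro mult_left_mono powr_mono2') auto
      finally show ?thesis .
    qed
    have far1: "cmod z \<ge> N / 2" if zs: "z \<in> closed_segment b c" for z
    proof -
      obtain u where u: "0 \<le> u" "u \<le> 1" "z = (1 - u) *\<^sub>R b + u *\<^sub>R c"
        using zs by (auto simp: in_segment)
      have "Re z + Im z = N" by (simp add: u(3) b_def c_def algebra_simps)
      then show ?thesis using complex_Re_le_cmod[of z] abs_Im_le_cmod[of z] by linarith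
    qed
    have far2: "cmod z \<ge> N / 2" if zs: "z \<in> closed_segment c a" for z
    proof -
      obtain u where u: "0 \<le> u" "u \<le> 1" "z = (1 - u) *\<^sub>R c + u *\<^sub>R a"
        using zs by (auto simp: in_segment)
      have "- Re z + Im z = N" by (simp add: u(3) a_def c_def algebra_simps)
      then show ?thesis using abs_Re_le_cmod[of z] abs_Im_le_cmod[of z] by linarith
    qed
    have len: "cmod (c - b) \<le> 2 * N" "cmod (a - c) \<le> 2 * N"
      using norm_triangle_ineq4[of c b] norm_triangle_ineq4[of a c] N
      by (auto simp: a_def b_def c_def norm_mult)
    have B0: "0 \<le> K * (N / 2) powr - p" using K0 by simp
    have I1: "cmod (contour_integral (linepath b c) G) \<le> K * (N / 2) powr - p * cmod (c - b)"
      using B0 cont seg sub far1 big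
      by (intro contour_integral_bound_linepath contour_integrable_continuous_linepath)
         (auto intro: continuous_on_subset)
    have I2: "cmod (contour_integral (linepath c a) G) \<le> K * (N / 2) powr - p * cmod (a - c)"
      using B0 cont seg sub far2 big
      by (intro contour_integral_bound_linepath contour_integrable_continuous_linepath)
         (auto intro: continuous_on_subset)
    have J1: "K * (N / 2) powr - p * cmod (c - b) \<le> K * (N / 2) powr - p * (2 * N)"
      using len B0 by (intro mult_left_mono) auto
    have J2: "K * (N / 2) powr - p * cmod (a - c) \<le> K * (N / 2) powr - p * (2 * N)"
      using len B0 by (intro mult_left_mono) auto
    have "integral {-N..N} (\<lambda>x. G (of_real x)) = contour_integral (linepath a b) G"
      using N by (subst contour_integral_linepath_Reals_eq) (auto simp: a_def b_def)
    also have "\<dots> = - (contour_integral (linepath b c) G + contour_integral (linepath c a) G)"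
      using sum0 by (simp add: algebra_simps add_eq_0_iff)
    finally have "cmod (integral {-N..N} (\<lambda>x. G (of_real x))) \<le>
       cmod (contour_integral (linepath b c) G) + cmod (contour_integral (linepath c a) G)"
      by (metis norm_minus_cancel norm_triangle_ineq)
    also have "\<dots> \<le> K * (N / 2) powr - p * (4 * N)"
      using I1 I2 J1 J2 by (simp add: algebra_simps)
    also have "\<dots> = 8 * K * (N / 2) powr (1 - p)"
      using powr_mult_base[of "N / 2" "- p"] N by simp
    finally show ?thesis .
  qed
  show "\<forall>\<^sub>F N in at_top. cmod (integral {-N..N} (\<lambda>x. G (of_real x))) \<le> 8 * K * (N / 2) powr (1 - p)"
    using eventually_ge_at_top[of "2 * R"] eventually_gt_at_top[of 0]
    by eventually_elim (use bound in auto)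
  have "filterlim (\<lambda>N::real. 1 / 2 * N) at_top at_top"
    by (rule filterlim_tendsto_pos_mult_at_top[OF tendsto_const _ filterlim_ident]) simp
  then have "((\<lambda>N. (N / 2) powr (1 - p)) \<longlongrightarrow> 0) at_top"
    using p by (intro tendsto_neg_powr) simp_all
  then show "((\<lambda>N. 8 * K * (N / 2) powr (1 - p)) \<longlongrightarrow> 0) at_top"
    by (rule tendsto_mult_right_zero)
qed

text \<open>The Cauchy integral of $f$, normalised so that its real and imaginary parts are the Poisson and
  the conjugate Poisson integral of $f$.\<close>

definition herglotz :: "(real \<Rightarrow> real) \<Rightarrow> complex \<Rightarrow> complex" where
  "herglotz f z = (LINT t|lborel. \<i> * of_real (f t) / (of_real pi * (z - of_real t)))"

definition poisson_kernel :: "real \<Rightarrow> real \<Rightarrow> real" where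
  "poisson_kernel y t = y / (pi * (t\<^sup>2 + y\<^sup>2))"

definition conj_poisson_kernel :: "real \<Rightarrow> real \<Rightarrow> real" where
  "conj_poisson_kernel y t = t / (pi * (t\<^sup>2 + y\<^sup>2))"

lemma herglotz_integrable:
  assumes f: "integrable lborel f" and z: "Im z > 0"
  shows "integrable lborel (\<lambda>t. \<i> * of_real (f t) / (of_real pi * (z - of_real t)) :: complex)"
proof (rule Bochner_Integration.integrable_bound)
  show "integrable lborel (\<lambda>t. f t / (pi * Im z))" using f by simp
  show "(\<lambda>t. \<i> * of_real (f t) / (of_real pi * (z - of_real t)) :: complex) \<in> borel_measurable lborel"
    using borel_measurable_integrable[OF f] by measurable
  show "AE t in lborel. cmod (\<i> * of_real (f t) / (of_real pi * (z - of_real t))) \<le> norm (f t / (pi * Im z))"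
  proof (rule AE_I2)
    fix t
    have "Im z \<le> cmod (z - of_real t)" using abs_Im_le_cmod[of "z - of_real t"] by simp
    then show "cmod (\<i> * of_real (f t) / (of_real pi * (z - of_real t))) \<le> norm (f t / (pi * Im z))"
      using z by (auto simp: norm_divide norm_mult intro!: divide_left_mono mult_pos_pos)
  qed
qed

lemma
  assumes f: "integrable lborel f" and z: "Im z > 0"
  shows Re_herglotz: "Re (herglotz f z) = (LINT t|lborel. poisson_kernel (Im z) (Re z - t) * f t)"
    and Im_herglotz: "Im (herglotz f z) = (LINT t|lborel. conj_poisson_kernel (Im z) (Re z - t) * f t)"
    and integrable_poisson: "integrable lborel (\<lambda>t. poisson_kernel (Im z) (Re z - t) * f t)"
    and integrable_conj_poisson: "integrable lborel (\<lambda>t. conj_poisson_kernel (Im z) (Re z - t) * f t)"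
proof -
  define h where "h = (\<lambda>t. \<i> * of_real (f t) / (of_real pi * (z - of_real t)) :: complex)"
  have int: "integrable lborel h" unfolding h_def by (rule herglotz_integrable[OF f z])
  have h: "h t = Complex (poisson_kernel (Im z) (Re z - t) * f t) (conj_poisson_kernel (Im z) (Re z - t) * f t)" for t
  proof -
    have "h t = of_real (f t / pi) * (\<i> / (z - of_real t))" by (simp add: h_def)
    also have "\<i> / (z - of_real t) = Complex (Im z / ((Re z - t)\<^sup>2 + (Im z)\<^sup>2)) ((Re z - t) / ((Re z - t)\<^sup>2 + (Im z)\<^sup>2))"
      by (simp add: complex_eq_iff Re_divide Im_divide power2_eq_square)
    finally show ?thesis
      by (simp add: complex_eq_iff poisson_kernel_def conj_poisson_kernel_def mult_ac)
  qed
  have re: "(\<lambda>t. Re (h t)) = (\<lambda>t. poisson_kernel (Im z) (Re z - t) * f t)"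
   and im: "(\<lambda>t. Im (h t)) = (\<lambda>t. conj_poisson_kernel (Im z) (Re z - t) * f t)"
    by (simp_all add: h)
  have H: "herglotz f z = integral\<^sup>L lborel h" by (simp add: herglotz_def h_def)
  show "Re (herglotz f z) = (LINT t|lborel. poisson_kernel (Im z) (Re z - t) * f t)"
    unfolding H re[symmetric] using int by simp
  show "Im (herglotz f z) = (LINT t|lborel. conj_poisson_kernel (Im z) (Re z - t) * f t)"
    unfolding H im[symmetric] using int by simp
  show "integrable lborel (\<lambda>t. poisson_kernel (Im z) (Re z - t) * f t)"
    unfolding re[symmetric] using int by (rule integrable_Re)
  show "integrable lborel (\<lambda>t. conj_poisson_kernel (Im z) (Re z - t) * f t)"
    unfolding im[symmetric] using int by (rule integrable_Im)
qed

text \<open>Differentiation under the integral sign. The difference between the difference quotient and the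
  candidate derivative is again an integral of $f$ against an explicit kernel, which is bounded by
  a multiple of $|z-w|$.\<close>

lemma herglotz_holomorphic:
  assumes f: "integrable lborel f"
  shows "herglotz f holomorphic_on {z. Im z > 0}"
proof (rule holomorphic_onI)
  fix w assume w: "w \<in> {z. Im z > 0}"
  then have y: "Im w > 0" by simp
  define y where "y = Im w"
  define D where "D = (LINT t|lborel. - \<i> * of_real (f t) / (of_real pi * (w - of_real t)\<^sup>2))"
  have Imle: "Im z \<le> cmod (z - of_real t)" for z t using abs_Im_le_cmod[of "z - of_real t"] by simp
  have fm[measurable]: "f \<in> borel_measurable lborel" using f by simp
  have intD: "integrable lborel (\<lambda>t. - \<i> * of_real (f t) / (of_real pi * (w - of_real t)\<^sup>2) :: complex)"
  proof (rule Bochner_Integration.integrable_bound)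
    show "integrable lborel (\<lambda>t. f t / (pi * y\<^sup>2))" using f by simp
    show "AE t in lborel. cmod (- \<i> * of_real (f t) / (of_real pi * (w - of_real t)\<^sup>2)) \<le> norm (f t / (pi * y\<^sup>2))"
      using y Imle[of w]
      by (intro AE_I2) (auto simp: norm_divide norm_mult norm_power y_def intro!: divide_left_mono mult_left_mono power_mono mult_pos_pos zero_less_power)
  qed measurable
  define C where "C = 2 / (pi * y^3) * (LINT t|lborel. \<bar>f t\<bar>)"
  have est: "cmod ((herglotz f z - herglotz f w) / (z - w) - D) \<le> C * cmod (z - w)"
    if z: "z \<noteq> w" "dist z w < y / 2" for z
  proof -
    have "\<bar>Im z - Im w\<bar> \<le> dist z w" using abs_Im_le_cmod[of "z - w"] by (simp add: dist_norm)
    then have zy: "Im z > y / 2" using z by (simp add: y_def abs_if split: if_splits)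
    then have z0: "Im z > 0" using y y_def by simp
    define g where "g = (\<lambda>t. \<i> * of_real (f t) * (z - w) / (of_real pi * ((w - of_real t)\<^sup>2 * (z - of_real t))) :: complex)"
    have geq: "g t = (\<i> * of_real (f t) / (of_real pi * (z - of_real t)) - \<i> * of_real (f t) / (of_real pi * (w - of_real t))) / (z - w)
        - (- \<i> * of_real (f t) / (of_real pi * (w - of_real t)\<^sup>2))" for t
    proof -
      have nz: "z - of_real t \<noteq> 0" "w - of_real t \<noteq> 0" "z - w \<noteq> 0" using z z0 y by auto
      define a b :: complex where "a = z - of_real t" and "b = w - of_real t"
      have zw: "z - w = a - b" by (simp add: a_def b_def)
      have nz': "a \<noteq> 0" "b \<noteq> 0" "a - b \<noteq> 0" using nz by (simp_all add: a_def b_def)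
      have 3: "(1 / a - 1 / b) / (a - b) + 1 / b\<^sup>2 = (a - b) / (b\<^sup>2 * a)"
      proof -
        obtain d where d: "a = b + d" by (metis add.commute diff_add_cancel)
        have "1 / a - 1 / b = d * (- 1 / (a * b))" using nz' d by (simp add: field_simps)
        then have "(1 / a - 1 / b) / (a - b) = - 1 / (a * b)" using nz' d by simp
        then have "(1 / a - 1 / b) / (a - b) + 1 / b\<^sup>2 = - 1 / (a * b) + 1 / b\<^sup>2" by simp
        also have "\<dots> = (a - b) / (b\<^sup>2 * a)"
          using nz'(1,2) by (simp add: divide_simps power2_eq_square)
        finally show ?thesis .
      qed
      \<comment> \<open>The constant factor is split off so that the identity is one between the rational expressions in \<open>a\<close> and \<open>b\<close>.\<close>
      define k :: complex where "k = \<i> * of_real (f t) / of_real pi"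
      have "g t = k * ((a - b) / (b\<^sup>2 * a))"
        unfolding g_def zw a_def[symmetric] b_def[symmetric] k_def by simp
      also have "\<dots> = (k * (1 / a) - k * (1 / b)) / (a - b) - (- (k * (1 / b\<^sup>2)))"
        unfolding 3[symmetric] by (simp only: ring_distribs diff_divide_distrib add_divide_distrib times_divide_eq_right minus_minus diff_minus_eq_add)
      also have "\<dots> = (\<i> * of_real (f t) / (of_real pi * a) - \<i> * of_real (f t) / (of_real pi * b)) / (a - b)
        - (- \<i> * of_real (f t) / (of_real pi * b\<^sup>2))"
        unfolding k_def by simp
      finally show ?thesis unfolding zw a_def[symmetric] b_def[symmetric] .
    qed
    have "(herglotz f z - herglotz f w) / (z - w) - D = integral\<^sup>L lborel g"
      unfolding herglotz_def D_def geq
      using herglotz_integrable[OF f z0] herglotz_integrable[OF f y] intD by simp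
    also have "cmod \<dots> \<le> (LINT t|lborel. 2 * cmod (z - w) / (pi * y^3) * \<bar>f t\<bar>)"
    proof (rule Bochner_Integration.integral_norm_bound_integral)
      show "integrable lborel g" unfolding geq
        using herglotz_integrable[OF f z0] herglotz_integrable[OF f y] intD by simp
      show "integrable lborel (\<lambda>t. 2 * cmod (z - w) / (pi * y^3) * \<bar>f t\<bar>)" using f by simp
      fix t
      have nz: "0 < cmod (w - of_real t)" "0 < cmod (z - of_real t)" using z0 y by auto
      have "y\<^sup>2 * (y / 2) \<le> (cmod (w - of_real t))\<^sup>2 * cmod (z - of_real t)"
        using Imle[of w t] Imle[of z t] zy y unfolding y_def
        by (intro mult_mono power_mono) auto
      then have "\<bar>f t\<bar> * cmod (z - w) / (pi * ((cmod (w - of_real t))\<^sup>2 * cmod (z - of_real t)))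
          \<le> \<bar>f t\<bar> * cmod (z - w) / (pi * (y\<^sup>2 * (y / 2)))"
        using y nz by (intro divide_left_mono mult_left_mono mult_nonneg_nonneg mult_pos_pos)
                   (simp_all add: y_def)
      also have "\<dots> = 2 * cmod (z - w) / (pi * y^3) * \<bar>f t\<bar>"
        by (simp add: power2_eq_square power3_eq_cube field_simps)
      finally show "cmod (g t) \<le> 2 * cmod (z - w) / (pi * y^3) * \<bar>f t\<bar>"
        by (simp add: g_def norm_divide norm_mult norm_power)
    qed
    also have "\<dots> = C * cmod (z - w)" by (simp add: C_def field_simps)
    finally show ?thesis .
  qed
  have "((\<lambda>z. (herglotz f z - herglotz f w) / (z - w) - D) \<longlongrightarrow> 0) (at w)"
  proof (rule Lim_null_comparison)
    show "\<forall>\<^sub>F z in at w. norm ((herglotz f z - herglotz f w) / (z - w) - D) \<le> C * cmod (z - w)"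
      unfolding eventually_at using y est by (intro exI[of _ "y / 2"]) (auto simp: y_def)
    show "((\<lambda>z. C * cmod (z - w)) \<longlongrightarrow> 0) (at w)"
      by (auto intro!: tendsto_eq_intros)
  qed
  then have "(herglotz f has_field_derivative D) (at w)"
    by (simp add: has_field_derivative_iff LIM_zero_iff)
  then show "herglotz f field_differentiable at w within {z. 0 < Im z}"
    using field_differentiable_at_within field_differentiable_def by blast
qed

text \<open>On the support of $f$ one has $|t|\le R\le|z|/2$, hence $|z-t|\ge|z|/2$.\<close>

lemma herglotz_decay:
  assumes f: "integrable lborel f" and supp: "\<And>t. R < \<bar>t\<bar> \<Longrightarrow> f t = 0"
    and z: "Im z > 0" "cmod z \<ge> 2 * R"
  shows "cmod (herglotz f z) \<le> 2 / pi * (LINT t|lborel. \<bar>f t\<bar>) / cmod z"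
proof -
  have zp: "cmod z > 0" using z by auto
  have "cmod (herglotz f z) \<le> (LINT t|lborel. 2 / (pi * cmod z) * \<bar>f t\<bar>)"
    unfolding herglotz_def
  proof (rule Bochner_Integration.integral_norm_bound_integral)
    show "integrable lborel (\<lambda>t. \<i> * of_real (f t) / (of_real pi * (z - of_real t)) :: complex)"
      by (rule herglotz_integrable[OF f z(1)])
    show "integrable lborel (\<lambda>t. 2 / (pi * cmod z) * \<bar>f t\<bar>)" using f by simp
    fix t
    show "cmod (\<i> * of_real (f t) / (of_real pi * (z - of_real t))) \<le> 2 / (pi * cmod z) * \<bar>f t\<bar>"
    proof (cases "R < \<bar>t\<bar>")
      case True then show ?thesis by (simp add: supp)
    next
      case False
      have "cmod z / 2 \<le> cmod z - \<bar>t\<bar>" using False z by simp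
      also have "\<dots> \<le> cmod (z - of_real t)" using norm_triangle_ineq2[of z "of_real t"] by simp
      finally have "\<bar>f t\<bar> / (pi * cmod (z - of_real t)) \<le> \<bar>f t\<bar> / (pi * (cmod z / 2))"
        using zp by (intro divide_left_mono mult_left_mono mult_pos_pos) auto
      also have "\<bar>f t\<bar> / (pi * (cmod z / 2)) = 2 / (pi * cmod z) * \<bar>f t\<bar>" by simp
      finally show ?thesis by (simp add: norm_divide norm_mult)
    qed
  qed
  also have "\<dots> = 2 / pi * (LINT t|lborel. \<bar>f t\<bar>) / cmod z" by simp
  finally show ?thesis .
qed

section \<open>The Poisson and the conjugate Poisson integral\<close>

text \<open>The graph of $b\mapsto b^p$ lies above its tangent at $a$; with the exponent $q=p/(p-1)$ this is
  Young's inequality for $b$ and $a^{p-1}$.\<close>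

lemma powr_above_tangent:
  fixes a b p :: real
  assumes "1 < p" "0 \<le> a" "0 \<le> b"
  shows "p * a powr (p - 1) * b - (p - 1) * a powr p \<le> b powr p"
proof -
  define q where "q = p / (p - 1)"
  have q: "q > 1" "1 / p + 1 / q = 1" using assms by (auto simp: q_def field_simps)
  have pq: "(p - 1) * q = p" "p / q = p - 1" using assms by (auto simp: q_def)
  have "b * a powr (p - 1) \<le> b powr p / p + (a powr (p - 1)) powr q / q"
    using assms q by (intro Youngs_inequality) auto
  also have "(a powr (p - 1)) powr q = a powr p" by (simp add: powr_powr pq)
  finally have "p * (b * a powr (p - 1)) \<le> p * (b powr p / p + a powr p / q)"
    using assms by (intro mult_left_mono) auto
  also have "\<dots> = b powr p + (p / q) * a powr p" using assms by (simp add: ring_distribs)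
  finally show ?thesis unfolding pq by (simp add: mult_ac)
qed

lemma has_bochner_integral_poisson_kernel:
  assumes y: "y > 0"
  shows "has_bochner_integral lborel (\<lambda>t. poisson_kernel y (x - t)) 1"
proof -
  have e: "einterval (-\<infinity>) \<infinity> = (UNIV :: real set)" by (simp add: einterval_eq_UNIV)
  have "has_bochner_integral lborel (\<lambda>t::real. inverse (1 + t\<^sup>2)) pi"
    using integrable_inverse_1_plus_square LBINT_inverse_1_plus_square
    by (simp add: has_bochner_integral_iff interval_lebesgue_integral_def set_integrable_def
          set_lebesgue_integral_def e)
  then have "has_bochner_integral lborel (\<lambda>t. inverse (1 + (x / y + (- 1 / y) * t)\<^sup>2)) (pi /\<^sub>R \<bar>- 1 / y\<bar>)"
    using y by (subst (asm) lborel_has_bochner_integral_real_affine_iff[of "- 1 / y" _ _ "x / y"]) auto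
  then have "has_bochner_integral lborel (\<lambda>t. 1 / (pi * y) * inverse (1 + (x / y + (- 1 / y) * t)\<^sup>2)) (1 / (pi * y) * (pi /\<^sub>R \<bar>- 1 / y\<bar>))"
    by (rule has_bochner_integral_mult_right)
  moreover have "1 / (pi * y) * inverse (1 + (x / y + (- 1 / y) * t)\<^sup>2) = poisson_kernel y (x - t)" for t
  proof -
    have "x / y + (- 1 / y) * t = (x - t) / y" by (simp add: diff_divide_distrib)
    moreover have "1 + ((x - t) / y)\<^sup>2 = ((x - t)\<^sup>2 + y\<^sup>2) / y\<^sup>2"
      using y by (simp add: power_divide add_divide_distrib)
    ultimately show ?thesis using y by (simp add: poisson_kernel_def power2_eq_square)
  qed
  ultimately show ?thesis using y by simp
qed

lemma poisson_kernel_nonneg: "0 \<le> y \<Longrightarrow> 0 \<le> poisson_kernel y t"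
  by (simp add: poisson_kernel_def)

lemma poisson_kernel_pos: "0 < y \<Longrightarrow> 0 < poisson_kernel y t"
  by (auto simp: poisson_kernel_def intro!: divide_pos_pos mult_pos_pos add_nonneg_pos)

lemma poisson_kernel_measurable[measurable]: "poisson_kernel y \<in> borel_measurable borel"
  unfolding poisson_kernel_def by measurable

lemma conj_poisson_kernel_measurable[measurable]: "conj_poisson_kernel y \<in> borel_measurable borel"
  unfolding conj_poisson_kernel_def by measurable

text \<open>Jensen's inequality for the probability density \<open>poisson_kernel y (x - t)\<close> followed by Tonelli's
  theorem. Jensen's inequality is obtained by integrating the tangent inequality at the mean value
  $u(x)$.\<close>

lemma poisson_integral_contraction:
  fixes f :: "real \<Rightarrow> real"
  assumes p: "1 < p" and y: "0 < y" and f: "integrable lborel f" and nn: "\<And>t. 0 \<le> f t"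
  shows "(\<integral>\<^sup>+x. ennreal ((LINT t|lborel. poisson_kernel y (x - t) * f t) powr p) \<partial>lborel)
       \<le> (\<integral>\<^sup>+t. ennreal (f t powr p) \<partial>lborel)"
proof -
  have fm[measurable]: "f \<in> borel_measurable borel" using f by auto
  define u where "u = (\<lambda>x. LINT t|lborel. poisson_kernel y (x - t) * f t)"
  have intP: "integrable lborel (\<lambda>t. poisson_kernel y (x - t) * f t)" for x
    using integrable_poisson[OF f, of "Complex x y"] y by simp
  have u0: "0 \<le> u x" for x
    unfolding u_def using nn y by (intro Bochner_Integration.integral_nonneg) (simp add: poisson_kernel_nonneg)
  have jensen: "ennreal (u x powr p) \<le> (\<integral>\<^sup>+t. ennreal (poisson_kernel y (x - t) * f t powr p) \<partial>lborel)"
    (is "_ \<le> ?R") for x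
  proof (cases "?R = \<infinity>")
    case True then show ?thesis by simp
  next
    case False
    have P: "integrable lborel (\<lambda>t. poisson_kernel y (x - t))" "(LINT t|lborel. poisson_kernel y (x - t)) = 1"
      using has_bochner_integral_poisson_kernel[OF y, of x] by (auto simp: has_bochner_integral_iff)
    have int: "integrable lborel (\<lambda>t. poisson_kernel y (x - t) * f t powr p)"
      using False y by (intro integrableI_nonneg) (auto simp: poisson_kernel_nonneg less_top)
    have "u x powr p = p * u x powr (p - 1) * u x - (p - 1) * u x powr p"
      using powr_mult_base[OF u0, of x "p - 1"] by (simp add: algebra_simps)
    also have "\<dots> = (LINT t|lborel. p * u x powr (p - 1) * (poisson_kernel y (x - t) * f t)
                      - (p - 1) * u x powr p * poisson_kernel y (x - t))"
      using intP[of x] P by (simp add: u_def)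
    also have "\<dots> \<le> (LINT t|lborel. poisson_kernel y (x - t) * f t powr p)"
    proof (rule integral_mono)
      fix t
      have "poisson_kernel y (x - t) * (p * u x powr (p - 1) * f t - (p - 1) * u x powr p)
        \<le> poisson_kernel y (x - t) * f t powr p"
        using powr_above_tangent[OF p u0 nn, of x t] y by (intro mult_left_mono poisson_kernel_nonneg) auto
      then show "p * u x powr (p - 1) * (poisson_kernel y (x - t) * f t)
                      - (p - 1) * u x powr p * poisson_kernel y (x - t) \<le> poisson_kernel y (x - t) * f t powr p"
        by (simp add: algebra_simps)
    qed (use intP[of x] P int in auto)
    also have "ennreal \<dots> = ?R"
      using int y by (intro nn_integral_eq_integral[symmetric]) (auto simp: poisson_kernel_nonneg)
    finally show ?thesis by (simp add: ennreal_leI)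
  qed
  have "(\<integral>\<^sup>+x. ennreal (u x powr p) \<partial>lborel)
      \<le> (\<integral>\<^sup>+x. \<integral>\<^sup>+t. ennreal (poisson_kernel y (x - t) * f t powr p) \<partial>lborel \<partial>lborel)"
    by (intro nn_integral_mono jensen)
  also have "\<dots> = (\<integral>\<^sup>+t. \<integral>\<^sup>+x. ennreal (poisson_kernel y (x - t) * f t powr p) \<partial>lborel \<partial>lborel)"
    by (rule lborel_pair.Fubini') simp
  also have "\<dots> = (\<integral>\<^sup>+t. ennreal (f t powr p) \<partial>lborel)"
  proof (intro nn_integral_cong)
    fix t
    have "(\<integral>\<^sup>+x. ennreal (poisson_kernel y (x - t) * f t powr p) \<partial>lborel)
       = (\<integral>\<^sup>+x. ennreal (poisson_kernel y (t - x)) * ennreal (f t powr p) \<partial>lborel)"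
    proof (intro nn_integral_cong)
      fix x
      have "poisson_kernel y (x - t) = poisson_kernel y (t - x)"
        by (simp add: poisson_kernel_def power2_commute)
      then show "ennreal (poisson_kernel y (x - t) * f t powr p) = ennreal (poisson_kernel y (t - x)) * ennreal (f t powr p)"
        using y by (simp add: ennreal_mult poisson_kernel_nonneg)
    qed
    also have "\<dots> = (\<integral>\<^sup>+x. ennreal (poisson_kernel y (t - x)) \<partial>lborel) * ennreal (f t powr p)"
      by (rule nn_integral_multc) simp
    also have "(\<integral>\<^sup>+x. ennreal (poisson_kernel y (t - x)) \<partial>lborel) = 1"
      using has_bochner_integral_poisson_kernel[OF y, of t] y
      by (subst nn_integral_eq_integral) (auto simp: has_bochner_integral_iff poisson_kernel_nonneg)
    finally show "(\<integral>\<^sup>+x. ennreal (poisson_kernel y (x - t) * f t powr p) \<partial>lborel) = ennreal (f t powr p)" by simp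
  qed
  finally show ?thesis unfolding u_def .
qed

text \<open>Monotone convergence. The contour argument only controls integrals over symmetric intervals.\<close>

lemma nn_integral_le_of_intervals:
  fixes g :: "real \<Rightarrow> real"
  assumes g: "continuous_on UNIV g" and nn: "\<And>x. 0 \<le> g x"
    and le: "\<forall>\<^sub>F n in sequentially. integral {- real n..real n} g \<le> c n" and c: "c \<longlonglongrightarrow> C"
  shows "(\<integral>\<^sup>+x. ennreal (g x) \<partial>lborel) \<le> ennreal C"
proof (rule LIMSEQ_le)
  have gm[measurable]: "g \<in> borel_measurable borel" by (rule borel_measurable_continuous_onI[OF g])
  show "(\<lambda>n. \<integral>\<^sup>+x. ennreal (g x) * indicator {- real n..real n} x \<partial>lborel) \<longlonglongrightarrow> (\<integral>\<^sup>+x. ennreal (g x) \<partial>lborel)"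
  proof (rule nn_integral_LIMSEQ)
    show "incseq (\<lambda>n x. ennreal (g x) * indicator {- real n..real n} x)"
      by (auto simp: incseq_def le_fun_def indicator_def)
    fix x :: real
    have "\<forall>\<^sub>F n in sequentially. ennreal (g x) * indicator {- real n..real n} x = ennreal (g x)"
      using eventually_ge_at_top[of "nat \<lceil>\<bar>x\<bar>\<rceil>"] by eventually_elim (auto simp: indicator_def abs_le_iff nat_le_iff ceiling_le_iff)
    then show "(\<lambda>n. ennreal (g x) * indicator {- real n..real n} x) \<longlonglongrightarrow> ennreal (g x)"
      by (rule tendsto_eventually)
  qed simp
  show "(\<lambda>n. ennreal (c n)) \<longlonglongrightarrow> ennreal C" using c by (rule tendsto_ennrealI)
  have "(\<integral>\<^sup>+x. ennreal (g x) * indicator {- real n..real n} x \<partial>lborel) = ennreal (integral {- real n..real n} g)" for n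
  proof -
    have "(g has_integral integral {- real n..real n} g) {- real n..real n}"
      by (intro integrable_integral integrable_continuous_real continuous_on_subset[OF g]) auto
    then show ?thesis using nn by (intro nn_integral_has_integral_lebesgue') auto
  qed
  then show "\<exists>N. \<forall>n\<ge>N. (\<integral>\<^sup>+x. ennreal (g x) * indicator {- real n..real n} x \<partial>lborel) \<le> ennreal (c n)"
    using le unfolding eventually_sequentially by (auto intro!: ennreal_leI)
qed

text \<open>M. Riesz's inequality for nonnegative functions at a fixed height $y$. Positivity of $f$ makes the
  real part of the Cauchy integral positive, so that its $p$-th power is holomorphic.\<close>

lemma conj_poisson_integral_bound_nonneg:
  fixes p :: real
  assumes p: "1 < p" "p \<le> 2"
  shows "\<exists>A>0. \<forall>f R y. integrable lborel f \<longrightarrow> (\<forall>t. 0 \<le> f t) \<longrightarrow> (\<forall>t. R < \<bar>t\<bar> \<longrightarrow> f t = 0) \<longrightarrow> 0 < y \<longrightarrow>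
      (\<integral>\<^sup>+x. ennreal (\<bar>LINT t|lborel. conj_poisson_kernel y (x - t) * f t\<bar> powr p) \<partial>lborel)
        \<le> ennreal A * (\<integral>\<^sup>+t. ennreal (f t powr p) \<partial>lborel)"
proof -
  obtain A B where A: "0 \<le> A"
    and AB: "\<And>w. Re w > 0 \<Longrightarrow> \<bar>Im w\<bar> powr p \<le> A * Re w powr p - B * Re (w powr of_real p)"
    using Im_powr_le_Re_powr[OF p] by blast
  have "(\<integral>\<^sup>+x. ennreal (\<bar>LINT t|lborel. conj_poisson_kernel y (x - t) * f t\<bar> powr p) \<partial>lborel)
        \<le> ennreal (A + 1) * (\<integral>\<^sup>+t. ennreal (f t powr p) \<partial>lborel)"
    if f: "integrable lborel f" and nn: "\<And>t. 0 \<le> f t" and supp: "\<And>t. R < \<bar>t\<bar> \<Longrightarrow> f t = 0" and y: "0 < y"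
    for f :: "real \<Rightarrow> real" and R y
  \<comment> \<open>If $f$ vanishes almost everywhere then the real part of the Cauchy integral is $0$ and not positive.\<close>
  proof (cases "(AE t in lborel. f t = 0) \<or> (\<integral>\<^sup>+t. ennreal (f t powr p) \<partial>lborel) = \<infinity>")
    case True
    then show ?thesis
    proof
      assume "AE t in lborel. f t = 0"
      then have "(LINT t|lborel. conj_poisson_kernel y (x - t) * f t) = 0" for x
        by (intro integral_eq_zero_AE) auto
      then show ?thesis by simp
    next
      assume "(\<integral>\<^sup>+t. ennreal (f t powr p) \<partial>lborel) = \<infinity>"
      then show ?thesis using A by (simp add: ennreal_mult_top)
    qed
  next
    case False
    \<comment> \<open>The shift by $iy$ makes the real axis the line on which the Poisson integrals at height $y$ live.\<close>
    define F where "F = (\<lambda>z. herglotz f (z + \<i> * of_real y))"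
    have hol: "F holomorphic_on {z. Im z \<ge> 0}"
    proof -
      have "herglotz f \<circ> (\<lambda>z. z + \<i> * of_real y) holomorphic_on {z. Im z \<ge> 0}"
        using y by (intro holomorphic_on_compose_gen[OF _ herglotz_holomorphic[OF f]] holomorphic_intros) auto
      then show ?thesis by (simp add: F_def o_def)
    qed
    have Repos: "Re (F z) > 0" if z: "Im z \<ge> 0" for z
    proof -
      let ?w = "z + \<i> * of_real y"
      have w: "Im ?w > 0" using z y by simp
      have "0 \<le> (LINT t|lborel. poisson_kernel (Im ?w) (Re ?w - t) * f t)"
        using nn w by (intro Bochner_Integration.integral_nonneg mult_nonneg_nonneg poisson_kernel_nonneg) auto
      moreover have "(LINT t|lborel. poisson_kernel (Im ?w) (Re ?w - t) * f t) \<noteq> 0"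
      proof
        assume "(LINT t|lborel. poisson_kernel (Im ?w) (Re ?w - t) * f t) = 0"
        then have "AE t in lborel. poisson_kernel (Im ?w) (Re ?w - t) * f t = 0"
          using nn w integrable_poisson[OF f w]
          by (subst (asm) integral_nonneg_eq_0_iff_AE) (auto intro!: mult_nonneg_nonneg poisson_kernel_nonneg)
        then have "AE t in lborel. f t = 0"
          using poisson_kernel_pos[OF w] by (auto simp: less_le)
        then show False using False by blast
      qed
      ultimately show ?thesis by (simp add: F_def Re_herglotz[OF f w])
    qed
    define G where "G = (\<lambda>z. F z powr of_real p)"
    have holG: "G holomorphic_on {z. Im z \<ge> 0}"
    proof -
      have "F z \<notin> \<real>\<^sub>\<le>\<^sub>0" if "Im z \<ge> 0" for z using Repos[OF that] by (auto simp: complex_nonpos_Reals_iff)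
      then show ?thesis unfolding G_def by (intro holomorphic_intros hol) auto
    qed
    define K where "K = (2 / pi * (LINT t|lborel. \<bar>f t\<bar>)) powr p"
    have decay: "cmod (G z) \<le> K * cmod z powr - p" if z: "Im z \<ge> 0" "cmod z \<ge> 2 * \<bar>R\<bar> + 1" for z
    proof -
      let ?w = "z + \<i> * of_real y"
      have zw: "cmod z \<le> cmod ?w"
        using z y unfolding cmod_def by (intro real_sqrt_le_mono) (simp add: power_mono)
      have zp: "cmod z > 0" using z by linarith
      have "cmod (F z) \<le> 2 / pi * (LINT t|lborel. \<bar>f t\<bar>) / cmod ?w"
        unfolding F_def using z y zw supp by (intro herglotz_decay[OF f, of R]) auto
      also have "\<dots> \<le> 2 / pi * (LINT t|lborel. \<bar>f t\<bar>) / cmod z"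
        using zw zp by (intro divide_left_mono mult_nonneg_nonneg mult_pos_pos) (auto intro: order_less_le_trans)
      finally have "cmod (F z) powr p \<le> (2 / pi * (LINT t|lborel. \<bar>f t\<bar>) / cmod z) powr p"
        using p by (intro powr_mono2) auto
      also have "\<dots> = K * cmod z powr - p"
        unfolding K_def by (subst powr_divide) (auto simp: powr_minus_divide)
      finally show ?thesis by (simp add: G_def norm_powr_real_powr')
    qed
    define u v where "u = (\<lambda>x::real. Re (F (of_real x)))" and "v = (\<lambda>x::real. Im (F (of_real x)))"
    have contF: "continuous_on UNIV (\<lambda>x::real. F (of_real x))"
      by (rule continuous_on_compose2[OF holomorphic_on_imp_continuous_on[OF hol]])
         (auto intro!: continuous_intros)
    have contG: "continuous_on UNIV (\<lambda>x::real. G (of_real x))"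
      by (rule continuous_on_compose2[OF holomorphic_on_imp_continuous_on[OF holG]])
         (auto intro!: continuous_intros)
    have u0: "u x > 0" for x using Repos[of "of_real x"] by (simp add: u_def)
    have contu: "continuous_on S (\<lambda>x. u x powr p)" for S
      unfolding u_def using Repos p
      by (intro continuous_on_powr' continuous_intros continuous_on_subset[OF contF]) (auto simp: less_imp_le)
    have contv: "continuous_on S (\<lambda>x. \<bar>v x\<bar> powr p)" for S
      unfolding v_def using p
      by (intro continuous_on_powr' continuous_intros continuous_on_subset[OF contF]) auto
    have u_eq: "u x = (LINT t|lborel. poisson_kernel y (x - t) * f t)"
     and v_eq: "v x = (LINT t|lborel. conj_poisson_kernel y (x - t) * f t)" for x
      using Re_herglotz[OF f, of "of_real x + \<i> * of_real y"] Im_herglotz[OF f, of "of_real x + \<i> * of_real y"] y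
      by (simp_all add: u_def v_def F_def)
    have U: "(\<integral>\<^sup>+x. ennreal (u x powr p) \<partial>lborel) \<le> (\<integral>\<^sup>+t. ennreal (f t powr p) \<partial>lborel)"
      unfolding u_eq by (rule poisson_integral_contraction[OF p(1) y f nn])
    then have Ufin: "(\<integral>\<^sup>+x. ennreal (u x powr p) \<partial>lborel) < \<infinity>" using False by (auto simp: less_top)
    define U where "U = enn2real (\<integral>\<^sup>+x. ennreal (u x powr p) \<partial>lborel)"
    have U_eq: "(\<integral>\<^sup>+x. ennreal (u x powr p) \<partial>lborel) = ennreal U" using Ufin by (simp add: U_def)
    have um[measurable]: "u \<in> borel_measurable borel"
      unfolding u_def by (intro borel_measurable_continuous_onI continuous_intros contF)
    have intu: "integral {- N..N} (\<lambda>x. u x powr p) \<le> U" for N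
    proof -
      have "((\<lambda>x. u x powr p) has_integral U) UNIV"
        using U_eq by (intro nn_integral_has_integral) (auto simp: U_def)
      then have "(\<lambda>x. u x powr p) integrable_on UNIV" "integral UNIV (\<lambda>x. u x powr p) = U" by (auto simp: has_integral_iff)
      then show ?thesis
        using integral_subset_le[of "{-N..N}" UNIV "\<lambda>x. u x powr p"] integrable_continuous_real[OF contu] by auto
    qed
    define I where "I = (\<lambda>N. integral {- N..N} (\<lambda>x. G (of_real x)))"
    have I0: "(I \<longlongrightarrow> 0) at_top"
      unfolding I_def by (rule integral_real_line_tendsto_0[OF holG p(1) decay])
    have vle: "integral {- N..N} (\<lambda>x. \<bar>v x\<bar> powr p) \<le> A * U + \<bar>B\<bar> * cmod (I N)" for N
    proof -
      have intG: "(\<lambda>x. G (of_real x)) integrable_on {- N..N}"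
        by (intro integrable_continuous_real continuous_on_subset[OF contG]) auto
      have ReG: "((\<lambda>x. Re (G (of_real x))) has_integral Re (I N)) {-N..N}"
        using has_integral_Re[OF integrable_integral[OF intG]] by (simp add: I_def)
      have "integral {- N..N} (\<lambda>x. \<bar>v x\<bar> powr p) \<le> integral {- N..N} (\<lambda>x. A * u x powr p - B * Re (G (of_real x)))"
      proof (rule integral_le)
        show "(\<lambda>x. \<bar>v x\<bar> powr p) integrable_on {- N..N}" by (intro integrable_continuous_real contv)
        show "(\<lambda>x. A * u x powr p - B * Re (G (of_real x))) integrable_on {- N..N}"
          by (intro integrable_continuous_real continuous_intros contu continuous_on_subset[OF contG]) auto
        show "\<bar>v x\<bar> powr p \<le> A * u x powr p - B * Re (G (of_real x))" for x
          using AB[OF Repos[of "of_real x"]] by (simp add: u_def v_def G_def)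
      qed
      also have "\<dots> = A * integral {- N..N} (\<lambda>x. u x powr p) - B * Re (I N)"
      proof (rule integral_unique)
        show "((\<lambda>x. A * u x powr p - B * Re (G (of_real x))) has_integral
            A * integral {- N..N} (\<lambda>x. u x powr p) - B * Re (I N)) {- N..N}"
          by (intro has_integral_diff has_integral_mult_right ReG integrable_integral integrable_continuous_real contu)
      qed
      also have "\<dots> \<le> A * U + \<bar>B\<bar> * cmod (I N)"
      proof -
        have "- (B * Re (I N)) \<le> \<bar>B\<bar> * \<bar>Re (I N)\<bar>" by (simp add: abs_mult[symmetric])
        also have "\<dots> \<le> \<bar>B\<bar> * cmod (I N)" by (intro mult_left_mono abs_Re_le_cmod) auto
        finally show ?thesis using mult_left_mono[OF intu[of N] A] by linarith
      qed
      finally show ?thesis .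
    qed
    have "(\<integral>\<^sup>+x. ennreal (\<bar>v x\<bar> powr p) \<partial>lborel) \<le> ennreal (A * U)"
    proof (rule nn_integral_le_of_intervals[where c = "\<lambda>n. A * U + \<bar>B\<bar> * cmod (I (real n))"])
      have "(\<lambda>n. I (real n)) \<longlonglongrightarrow> 0" by (rule filterlim_compose[OF I0 filterlim_real_sequentially])
      then have "(\<lambda>n. A * U + \<bar>B\<bar> * cmod (I (real n))) \<longlonglongrightarrow> A * U + \<bar>B\<bar> * cmod 0"
        by (intro tendsto_intros)
      then show "(\<lambda>n. A * U + \<bar>B\<bar> * cmod (I (real n))) \<longlonglongrightarrow> A * U" by simp
    qed (use contv vle in auto)
    also have "\<dots> \<le> ennreal ((A + 1) * U)"
      by (intro ennreal_leI) (simp add: U_def algebra_simps)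
    also have "\<dots> = ennreal (A + 1) * (\<integral>\<^sup>+x. ennreal (u x powr p) \<partial>lborel)"
      unfolding U_eq using A by (intro ennreal_mult) (auto simp: U_def)
    also have "\<dots> \<le> ennreal (A + 1) * (\<integral>\<^sup>+t. ennreal (f t powr p) \<partial>lborel)"
      by (intro mult_left_mono U) auto
    finally show ?thesis unfolding v_eq .
  qed
  \<comment> \<open>The constant has to be positive, so that the right-hand side is infinite whenever $\int f^p$ is; hence $A+1$.\<close>
  then show ?thesis using A by (intro exI[of _ "A + 1"]) auto
qed

definition conv_op :: "(real \<Rightarrow> real) \<Rightarrow> (real \<Rightarrow> complex) \<Rightarrow> real \<Rightarrow> complex" where
  "conv_op k f x = (LINT y|lborel. of_real (k (x - y)) * f y)"

text \<open>A single radius bounds the values and the support. On this class all integrals converge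
  absolutely for every bounded kernel.\<close>

definition bounded_compact_support :: "(real \<Rightarrow> complex) \<Rightarrow> bool" where
  "bounded_compact_support f \<longleftrightarrow> f \<in> borel_measurable borel \<and>
     (\<exists>R. \<forall>t. cmod (f t) \<le> R \<and> (R < \<bar>t\<bar> \<longrightarrow> f t = 0))"

lemma bounded_compact_supportE:
  assumes "bounded_compact_support f"
  obtains R where "0 < R" "\<And>t. cmod (f t) \<le> R" "\<And>t. R < \<bar>t\<bar> \<Longrightarrow> f t = 0" "f \<in> borel_measurable borel"
proof -
  obtain R where R: "\<And>t. cmod (f t) \<le> R" "\<And>t. R < \<bar>t\<bar> \<Longrightarrow> f t = 0" "f \<in> borel_measurable borel"
    using assms by (auto simp: bounded_compact_support_def)
  show ?thesis by (rule that[of "\<bar>R\<bar> + 1"]) (use R in \<open>auto intro: order_trans[OF R(1)]\<close>)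
qed

lemma bounded_compact_support_integrable:
  assumes "bounded_compact_support f"
  shows "integrable lborel f"
proof -
  obtain R where R: "\<And>t. cmod (f t) \<le> R" "\<And>t. R < \<bar>t\<bar> \<Longrightarrow> f t = 0" "f \<in> borel_measurable borel"
    using bounded_compact_supportE[OF assms] by metis
  show ?thesis
  proof (rule integrableI_bounded_set[of "{-R..R}" _ _ R])
    show "emeasure lborel {-R..R} < \<infinity>" by (simp add: emeasure_lborel_Icc_eq)
    show "f \<in> borel_measurable lborel" using R(3) by simp
    show "AE x\<in>{-R..R} in lborel. cmod (f x) \<le> R" using R(1) by simp
    show "AE x in lborel. x \<notin> {-R..R} \<longrightarrow> f x = 0"
    proof (intro AE_I2 impI)
      fix x assume "x \<notin> {-R..R}"
      then show "f x = 0" by (intro R(2)) (auto simp: abs_if)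
    qed
  qed simp
qed

lemma bounded_compact_support_mult:
  assumes f: "bounded_compact_support f" and h: "h \<in> borel_measurable borel" and hB: "\<And>t. cmod (h t) \<le> B"
  shows "bounded_compact_support (\<lambda>t. h t * f t)"
proof -
  obtain R where R: "0 < R" "\<And>t. cmod (f t) \<le> R" "\<And>t. R < \<bar>t\<bar> \<Longrightarrow> f t = 0" "f \<in> borel_measurable borel"
    using bounded_compact_supportE[OF f] by metis
  have B: "0 \<le> B" using order_trans[OF norm_ge_zero hB] .
  have "cmod (h t * f t) \<le> (B + 1) * R" for t
    unfolding norm_mult using hB[of t] R(2)[of t] B by (intro mult_mono) auto
  moreover have "R \<le> (B + 1) * R" using R(1) B by (simp add: algebra_simps)
  then have "h t * f t = 0" if "(B + 1) * R < \<bar>t\<bar>" for t using R(3)[of t] that by simp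
  ultimately show ?thesis unfolding bounded_compact_support_def
    using R(4) h by (intro conjI exI[of _ "(B + 1) * R"] allI impI) auto
qed

lemma conv_op_measurable[measurable]:
  assumes [measurable]: "k \<in> borel_measurable borel" "f \<in> borel_measurable borel"
  shows "conv_op k f \<in> borel_measurable borel"
  unfolding conv_op_def by measurable

lemma conv_op_integrable:
  fixes f :: "real \<Rightarrow> complex"
  assumes f: "integrable lborel f" and k: "k \<in> borel_measurable borel" "\<And>t. \<bar>k t\<bar> \<le> B"
  shows "integrable lborel (\<lambda>y. of_real (k (x - y)) * f y)"
proof (rule Bochner_Integration.integrable_bound)
  show "integrable lborel (\<lambda>y. B * cmod (f y))" using f by simp
  show "(\<lambda>y. of_real (k (x - y)) * f y) \<in> borel_measurable lborel"
    using borel_measurable_integrable[OF f] k(1) by measurable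
  show "AE y in lborel. cmod (of_real (k (x - y)) * f y) \<le> norm (B * cmod (f y))"
  proof (intro AE_I2)
    fix y
    have "0 \<le> B" using order_trans[OF abs_ge_zero k(2)] .
    then show "cmod (of_real (k (x - y)) * f y) \<le> norm (B * cmod (f y))"
      using k(2)[of "x - y"] by (simp add: norm_mult mult_right_mono)
  qed
qed

lemma conj_poisson_kernel_bounded:
  assumes y: "0 < y"
  shows "\<bar>conj_poisson_kernel y t\<bar> \<le> 1 / (2 * pi * y)"
proof -
  have "2 * \<bar>t\<bar> * y \<le> t\<^sup>2 + y\<^sup>2"
    using zero_le_power2[of "\<bar>t\<bar> - y"] by (simp add: power2_diff)
  moreover have "0 < t\<^sup>2 + y\<^sup>2" using y by (simp add: add_nonneg_pos)
  ultimately have "\<bar>t\<bar> / (t\<^sup>2 + y\<^sup>2) \<le> 1 / (2 * y)"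
    using y by (simp add: field_simps)
  then have "\<bar>t\<bar> / (t\<^sup>2 + y\<^sup>2) / pi \<le> 1 / (2 * y) / pi" by (rule divide_right_mono) simp
  then show ?thesis by (simp add: conj_poisson_kernel_def abs_mult mult_ac)
qed

text \<open>A complex function is split into real and imaginary part, and these into positive and negative part.\<close>

lemma conj_poisson_bound:
  fixes p :: real
  assumes p: "1 < p" "p \<le> 2"
  shows "\<exists>C>0. \<forall>f y. bounded_compact_support f \<longrightarrow> 0 < y \<longrightarrow>
     pth_integral p lborel (conv_op (conj_poisson_kernel y) f) \<le> ennreal C * pth_integral p lborel f"
proof -
  obtain A where A: "A > 0" and bound: "\<And>f R y. integrable lborel f \<Longrightarrow> (\<And>t. 0 \<le> f t) \<Longrightarrow> (\<And>t. R < \<bar>t\<bar> \<Longrightarrow> f t = 0) \<Longrightarrow> 0 < y \<Longrightarrow>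
      (\<integral>\<^sup>+x. ennreal (\<bar>LINT t|lborel. conj_poisson_kernel y (x - t) * f t\<bar> powr p) \<partial>lborel)
        \<le> ennreal A * (\<integral>\<^sup>+t. ennreal (f t powr p) \<partial>lborel)"
    using conj_poisson_integral_bound_nonneg[OF p] by blast
  define c where "c = (2::real) powr p"
  have c: "c > 0" by (simp add: c_def)
  define A' where "A' = c * (2 * A)"
  have A': "A' > 0" using A c by (simp add: A'_def)
  define C where "C = c * (2 * A')"
  have "pth_integral p lborel (conv_op (conj_poisson_kernel y) f) \<le> ennreal C * pth_integral p lborel f"
    if f: "bounded_compact_support f" and y: "0 < y" for f y
  proof -
    obtain R where R: "0 < R" "\<And>t. cmod (f t) \<le> R" "\<And>t. R < \<bar>t\<bar> \<Longrightarrow> f t = 0" "f \<in> borel_measurable borel"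
      using bounded_compact_supportE[OF f] by metis
    define N where "N = pth_integral p lborel f"
    define Q where "Q = (\<lambda>g x. LINT t|lborel. conj_poisson_kernel y (x - t) * g t)"
    have fint: "integrable lborel f" by (rule bounded_compact_support_integrable[OF f])
    have intQ: "integrable lborel (\<lambda>t. conj_poisson_kernel y (x - t) * g t)" if "integrable lborel g" for g :: "real \<Rightarrow> real" and x
      using integrable_conj_poisson[OF that, of "Complex x y"] y by simp
    have Qm[measurable]: "Q g \<in> borel_measurable borel" if [measurable]: "g \<in> borel_measurable borel" for g
      unfolding Q_def by measurable
    have nonneg: "pth_integral p lborel (\<lambda>x. of_real (Q g x)) \<le> ennreal A * N"
      if g: "integrable lborel g" "\<And>t. 0 \<le> g t" "\<And>t. g t \<le> cmod (f t)" for g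
    proof -
      have "pth_integral p lborel (\<lambda>x. of_real (Q g x)) \<le> ennreal A * (\<integral>\<^sup>+t. ennreal (g t powr p) \<partial>lborel)"
        unfolding pth_integral_def Q_def norm_of_real
      proof (rule bound[OF g(1) g(2) _ y])
        show "g t = 0" if "R < \<bar>t\<bar>" for t using g(2)[of t] g(3)[of t] R(3)[OF that] by simp
      qed
      also have "(\<integral>\<^sup>+t. ennreal (g t powr p) \<partial>lborel) \<le> N"
        unfolding N_def pth_integral_def using g p by (intro nn_integral_mono ennreal_leI powr_mono2) auto
      finally show ?thesis by (simp add: mult_left_mono)
    qed
    have real: "pth_integral p lborel (\<lambda>x. of_real (Q g x)) \<le> ennreal A' * N"
      if g: "integrable lborel g" "\<And>t. \<bar>g t\<bar> \<le> cmod (f t)" for g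
    proof -
      have gm[measurable]: "g \<in> borel_measurable borel" using g by auto
      define g1 g2 where "g1 = (\<lambda>t. max 0 (g t))" and "g2 = (\<lambda>t. max 0 (- g t))"
      have gi: "integrable lborel g1" "integrable lborel g2" using g(1) by (auto simp: g1_def g2_def)
      have [measurable]: "g1 \<in> borel_measurable borel" "g2 \<in> borel_measurable borel" by (auto simp: g1_def g2_def)
      have "Q g x = Q g1 x - Q g2 x" for x
      proof -
        have "Q g x = (LINT t|lborel. conj_poisson_kernel y (x - t) * g1 t - conj_poisson_kernel y (x - t) * g2 t)"
          unfolding Q_def by (intro Bochner_Integration.integral_cong) (auto simp: g1_def g2_def max_def)
        then show ?thesis using intQ[OF gi(1)] intQ[OF gi(2)] by (simp add: Q_def)
      qed
      then have "pth_integral p lborel (\<lambda>x. of_real (Q g x)) = pth_integral p lborel (\<lambda>x. of_real (Q g1 x) + (- of_real (Q g2 x)))"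
        by simp
      also have "\<dots> \<le> ennreal c * (pth_integral p lborel (\<lambda>x. of_real (Q g1 x)) + pth_integral p lborel (\<lambda>x. - of_real (Q g2 x)))"
        unfolding c_def using p by (intro pth_integral_add_le) auto
      also have "\<dots> \<le> ennreal c * (ennreal A * N + ennreal A * N)"
      proof (intro mult_left_mono add_mono)
        show "pth_integral p lborel (\<lambda>x. of_real (Q g1 x)) \<le> ennreal A * N"
          by (rule nonneg[OF gi(1)]) (use g(2) in \<open>auto simp: g1_def intro: order_trans[OF abs_ge_self]\<close>)
        have "pth_integral p lborel (\<lambda>x. - of_real (Q g2 x)) = pth_integral p lborel (\<lambda>x. of_real (Q g2 x))"
          by (simp add: pth_integral_def)
        also have "\<dots> \<le> ennreal A * N"
          by (rule nonneg[OF gi(2)]) (use g(2) in \<open>auto simp: g2_def intro: order_trans[OF abs_ge_minus_self]\<close>)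
        finally show "pth_integral p lborel (\<lambda>x. - of_real (Q g2 x)) \<le> ennreal A * N" .
      qed auto
      also have "\<dots> = ennreal A' * N"
        using c A by (simp add: A'_def ennreal_mult mult_2[symmetric] mult.assoc)
      finally show ?thesis .
    qed
    have Ri: "integrable lborel (\<lambda>t. Re (f t))" "integrable lborel (\<lambda>t. Im (f t))" using fint by auto
    have [measurable]: "f \<in> borel_measurable borel" by fact
    have split: "conv_op (conj_poisson_kernel y) f x = of_real (Q (\<lambda>t. Re (f t)) x) + \<i> * of_real (Q (\<lambda>t. Im (f t)) x)" for x
    proof -
      have int: "integrable lborel (\<lambda>t. of_real (conj_poisson_kernel y (x - t)) * f t)"
        using conj_poisson_kernel_bounded[OF y] by (intro conv_op_integrable[OF fint]) auto
      show ?thesis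
        using integral_Re[OF int] integral_Im[OF int]
        by (simp add: complex_eq_iff conv_op_def Q_def)
    qed
    have "pth_integral p lborel (conv_op (conj_poisson_kernel y) f)
       \<le> ennreal c * (pth_integral p lborel (\<lambda>x. of_real (Q (\<lambda>t. Re (f t)) x)) + pth_integral p lborel (\<lambda>x. \<i> * of_real (Q (\<lambda>t. Im (f t)) x)))"
      unfolding c_def split using p by (intro pth_integral_add_le) auto
    also have "pth_integral p lborel (\<lambda>x. \<i> * of_real (Q (\<lambda>t. Im (f t)) x)) = pth_integral p lborel (\<lambda>x. of_real (Q (\<lambda>t. Im (f t)) x))"
      by (simp add: pth_integral_def norm_mult)
    also have "ennreal c * (pth_integral p lborel (\<lambda>x. of_real (Q (\<lambda>t. Re (f t)) x)) + pth_integral p lborel (\<lambda>x. of_real (Q (\<lambda>t. Im (f t)) x)))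
        \<le> ennreal c * (ennreal A' * N + ennreal A' * N)"
      by (intro mult_left_mono add_mono real Ri abs_Re_le_cmod abs_Im_le_cmod) auto
    also have "\<dots> = ennreal C * N"
      using c A' by (simp add: C_def ennreal_mult mult_2[symmetric] mult.assoc)
    finally show ?thesis unfolding N_def .
  qed
  then show ?thesis using A c by (intro exI[of _ C]) (auto simp: C_def A'_def)
qed

section \<open>The Dirichlet operator on the line\<close>

text \<open>The factor of the Dirichlet kernel that belongs to one coordinate.\<close>

definition dirichlet_kernel1 :: "real \<Rightarrow> real \<Rightarrow> real" where
  "dirichlet_kernel1 \<omega> t = (if t = 0 then \<omega> / pi else sin (\<omega> * t) / (pi * t))"

lemma dirichlet_kernel1_measurable[measurable]: "dirichlet_kernel1 \<omega> \<in> borel_measurable borel"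
  unfolding dirichlet_kernel1_def by measurable

lemma dirichlet_kernel1_minus: "dirichlet_kernel1 \<omega> (- t) = dirichlet_kernel1 \<omega> t"
  by (simp add: dirichlet_kernel1_def)

lemma dirichlet_kernel1_le:
  assumes "0 < \<omega>"
  shows "\<bar>dirichlet_kernel1 \<omega> t\<bar> \<le> \<omega> / pi"
proof (cases "t = 0")
  case False
  have "\<bar>sin (\<omega> * t)\<bar> \<le> \<omega> * \<bar>t\<bar>" using abs_sin_x_le_abs_x[of "\<omega> * t"] assms by (simp add: abs_mult)
  then have "\<bar>sin (\<omega> * t)\<bar> / \<bar>t\<bar> \<le> \<omega>" using False by (simp add: field_simps)
  then have "\<bar>sin (\<omega> * t)\<bar> / \<bar>t\<bar> / pi \<le> \<omega> / pi" by (rule divide_right_mono) simp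
  then show ?thesis using False by (simp add: dirichlet_kernel1_def abs_mult mult_ac)
qed (use assms in \<open>simp add: dirichlet_kernel1_def\<close>)

text \<open>The sine addition theorem turns the convolution with $\sin(\omega t)\,t/(\pi(t^2+\epsilon^2))$ into two
  conjugate Poisson integrals at height $\epsilon$, multiplied by bounded functions. These kernels are
  dominated by the Dirichlet kernel and converge to it for $t\ne 0$ as $\epsilon\to 0$.\<close>

lemma dirichlet_bound_bounded_support_small_p:
  fixes p :: real
  assumes p: "1 < p" "p \<le> 2"
  shows "\<exists>C>0. \<forall>f \<omega>. bounded_compact_support f \<longrightarrow> 0 < \<omega> \<longrightarrow>
     pth_integral p lborel (conv_op (dirichlet_kernel1 \<omega>) f) \<le> ennreal C * pth_integral p lborel f"
proof -
  obtain A where A: "A > 0" and bound: "\<And>f y. bounded_compact_support f \<Longrightarrow> 0 < y \<Longrightarrow>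
     pth_integral p lborel (conv_op (conj_poisson_kernel y) f) \<le> ennreal A * pth_integral p lborel f"
    using conj_poisson_bound[OF p] by blast
  define c where "c = (2::real) powr p"
  have c: "c > 0" by (simp add: c_def)
  have "pth_integral p lborel (conv_op (dirichlet_kernel1 \<omega>) f) \<le> ennreal (c * (2 * A)) * pth_integral p lborel f"
    if f: "bounded_compact_support f" and om: "0 < \<omega>" for f \<omega>
  proof -
    define N where "N = pth_integral p lborel f"
    have [measurable]: "f \<in> borel_measurable borel" using f by (simp add: bounded_compact_support_def)
    have fint: "integrable lborel f" by (rule bounded_compact_support_integrable[OF f])
    define k where "k = (\<lambda>\<epsilon> t. sin (\<omega> * t) * conj_poisson_kernel \<epsilon> t)"
    have km[measurable]: "k \<epsilon> \<in> borel_measurable borel" for \<epsilon> unfolding k_def by measurable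
    have step: "pth_integral p lborel (conv_op (k \<epsilon>) f) \<le> ennreal (c * (2 * A)) * N" if eps: "0 < \<epsilon>" for \<epsilon>
    proof -
      define fc fs where "fc = (\<lambda>t. of_real (cos (\<omega> * t)) * f t)" and "fs = (\<lambda>t. of_real (sin (\<omega> * t)) * f t)"
      have bc: "bounded_compact_support fc" "bounded_compact_support fs"
        unfolding fc_def fs_def by (rule bounded_compact_support_mult[OF f, of _ 1]; simp)+
      have [measurable]: "fc \<in> borel_measurable borel" "fs \<in> borel_measurable borel"
        unfolding fc_def fs_def by measurable
      have int: "integrable lborel (\<lambda>t. of_real (conj_poisson_kernel \<epsilon> (x - t)) * fc t)"
         "integrable lborel (\<lambda>t. of_real (conj_poisson_kernel \<epsilon> (x - t)) * fs t)" for x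
        using conj_poisson_kernel_bounded[OF eps]
        by (intro conv_op_integrable bounded_compact_support_integrable bc; auto)+
      define Qc Qs where "Qc = conv_op (conj_poisson_kernel \<epsilon>) fc" and "Qs = conv_op (conj_poisson_kernel \<epsilon>) fs"
      have [measurable]: "Qc \<in> borel_measurable borel" "Qs \<in> borel_measurable borel"
        unfolding Qc_def Qs_def by measurable
      have split: "conv_op (k \<epsilon>) f x = of_real (sin (\<omega> * x)) * Qc x + (- (of_real (cos (\<omega> * x)) * Qs x))" for x
      proof -
        have "conv_op (k \<epsilon>) f x = (LINT t|lborel. of_real (sin (\<omega> * x)) * (of_real (conj_poisson_kernel \<epsilon> (x - t)) * fc t)
            - of_real (cos (\<omega> * x)) * (of_real (conj_poisson_kernel \<epsilon> (x - t)) * fs t))"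
          unfolding conv_op_def
        proof (rule Bochner_Integration.integral_cong[OF refl])
          fix t
          have "sin (\<omega> * (x - t)) = sin (\<omega> * x) * cos (\<omega> * t) - cos (\<omega> * x) * sin (\<omega> * t)"
            by (simp add: right_diff_distrib sin_diff)
          then show "of_real (k \<epsilon> (x - t)) * f t = of_real (sin (\<omega> * x)) * (of_real (conj_poisson_kernel \<epsilon> (x - t)) * fc t)
            - of_real (cos (\<omega> * x)) * (of_real (conj_poisson_kernel \<epsilon> (x - t)) * fs t)"
            by (simp only: k_def fc_def fs_def of_real_mult of_real_diff) (simp add: algebra_simps)
        qed
        also have "\<dots> = of_real (sin (\<omega> * x)) * Qc x - of_real (cos (\<omega> * x)) * Qs x"
          using int[of x] by (simp add: Qc_def Qs_def conv_op_def)
        finally show ?thesis by simp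
      qed
      have "pth_integral p lborel (conv_op (k \<epsilon>) f) \<le> ennreal c * (pth_integral p lborel (\<lambda>x. of_real (sin (\<omega> * x)) * Qc x)
            + pth_integral p lborel (\<lambda>x. - (of_real (cos (\<omega> * x)) * Qs x)))"
        unfolding c_def split using p by (intro pth_integral_add_le) auto
      also have "\<dots> \<le> ennreal c * (ennreal A * N + ennreal A * N)"
      proof (intro mult_left_mono add_mono)
        have "pth_integral p lborel (\<lambda>x. of_real (sin (\<omega> * x)) * Qc x) \<le> pth_integral p lborel Qc"
          using p by (intro pth_integral_mono) (auto simp: norm_mult intro!: mult_left_le_one_le)
        also have "\<dots> \<le> ennreal A * pth_integral p lborel fc" unfolding Qc_def by (rule bound[OF bc(1) eps])
        also have "\<dots> \<le> ennreal A * N" unfolding N_def fc_def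
          using p by (intro mult_left_mono pth_integral_mono) (auto simp: norm_mult intro!: mult_left_le_one_le)
        finally show "pth_integral p lborel (\<lambda>x. of_real (sin (\<omega> * x)) * Qc x) \<le> ennreal A * N" .
        have "pth_integral p lborel (\<lambda>x. - (of_real (cos (\<omega> * x)) * Qs x)) \<le> pth_integral p lborel Qs"
          using p by (intro pth_integral_mono) (auto simp: norm_mult intro!: mult_left_le_one_le)
        also have "\<dots> \<le> ennreal A * pth_integral p lborel fs" unfolding Qs_def by (rule bound[OF bc(2) eps])
        also have "\<dots> \<le> ennreal A * N" unfolding N_def fs_def
          using p by (intro mult_left_mono pth_integral_mono) (auto simp: norm_mult intro!: mult_left_le_one_le)
        finally show "pth_integral p lborel (\<lambda>x. - (of_real (cos (\<omega> * x)) * Qs x)) \<le> ennreal A * N" .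
      qed auto
      also have "\<dots> = ennreal (c * (2 * A)) * N"
        using c A by (simp add: ennreal_mult mult_2[symmetric] mult.assoc)
      finally show ?thesis .
    qed
    define e where "e = (\<lambda>n::nat. 1 / (real n + 1))"
    have e: "e n > 0" for n by (simp add: e_def)
    have e0: "e \<longlonglongrightarrow> 0" unfolding e_def using LIMSEQ_inverse_real_of_nat by (simp add: inverse_eq_divide add.commute)
    have klim: "(\<lambda>n. k (e n) t) \<longlonglongrightarrow> dirichlet_kernel1 \<omega> t" if t: "t \<noteq> 0" for t
    proof -
      have "(\<lambda>n. sin (\<omega> * t) * (t / (pi * (t\<^sup>2 + (e n)\<^sup>2)))) \<longlonglongrightarrow> sin (\<omega> * t) * (t / (pi * (t\<^sup>2 + 0\<^sup>2)))"
        using t by (intro tendsto_intros e0) auto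
      moreover have "sin (\<omega> * t) * (t / (pi * (t\<^sup>2 + 0\<^sup>2))) = dirichlet_kernel1 \<omega> t"
        using t by (simp add: dirichlet_kernel1_def power2_eq_square)
      ultimately show ?thesis by (simp add: k_def conj_poisson_kernel_def)
    qed
    have kb: "\<bar>k (e n) t\<bar> \<le> \<omega> / pi" for n t
    proof (cases "t = 0")
      case False
      define s where "s = t\<^sup>2 + (e n)\<^sup>2"
      have s: "0 < s" "t\<^sup>2 \<le> s" using e[of n] by (auto simp: s_def add_nonneg_pos)
      have "k (e n) t = dirichlet_kernel1 \<omega> t * (t\<^sup>2 / s)"
        using False by (simp add: k_def conj_poisson_kernel_def dirichlet_kernel1_def s_def power2_eq_square)
      then have "\<bar>k (e n) t\<bar> = \<bar>dirichlet_kernel1 \<omega> t\<bar> * (t\<^sup>2 / s)"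
        using s by (simp add: abs_mult)
      also have "\<dots> \<le> \<bar>dirichlet_kernel1 \<omega> t\<bar> * 1"
        using s by (intro mult_left_mono) auto
      finally show ?thesis using dirichlet_kernel1_le[OF om, of t] by simp
    qed (use om in \<open>simp add: k_def\<close>)
    have "pth_integral p lborel (conv_op (dirichlet_kernel1 \<omega>) f) \<le> ennreal (c * (2 * A)) * N"
    proof (rule pth_integral_le_of_tendsto[where h = "\<lambda>n. conv_op (k (e n)) f"])
      show "pth_integral p lborel (conv_op (k (e n)) f) \<le> ennreal (c * (2 * A)) * N" for n by (rule step[OF e])
      show "(\<lambda>n. conv_op (k (e n)) f x) \<longlonglongrightarrow> conv_op (dirichlet_kernel1 \<omega>) f x" for x
        unfolding conv_op_def
      proof (rule integral_dominated_convergence[where w = "\<lambda>t. \<omega> / pi * cmod (f t)"])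
        show "integrable lborel (\<lambda>t. \<omega> / pi * cmod (f t))" using fint by simp
        show "AE t in lborel. (\<lambda>n. of_real (k (e n) (x - t)) * f t) \<longlonglongrightarrow> of_real (dirichlet_kernel1 \<omega> (x - t)) * f t"
          using AE_lborel_singleton[of x] by eventually_elim (intro tendsto_intros klim, auto)
        show "AE t in lborel. cmod (of_real (k (e n) (x - t)) * f t) \<le> \<omega> / pi * cmod (f t)" for n
          by (intro AE_I2) (simp add: norm_mult mult_right_mono kb del: times_divide_eq_left)
      qed measurable
    qed (use p in auto)
    then show ?thesis by (simp add: N_def)
  qed
  then show ?thesis using A c by (intro exI[of _ "c * (2 * A)"]) auto
qed

lemma conv_op_norm_le:
  assumes f: "integrable lborel f" and k: "k \<in> borel_measurable borel" "\<And>t. \<bar>k t\<bar> \<le> B"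
  shows "cmod (conv_op k f x) \<le> B * (LINT t|lborel. cmod (f t))"
proof -
  have "cmod (conv_op k f x) \<le> (LINT t|lborel. B * cmod (f t))"
    unfolding conv_op_def
  proof (rule Bochner_Integration.integral_norm_bound_integral)
    show "cmod (of_real (k (x - t)) * f t) \<le> B * cmod (f t)" for t
      using k(2) by (simp add: norm_mult mult_right_mono)
  qed (use f conv_op_integrable[OF f k] in auto)
  then show ?thesis by simp
qed

text \<open>Fubini's theorem: for bounded functions with bounded support the double integral converges
  absolutely, and evenness of the kernel exchanges the roles of $f$ and $g$.\<close>

lemma conv_op_symmetric:
  assumes f: "bounded_compact_support f" and g: "bounded_compact_support g"
    and k[measurable]: "k \<in> borel_measurable borel" and kB: "\<And>t. \<bar>k t\<bar> \<le> B" and even: "\<And>t. k (- t) = k t"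
  shows "(LINT x|lborel. conv_op k f x * g x) = (LINT y|lborel. f y * conv_op k g y)"
proof -
  obtain R where R: "0 < R" "\<And>t. cmod (f t) \<le> R" "\<And>t. R < \<bar>t\<bar> \<Longrightarrow> f t = 0" and fm[measurable]: "f \<in> borel_measurable borel"
    using bounded_compact_supportE[OF f] by metis
  obtain T where T: "0 < T" "\<And>t. cmod (g t) \<le> T" "\<And>t. T < \<bar>t\<bar> \<Longrightarrow> g t = 0" and gm[measurable]: "g \<in> borel_measurable borel"
    using bounded_compact_supportE[OF g] by metis
  have B: "0 \<le> B" using order_trans[OF abs_ge_zero kB] .
  define h where "h = (\<lambda>x y. of_real (k (x - y)) * f y * g x)"
  have "integrable (lborel \<Otimes>\<^sub>M lborel) (case_prod h)"
  proof (rule integrableI_bounded_set[of "{-T..T} \<times> {-R..R}" _ _ "B * R * T"])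
    show "{-T..T} \<times> {-R..R} \<in> sets (lborel \<Otimes>\<^sub>M lborel)" by (intro pair_measureI) auto
    have "emeasure (lborel \<Otimes>\<^sub>M lborel) ({-T..T} \<times> {-R..R}) = emeasure lborel {-T..T} * emeasure lborel {-R..R}"
      by (rule lborel.emeasure_pair_measure_Times) auto
    then show "emeasure (lborel \<Otimes>\<^sub>M lborel) ({-T..T} \<times> {-R..R}) < \<infinity>"
      using R T by (simp add: ennreal_mult_less_top)
    show "case_prod h \<in> borel_measurable (lborel \<Otimes>\<^sub>M lborel)" unfolding h_def by measurable
    have "cmod (h x y) \<le> B * R * T" for x y
      unfolding h_def norm_mult using kB[of "x - y"] R T B by (intro mult_mono) auto
    then show "AE z\<in>{-T..T} \<times> {-R..R} in lborel \<Otimes>\<^sub>M lborel. cmod (case_prod h z) \<le> B * R * T" by auto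
    have h0: "h x y = 0" if "(x, y) \<notin> {-T..T} \<times> {-R..R}" for x y
    proof -
      have "T < \<bar>x\<bar> \<or> R < \<bar>y\<bar>" using that by (auto simp: abs_if)
      then show ?thesis using R(3) T(3) by (auto simp: h_def)
    qed
    then show "AE z in lborel \<Otimes>\<^sub>M lborel. z \<notin> {-T..T} \<times> {-R..R} \<longrightarrow> case_prod h z = 0"
      by (intro AE_I2 impI) (metis h0 split_conv surj_pair)
  qed
  then have "(LINT y|lborel. LINT x|lborel. h x y) = (LINT x|lborel. LINT y|lborel. h x y)"
    by (rule lborel_pair.Fubini_integral)
  moreover have "(LINT y|lborel. h x y) = conv_op k f x * g x" for x
    by (simp add: h_def conv_op_def)
  moreover have "(LINT x|lborel. h x y) = f y * conv_op k g y" for y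
  proof -
    have "k (x - y) = k (y - x)" for x using even[of "x - y"] by simp
    then have "(LINT x|lborel. h x y) = (LINT x|lborel. f y * (of_real (k (y - x)) * g x))"
      by (simp add: h_def mult_ac)
    then show ?thesis by (simp add: conv_op_def)
  qed
  ultimately show ?thesis by simp
qed

text \<open>Absorbs a term into the left-hand side. Finiteness of \<open>I\<close> is essential: \<open>I = \<infinity>\<close> satisfies the
  first assumption for every \<open>J\<close>.\<close>

lemma ennreal_le_of_le_half:
  fixes I J :: ennreal
  assumes "I \<le> J + ennreal (1 / 2) * I" "I < \<infinity>"
  shows "I \<le> 2 * J"
proof (cases "J = \<infinity>")
  case False
  obtain i j where ij: "I = ennreal i" "J = ennreal j" "0 \<le> i" "0 \<le> j"
    using assms(2) False by (metis enn2real_nonneg ennreal_enn2real infinity_ennreal_def less_top)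
  have "ennreal (1 / 2 * i) = ennreal (1 / 2) * ennreal i" using ij by (intro ennreal_mult) auto
  moreover have "ennreal (j + 1 / 2 * i) = ennreal j + ennreal (1 / 2 * i)" using ij by (intro ennreal_plus) auto
  ultimately have "ennreal i \<le> ennreal (j + 1 / 2 * i)" using assms(1) unfolding ij(1,2) by (simp only:)
  then have "i \<le> j + 1 / 2 * i" using ij by (subst (asm) ennreal_le_iff) auto
  then have "i \<le> 2 * j" by simp
  then have "ennreal i \<le> ennreal (2 * j)" by (rule ennreal_leI)
  then show ?thesis using ij by (simp add: ennreal_mult)
qed (simp add: ennreal_mult_top)

text \<open>Duality. Let $q$ be the exponent conjugate to $p$, so that $1<q<2$, and let $h=S_\omega f$. Testing
  $h$ against $g=\overline{h}|h|^{p-2}$, cut off to $[-n,n]$, gives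
  $\int_{[-n,n]}|h|^p=\int hg=\int f\,S_\omega g$, because the kernel is even. By Young's inequality with weight
  \<open>l\<close> this is at most $l^p\int|f|^p+l^{-q}\int|S_\omega g|^q$, and the bound for $q$ estimates the
  last term by a multiple of $\int|g|^q=\int_{[-n,n]}|h|^p$. The weight is chosen so that half
  of the left-hand side can be absorbed.\<close>

lemma dirichlet_bound_bounded_support_large_p:
  fixes p :: real
  assumes p: "2 < p"
  shows "\<exists>C>0. \<forall>f \<omega>. bounded_compact_support f \<longrightarrow> 0 < \<omega> \<longrightarrow>
     pth_integral p lborel (conv_op (dirichlet_kernel1 \<omega>) f) \<le> ennreal C * pth_integral p lborel f"
proof -
  define q where "q = p / (p - 1)"
  have q: "1 < q" "q \<le> 2" and pq: "(p - 1) * q = p" "1 / p + 1 / q = 1"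
    using p by (auto simp: q_def field_simps)
  obtain C where C: "C > 0" and bound: "\<And>f \<omega>. bounded_compact_support f \<Longrightarrow> 0 < \<omega> \<Longrightarrow>
     pth_integral q lborel (conv_op (dirichlet_kernel1 \<omega>) f) \<le> ennreal C * pth_integral q lborel f"
    using dirichlet_bound_bounded_support_small_p[OF q] by blast
  define l where "l = (2 * C) powr (1 / q)"
  have l: "l > 0" using C by (simp add: l_def)
  have lq: "l powr q = 2 * C" using C q by (simp add: l_def powr_powr)
  have "pth_integral p lborel (conv_op (dirichlet_kernel1 \<omega>) f) \<le> ennreal (2 * l powr p) * pth_integral p lborel f"
    if f: "bounded_compact_support f" and om: "0 < \<omega>" for f \<omega>
  proof -
    define k where "k = dirichlet_kernel1 \<omega>"
    have km[measurable]: "k \<in> borel_measurable borel" by (simp add: k_def)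
    have kB: "\<bar>k t\<bar> \<le> \<omega> / pi" for t unfolding k_def by (rule dirichlet_kernel1_le[OF om])
    have fm[measurable]: "f \<in> borel_measurable borel" using f by (simp add: bounded_compact_support_def)
    have fint: "integrable lborel f" by (rule bounded_compact_support_integrable[OF f])
    define h where "h = conv_op k f"
    have hm[measurable]: "h \<in> borel_measurable borel" unfolding h_def by measurable
    define H where "H = \<omega> / pi * (LINT t|lborel. cmod (f t))"
    have hH: "cmod (h x) \<le> H" for x unfolding h_def H_def by (rule conv_op_norm_le[OF fint km kB])
    have H0: "0 \<le> H" using order_trans[OF norm_ge_zero hH] .
    have trunc: "pth_integral p lborel (\<lambda>x. if \<bar>x\<bar> \<le> real n then h x else 0) \<le> ennreal (2 * l powr p) * pth_integral p lborel f" for n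
    proof -
      define g where "g = (\<lambda>x. if \<bar>x\<bar> \<le> real n then cnj (h x) * of_real (cmod (h x) powr (p - 2)) else 0)"
      have [measurable]: "cnj \<in> borel_measurable borel"
        by (intro borel_measurable_continuous_onI continuous_intros)
      have gm[measurable]: "g \<in> borel_measurable borel" unfolding g_def by measurable
      have ng: "cmod (g x) = (if \<bar>x\<bar> \<le> real n then cmod (h x) powr (p - 1) else 0)" for x
        using powr_mult_base[of "cmod (h x)" "p - 2"] by (simp add: g_def norm_mult)
      have bg: "bounded_compact_support g"
        unfolding bounded_compact_support_def
      proof (intro conjI exI allI impI)
        have "cmod (h x) powr (p - 1) \<le> H powr (p - 1)" for x using hH p by (intro powr_mono2) auto
        then show "cmod (g x) \<le> H powr (p - 1) + real n" for x by (simp add: ng add_increasing2)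
        show "g x = 0" if "H powr (p - 1) + real n < \<bar>x\<bar>" for x
        proof -
          have "real n < \<bar>x\<bar>" using that powr_ge_zero[of H "p - 1"] by linarith
          then show ?thesis by (simp add: g_def)
        qed
      qed simp
      define I where "I = pth_integral p lborel (\<lambda>x. if \<bar>x\<bar> \<le> real n then h x else 0)"
      have Iq: "pth_integral q lborel g = I"
        unfolding pth_integral_def I_def ng using p q by (intro nn_integral_cong) (auto simp: powr_powr pq)
      have hg: "h x * g x = of_real (cmod (if \<bar>x\<bar> \<le> real n then h x else 0) powr p)" for x
      proof -
        have "(cmod (h x))\<^sup>2 * cmod (h x) powr (p - 2) = cmod (h x) powr p"
          using powr_mult_base[of "cmod (h x)" "p - 2"] powr_mult_base[of "cmod (h x)" "p - 1"]
          by (simp add: power2_eq_square mult.assoc)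
        then have e: "complex_of_real ((cmod (h x))\<^sup>2) * of_real (cmod (h x) powr (p - 2)) = of_real (cmod (h x) powr p)"
          by (simp only: of_real_mult[symmetric])
        have "h x * cnj (h x) = complex_of_real ((cmod (h x))\<^sup>2)" by (simp only: complex_norm_square)
        then have "h x * (cnj (h x) * of_real (cmod (h x) powr (p - 2))) = of_real (cmod (h x) powr p)"
          using e by (simp only: mult.assoc[symmetric])
        then show ?thesis using p by (simp add: g_def)
      qed
      define r where "r = (\<lambda>x. cmod (if \<bar>x\<bar> \<le> real n then h x else 0) powr p)"
      have rm[measurable]: "r \<in> borel_measurable borel" unfolding r_def by measurable
      have rint: "integrable lborel r"
      proof (rule integrableI_bounded_set[of "{- real n..real n}" _ _ "H powr p"])
        show "AE x\<in>{- real n..real n} in lborel. norm (r x) \<le> H powr p"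
          using hH H0 p by (intro AE_I2) (auto simp: r_def intro!: powr_mono2)
        show "AE x in lborel. x \<notin> {- real n..real n} \<longrightarrow> r x = 0"
          using p by (intro AE_I2) (auto simp: r_def abs_if)
      qed auto
      have I_eq: "I = ennreal (LINT x|lborel. r x)"
        unfolding I_def pth_integral_def using rint
        by (subst nn_integral_eq_integral[symmetric]) (auto simp: r_def)
      then have Ifin: "I < \<infinity>" by simp
      define G where "G = conv_op k g"
      have Gm[measurable]: "G \<in> borel_measurable borel" unfolding G_def by measurable
      have GB: "cmod (G x) \<le> \<omega> / pi * (LINT t|lborel. cmod (g t))" for x
        unfolding G_def by (rule conv_op_norm_le[OF bounded_compact_support_integrable[OF bg] km kB])
      have "complex_of_real (LINT x|lborel. r x) = (LINT x|lborel. h x * g x)"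
        unfolding hg r_def by simp
      also have "\<dots> = (LINT y|lborel. f y * G y)"
        unfolding h_def G_def
        by (rule conv_op_symmetric[OF f bg km kB]) (simp add: k_def dirichlet_kernel1_minus)
      finally have "I = ennreal (cmod (LINT y|lborel. f y * G y))"
        unfolding I_eq by (metis abs_of_nonneg norm_of_real Bochner_Integration.integral_nonneg r_def powr_ge_zero)
      also have "\<dots> \<le> (\<integral>\<^sup>+y. cmod (f y * G y) \<partial>lborel)"
      proof (rule integral_norm_bound_ennreal)
        have "integrable lborel (\<lambda>y. G y * f y)"
          by (rule bounded_compact_support_integrable[OF bounded_compact_support_mult[OF f Gm GB]])
        then show "integrable lborel (\<lambda>y. f y * G y)" by (simp add: mult.commute)
      qed
      also have "\<dots> \<le> (\<integral>\<^sup>+y. ennreal (l powr p) * ennreal (cmod (f y) powr p) + ennreal (1 / (2 * C)) * ennreal (cmod (G y) powr q) \<partial>lborel)"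
      proof (rule nn_integral_mono)
        fix y
        have "cmod (f y * G y) = (l * cmod (f y)) * (cmod (G y) / l)" using l by (simp add: norm_mult)
        also have "\<dots> \<le> (l * cmod (f y)) powr p / p + (cmod (G y) / l) powr q / q"
          using p q pq l by (intro Youngs_inequality) auto
        also have "\<dots> \<le> (l * cmod (f y)) powr p / 1 + (cmod (G y) / l) powr q / 1"
          using p q by (intro add_mono divide_left_mono) auto
        also have "\<dots> = l powr p * cmod (f y) powr p + 1 / (2 * C) * cmod (G y) powr q"
          using l by (simp add: powr_mult powr_divide lq)
        finally show "ennreal (cmod (f y * G y)) \<le> ennreal (l powr p) * ennreal (cmod (f y) powr p) + ennreal (1 / (2 * C)) * ennreal (cmod (G y) powr q)"
          using C by (simp add: ennreal_mult[symmetric] ennreal_plus[symmetric] ennreal_leI del: ennreal_plus)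
      qed
      also have "\<dots> = ennreal (l powr p) * pth_integral p lborel f + ennreal (1 / (2 * C)) * pth_integral q lborel G"
        by (simp add: pth_integral_def nn_integral_add nn_integral_cmult)
      also have "\<dots> \<le> ennreal (l powr p) * pth_integral p lborel f + ennreal (1 / (2 * C)) * (ennreal C * I)"
        unfolding G_def k_def using bound[OF bg om] Iq by (intro add_left_mono mult_left_mono) auto
      also have "ennreal (1 / (2 * C)) * (ennreal C * I) = ennreal (1 / 2) * I"
        using C by (simp add: mult.assoc[symmetric] ennreal_mult[symmetric])
      finally have "I \<le> 2 * (ennreal (l powr p) * pth_integral p lborel f)"
        using Ifin by (rule ennreal_le_of_le_half)
      then show ?thesis by (simp add: I_def ennreal_mult mult.assoc)
    qed
    have "pth_integral p lborel h \<le> ennreal (2 * l powr p) * pth_integral p lborel f"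
    proof (rule pth_integral_le_of_tendsto[OF _ _ trunc])
      fix x
      have "\<forall>\<^sub>F n in sequentially. (if \<bar>x\<bar> \<le> real n then h x else 0) = h x"
        using eventually_ge_at_top[of "nat \<lceil>\<bar>x\<bar>\<rceil>"] by eventually_elim (auto simp: nat_le_iff ceiling_le_iff)
      then show "(\<lambda>n. if \<bar>x\<bar> \<le> real n then h x else 0) \<longlonglongrightarrow> h x" by (rule tendsto_eventually)
    qed (use p in auto)
    then show ?thesis by (simp add: h_def k_def)
  qed
  then show ?thesis using l by (intro exI[of _ "2 * l powr p"]) auto
qed

lemma nn_integral_decay_finite:
  fixes h :: "real \<Rightarrow> real"
  assumes q: "1 < q" and h: "\<And>t. \<bar>h t\<bar> \<le> c / (1 + \<bar>t\<bar>)"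
  shows "(\<integral>\<^sup>+t. ennreal (\<bar>h t\<bar> powr q) \<partial>lborel) < \<infinity>"
proof -
  define w where "w = (\<lambda>t::real. (1 + \<bar>t\<bar>) powr - q)"
  have wm[measurable]: "w \<in> borel_measurable borel" unfolding w_def by measurable
  have c: "0 \<le> c" using h[of 0] by simp
  have "(\<integral>\<^sup>+t. ennreal (w t) * indicator {0..} t \<partial>lborel) = (\<integral>\<^sup>+t. ennreal ((1 + t) powr - q) * indicator {0..} t \<partial>lborel)"
    by (intro nn_integral_cong) (auto simp: w_def indicator_def)
  also have "\<dots> = ennreal (0 - (- 1 / (q - 1) * (1 + 0) powr (1 - q)))"
  proof (rule nn_integral_FTC_atLeast)
    show "DERIV (\<lambda>t. - 1 / (q - 1) * (1 + t) powr (1 - q)) x :> (1 + x) powr - q" if "0 \<le> x" for x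
    proof -
      have "DERIV (\<lambda>t. - 1 / (q - 1) * (1 + t) powr (1 - q)) x :> - 1 / (q - 1) * ((1 - q) * (1 + x) powr (1 - q - 1) * 1)"
        using that q by (auto intro!: derivative_eq_intros DERIV_fun_powr[of "\<lambda>t. 1 + t" 1 x "1 - q", simplified])
      moreover have "- 1 / (q - 1) * ((1 - q) * Y * 1) = Y" for Y
        using q by (simp add: field_simps)
      moreover have "1 - q - 1 = - q" by simp
      ultimately show ?thesis by (simp only:)
    qed
    have "filterlim (\<lambda>t::real. 1 + t) at_top at_top"
      by (rule filterlim_tendsto_add_at_top[OF tendsto_const filterlim_ident])
    then have "((\<lambda>t. (1 + t) powr (1 - q)) \<longlongrightarrow> 0) at_top"
      using q by (intro tendsto_neg_powr) auto
    then show "((\<lambda>t. - 1 / (q - 1) * (1 + t) powr (1 - q)) \<longlongrightarrow> 0) at_top"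
      by (rule tendsto_mult_right_zero)
  qed auto
  finally have half: "(\<integral>\<^sup>+t. ennreal (w t) * indicator {0..} t \<partial>lborel) < \<infinity>" by simp
  have "(\<integral>\<^sup>+t. ennreal (w t) * indicator {..0} t \<partial>lborel) = (\<integral>\<^sup>+t. ennreal (w (0 + (-1) * t)) * indicator {..0} (0 + (-1) * t) \<partial>lborel)"
    by (subst nn_integral_real_affine[of _ "-1" 0]) auto
  also have "\<dots> = (\<integral>\<^sup>+t. ennreal (w t) * indicator {0..} t \<partial>lborel)"
    by (intro nn_integral_cong) (auto simp: w_def indicator_def)
  finally have half': "(\<integral>\<^sup>+t. ennreal (w t) * indicator {..0} t \<partial>lborel) < \<infinity>" using half by simp
  have "(\<integral>\<^sup>+t. ennreal (\<bar>h t\<bar> powr q) \<partial>lborel)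
      \<le> (\<integral>\<^sup>+t. ennreal (c powr q) * (ennreal (w t) * indicator {0..} t + ennreal (w t) * indicator {..0} t) \<partial>lborel)"
  proof (rule nn_integral_mono)
    fix t
    have "\<bar>h t\<bar> powr q \<le> (c / (1 + \<bar>t\<bar>)) powr q" using h q by (intro powr_mono2) auto
    also have "\<dots> = c powr q * w t" using c by (simp add: w_def powr_divide powr_minus_divide)
    finally have "ennreal (\<bar>h t\<bar> powr q) \<le> ennreal (c powr q) * ennreal (w t)"
      by (simp add: ennreal_mult[symmetric] ennreal_leI w_def)
    also have "\<dots> \<le> ennreal (c powr q) * (ennreal (w t) * indicator {0..} t + ennreal (w t) * indicator {..0} t)"
      by (intro mult_left_mono) (auto simp: indicator_def)
    finally show "ennreal (\<bar>h t\<bar> powr q) \<le> ennreal (c powr q) * (ennreal (w t) * indicator {0..} t + ennreal (w t) * indicator {..0} t)" .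
  qed
  also have "\<dots> = ennreal (c powr q) * ((\<integral>\<^sup>+t. ennreal (w t) * indicator {0..} t \<partial>lborel) + (\<integral>\<^sup>+t. ennreal (w t) * indicator {..0} t \<partial>lborel))"
    by (simp add: nn_integral_cmult nn_integral_add)
  also have "\<dots> < \<infinity>" using half half' by (simp add: ennreal_mult_less_top)
  finally show ?thesis .
qed

lemma dirichlet_kernel1_decay:
  assumes "0 < \<omega>"
  shows "\<bar>dirichlet_kernel1 \<omega> t\<bar> \<le> ((\<omega> + 1) / pi) / (1 + \<bar>t\<bar>)"
proof -
  have "\<bar>dirichlet_kernel1 \<omega> t\<bar> * \<bar>t\<bar> \<le> 1 / pi"
    by (cases "t = 0") (auto simp: dirichlet_kernel1_def abs_mult divide_right_mono)
  then have "\<bar>dirichlet_kernel1 \<omega> t\<bar> * (1 + \<bar>t\<bar>) \<le> \<omega> / pi + 1 / pi"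
    using dirichlet_kernel1_le[OF assms, of t] by (simp add: ring_distribs)
  moreover have pos: "0 < 1 + \<bar>t\<bar>" by simp
  ultimately show ?thesis unfolding pos_le_divide_eq[OF pos] by (simp add: add_divide_distrib)
qed

lemma dirichlet_kernel1_nn_integral_finite:
  assumes "0 < \<omega>" "1 < q"
  shows "(\<integral>\<^sup>+t. ennreal (\<bar>dirichlet_kernel1 \<omega> (x - t)\<bar> powr q) \<partial>lborel) < \<infinity>"
proof -
  have "(\<integral>\<^sup>+t. ennreal (\<bar>dirichlet_kernel1 \<omega> t\<bar> powr q) \<partial>lborel) < \<infinity>"
    by (rule nn_integral_decay_finite[OF assms(2) dirichlet_kernel1_decay[OF assms(1)]])
  then show ?thesis
    by (subst (asm) nn_integral_real_affine[of _ "-1" x]) auto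
qed

text \<open>Bounded functions with bounded support suffice: $f$ is truncated, $S_\omega$ of the truncations
  converges pointwise because $D_\omega$ lies in the dual $L^q$, and Fatou's lemma applies.\<close>

theorem dirichlet_Lp_bound_line:
  fixes p :: real
  assumes p: "1 < p"
  shows "\<exists>C>0. \<forall>f \<omega>. f \<in> borel_measurable borel \<longrightarrow> 0 < \<omega> \<longrightarrow>
     pth_integral p lborel (conv_op (dirichlet_kernel1 \<omega>) f) \<le> ennreal C * pth_integral p lborel f"
proof -
  obtain C where C: "C > 0" and bound: "\<And>f \<omega>. bounded_compact_support f \<Longrightarrow> 0 < \<omega> \<Longrightarrow>
     pth_integral p lborel (conv_op (dirichlet_kernel1 \<omega>) f) \<le> ennreal C * pth_integral p lborel f"
    using dirichlet_bound_bounded_support_small_p[OF p] dirichlet_bound_bounded_support_large_p by (cases "p \<le> 2") (metis, metis not_le)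
  define q where "q = p / (p - 1)"
  have pq: "1 < p" "1 < q" "1 / p + 1 / q = 1" using p by (auto simp: q_def field_simps)
  have "pth_integral p lborel (conv_op (dirichlet_kernel1 \<omega>) f) \<le> ennreal C * pth_integral p lborel f"
    if fm[measurable]: "f \<in> borel_measurable borel" and om: "0 < \<omega>" for f \<omega>
  proof (cases "pth_integral p lborel f = \<infinity>")
    case True
    then show ?thesis using C by (simp add: ennreal_mult_top)
  next
    case False
    define F where "F = (\<lambda>n t. if cmod (f t) \<le> real n \<and> \<bar>t\<bar> \<le> real n then f t else 0)"
    have Fm[measurable]: "F n \<in> borel_measurable borel" for n unfolding F_def by measurable
    have Fb: "bounded_compact_support (F n)" for n
      unfolding bounded_compact_support_def by (intro conjI exI[of _ "real n"]) (auto simp: F_def)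
    have Fle: "cmod (F n t) \<le> cmod (f t)" for n t by (simp add: F_def)
    have Flim: "(\<lambda>n. F n t) \<longlonglongrightarrow> f t" for t
    proof (rule tendsto_eventually)
      show "\<forall>\<^sub>F n in sequentially. F n t = f t"
        using eventually_ge_at_top[of "nat \<lceil>max (cmod (f t)) \<bar>t\<bar>\<rceil>"]
        by eventually_elim (auto simp: F_def nat_le_iff ceiling_le_iff)
    qed
    show ?thesis
    proof (rule pth_integral_le_of_tendsto[where h = "\<lambda>n. conv_op (dirichlet_kernel1 \<omega>) (F n)"])
      fix n
      have "pth_integral p lborel (conv_op (dirichlet_kernel1 \<omega>) (F n)) \<le> ennreal C * pth_integral p lborel (F n)"
        by (rule bound[OF Fb om])
      also have "\<dots> \<le> ennreal C * pth_integral p lborel f"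
        using p Fle by (intro mult_left_mono pth_integral_mono) auto
      finally show "pth_integral p lborel (conv_op (dirichlet_kernel1 \<omega>) (F n)) \<le> ennreal C * pth_integral p lborel f" .
    next
      fix x
      have int: "integrable lborel (\<lambda>t. of_real (dirichlet_kernel1 \<omega> (x - t)) * f t)"
      proof (rule integrable_mult_of_pth_integrals[OF pq])
        show "pth_integral q lborel (\<lambda>t. complex_of_real (dirichlet_kernel1 \<omega> (x - t))) < \<infinity>"
          using dirichlet_kernel1_nn_integral_finite[OF om pq(2), of x] by (simp add: pth_integral_def)
      qed (use False in \<open>auto simp: less_top\<close>)
      show "(\<lambda>n. conv_op (dirichlet_kernel1 \<omega>) (F n) x) \<longlonglongrightarrow> conv_op (dirichlet_kernel1 \<omega>) f x"
        unfolding conv_op_def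
      proof (rule integral_dominated_convergence[where w = "\<lambda>t. cmod (of_real (dirichlet_kernel1 \<omega> (x - t)) * f t)"])
        show "AE t in lborel. (\<lambda>n. of_real (dirichlet_kernel1 \<omega> (x - t)) * F n t) \<longlonglongrightarrow> of_real (dirichlet_kernel1 \<omega> (x - t)) * f t"
          by (intro AE_I2 tendsto_intros Flim)
        show "AE t in lborel. cmod (of_real (dirichlet_kernel1 \<omega> (x - t)) * F n t) \<le> cmod (of_real (dirichlet_kernel1 \<omega> (x - t)) * f t)" for n
          using Fle by (intro AE_I2) (simp add: norm_mult mult_left_mono)
      qed (use int in auto)
    qed (use p in auto)
  qed
  then show ?thesis using C by blast
qed

section \<open>From the line to several variables\<close>

lemma (in product_sigma_finite) product_integral_insert_rev:
  fixes f :: "_ \<Rightarrow> _::{banach, second_countable_topology}"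
  assumes I: "finite I" "i \<notin> I" and f: "integrable (Pi\<^sub>M (insert i I) M) f"
  shows "integral\<^sup>L (Pi\<^sub>M (insert i I) M) f = (\<integral>t. (\<integral>y. f (y(i := t)) \<partial>Pi\<^sub>M I M) \<partial>M i)"
proof -
  interpret I: finite_product_sigma_finite M I by standard fact
  have fm[measurable]: "f \<in> borel_measurable (Pi\<^sub>M (insert i I) M)" using f by auto
  have "integral\<^sup>L (Pi\<^sub>M (insert i I) M) f = integral\<^sup>L (Pi\<^sub>M ({i} \<union> I) M) f" by simp
  also have "\<dots> = (\<integral>x. (\<integral>y. f (merge {i} I (x, y)) \<partial>Pi\<^sub>M I M) \<partial>Pi\<^sub>M {i} M)"
    using I f by (intro product_integral_fold) auto
  also have "\<dots> = (\<integral>x. (\<integral>y. f (y(i := x i)) \<partial>Pi\<^sub>M I M) \<partial>Pi\<^sub>M {i} M)"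
  proof (intro Bochner_Integration.integral_cong refl arg_cong[where f = f])
    fix x y assume "x \<in> space (Pi\<^sub>M {i} M)" "y \<in> space (Pi\<^sub>M I M)"
    then show "merge {i} I (x, y) = y(i := x i)"
      using I by (auto simp: merge_def fun_eq_iff space_PiM PiE_def extensional_def)
  qed
  also have "\<dots> = (\<integral>t. (\<integral>y. f (y(i := t)) \<partial>Pi\<^sub>M I M) \<partial>M i)"
    by (rule product_integral_singleton) measurable
  finally show ?thesis .
qed

text \<open>Convolution with a product kernel, for functions of finitely many real coordinates with an arbitrary
  index set; keeping the index set a variable is what makes induction on the dimension possible.\<close>

definition tensor_op :: "(real \<Rightarrow> real) \<Rightarrow> 'i set \<Rightarrow> (('i \<Rightarrow> real) \<Rightarrow> complex) \<Rightarrow> ('i \<Rightarrow> real) \<Rightarrow> complex" where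
  "tensor_op k I f x = (LINT y|Pi\<^sub>M I (\<lambda>_. lborel). of_real (\<Prod>i\<in>I. k (x i - y i)) * f y)"

lemma sigma_finite_PiM_lborel:
  fixes I :: "'i set"
  shows "finite I \<Longrightarrow> sigma_finite_measure (Pi\<^sub>M I (\<lambda>_. lborel :: real measure))"
proof -
  interpret product_sigma_finite "\<lambda>_::'i. lborel :: real measure" ..
  show "finite I \<Longrightarrow> sigma_finite_measure (Pi\<^sub>M I (\<lambda>_. lborel :: real measure))" by (rule sigma_finite)
qed

text \<open>The parameter \<open>z\<close> occurs in the function and in the point, because the induction on the set of
  coordinates applies the operator to the slices \<open>\<lambda>y. f (y(i := t))\<close> and needs measurability jointly
  in the point and in \<open>t\<close>.\<close>

lemma tensor_op_measurable_family:
  fixes I :: "'i set"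
  assumes I: "finite I" and k[measurable]: "k \<in> borel_measurable borel"
    and X[measurable]: "X \<in> measurable N (Pi\<^sub>M I (\<lambda>_. lborel))"
    and g[measurable]: "case_prod g \<in> borel_measurable (N \<Otimes>\<^sub>M Pi\<^sub>M I (\<lambda>_. lborel))"
  shows "(\<lambda>z. tensor_op k I (g z) (X z)) \<in> borel_measurable N"
proof -
  interpret sigma_finite_measure "Pi\<^sub>M I (\<lambda>_. lborel :: real measure)" by (rule sigma_finite_PiM_lborel[OF I])
  have "(\<lambda>(z, y). \<Prod>i\<in>I. k (X z i - y i)) \<in> borel_measurable (N \<Otimes>\<^sub>M Pi\<^sub>M I (\<lambda>_. lborel))"
    unfolding split_beta
  proof (rule borel_measurable_prod)
    fix i assume i[measurable]: "i \<in> I"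
    have [measurable]: "(\<lambda>w. w i) \<in> borel_measurable (Pi\<^sub>M I (\<lambda>_. lborel :: real measure))"
      using measurable_component_singleton[OF i, of "\<lambda>_. lborel :: real measure"] by simp
    show "(\<lambda>w. k (X (fst w) i - snd w i)) \<in> borel_measurable (N \<Otimes>\<^sub>M Pi\<^sub>M I (\<lambda>_. lborel))" by measurable
  qed
  then have [measurable]: "(\<lambda>w. \<Prod>i\<in>I. k (X (fst w) i - snd w i)) \<in> borel_measurable (N \<Otimes>\<^sub>M Pi\<^sub>M I (\<lambda>_. lborel))"
    by (simp add: split_beta)
  show ?thesis unfolding tensor_op_def
    by (rule borel_measurable_lebesgue_integral) (unfold split_beta, measurable)
qed

lemma tensor_kernel_finite:
  fixes I :: "'i set" and k :: "real \<Rightarrow> real"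
  assumes I: "finite I" and k[measurable]: "k \<in> borel_measurable borel"
    and fin: "\<And>x. (\<integral>\<^sup>+t. ennreal (\<bar>k (x - t)\<bar> powr q) \<partial>lborel) < \<infinity>"
  shows "pth_integral q (Pi\<^sub>M I (\<lambda>_. lborel)) (\<lambda>y. complex_of_real (\<Prod>i\<in>I. k (x i - y i))) < \<infinity>"
proof -
  interpret product_sigma_finite "\<lambda>_::'i. lborel :: real measure" ..
  have "pth_integral q (Pi\<^sub>M I (\<lambda>_. lborel)) (\<lambda>y. complex_of_real (\<Prod>i\<in>I. k (x i - y i)))
     = (\<integral>\<^sup>+y. (\<Prod>i\<in>I. ennreal (\<bar>k (x i - y i)\<bar> powr q)) \<partial>Pi\<^sub>M I (\<lambda>_. lborel))"
    unfolding pth_integral_def norm_of_real by (simp add: abs_prod prod_powr_distrib prod_ennreal)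
  also have "\<dots> = (\<Prod>i\<in>I. \<integral>\<^sup>+t. ennreal (\<bar>k (x i - t)\<bar> powr q) \<partial>lborel)"
    using product_nn_integral_prod[OF I, of "\<lambda>i t. ennreal (\<bar>k (x i - t)\<bar> powr q)"] by simp
  also have "\<dots> < \<infinity>" using I fin by (induction I rule: finite_induct) (auto simp: ennreal_mult_less_top)
  finally show ?thesis .
qed

text \<open>Induction on the set of coordinates. By Fubini's theorem the operator for \<open>insert i J\<close> first applies
  the operator for \<open>J\<close> with the coordinate \<open>i\<close> held fixed, and then the one-dimensional operator in
  the coordinate \<open>i\<close>. The finiteness assumption on the kernel guarantees the absolute convergence
  that Fubini's theorem needs.\<close>

theorem tensor_op_bound:
  fixes k :: "real \<Rightarrow> real" and I :: "'i set"
  assumes pq: "1 < p" "1 < q" "1 / p + 1 / q = 1"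
    and k[measurable]: "k \<in> borel_measurable borel"
    and fin: "\<And>x. (\<integral>\<^sup>+t. ennreal (\<bar>k (x - t)\<bar> powr q) \<partial>lborel) < \<infinity>"
    and C: "0 < C"
    and bound: "\<And>f. f \<in> borel_measurable borel \<Longrightarrow> pth_integral p lborel (conv_op k f) \<le> ennreal C * pth_integral p lborel f"
    and I: "finite I" and f: "f \<in> borel_measurable (Pi\<^sub>M I (\<lambda>_. lborel))"
  shows "pth_integral p (Pi\<^sub>M I (\<lambda>_. lborel)) (tensor_op k I f) \<le> ennreal (C ^ card I) * pth_integral p (Pi\<^sub>M I (\<lambda>_. lborel)) f"
  using I f
proof (induction I arbitrary: f rule: finite_induct)
  case empty
  interpret product_sigma_finite "\<lambda>_::'i. lborel :: real measure" ..
  have "tensor_op k {} f x = f (\<lambda>_. undefined)" for x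
    by (simp add: tensor_op_def PiM_empty lebesgue_integral_count_space_finite)
  then show ?case
    by (simp add: pth_integral_def PiM_empty nn_integral_count_space_finite)
next
  case (insert i J)
  interpret product_sigma_finite "\<lambda>_::'i. lborel :: real measure" ..
  interpret J: sigma_finite_measure "Pi\<^sub>M J (\<lambda>_. lborel :: real measure)" by (rule sigma_finite_PiM_lborel[OF insert.hyps(1)])
  interpret PJ: pair_sigma_finite "Pi\<^sub>M J (\<lambda>_. lborel :: real measure)" "lborel :: real measure" ..
  define P where "P = Pi\<^sub>M J (\<lambda>_. lborel :: real measure)"
  define PI where "PI = Pi\<^sub>M (insert i J) (\<lambda>_. lborel :: real measure)"
  have fm[measurable]: "f \<in> borel_measurable PI" using insert.prems by (simp add: PI_def)
  have finI: "finite (insert i J)" using insert.hyps by simp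
  have upd[measurable]: "(\<lambda>(y, t). y(i := t)) \<in> measurable (P \<Otimes>\<^sub>M lborel) PI"
    unfolding P_def PI_def by (rule measurable_add_dim)
  show ?case
  proof (cases "pth_integral p PI f = \<infinity>")
    case True
    then show ?thesis using C by (simp add: PI_def[symmetric] ennreal_mult_top)
  next
    case False
    define T where "T = tensor_op k (insert i J) f"
    define g where "g = (\<lambda>x t. tensor_op k J (\<lambda>y. f (y(i := t))) x)"
    have Tm[measurable]: "T \<in> borel_measurable PI"
      unfolding T_def PI_def
      by (rule tensor_op_measurable_family[OF finI k, where g = "\<lambda>_. f"])
         (use insert.prems in \<open>auto intro!: measurable_compose[OF measurable_snd]\<close>)
    have gm: "case_prod g \<in> borel_measurable (P \<Otimes>\<^sub>M lborel)"
      unfolding g_def split_beta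
    proof (rule tensor_op_measurable_family[OF insert.hyps(1) k])
      show "fst \<in> measurable (P \<Otimes>\<^sub>M lborel) (Pi\<^sub>M J (\<lambda>_. lborel))" unfolding P_def by (rule measurable_fst)
      have "(\<lambda>w. (snd w, snd (fst w))) \<in> measurable ((P \<Otimes>\<^sub>M lborel) \<Otimes>\<^sub>M P) (P \<Otimes>\<^sub>M (lborel :: real measure))" by measurable
      from measurable_compose[OF measurable_compose[OF this upd] fm]
      show "(\<lambda>(z, y). f (y(i := snd z))) \<in> borel_measurable ((P \<Otimes>\<^sub>M lborel) \<Otimes>\<^sub>M Pi\<^sub>M J (\<lambda>_. lborel))"
        by (simp add: split_beta P_def)
    qed
    note gm[measurable]
    have T_eq: "T (x(i := s)) = conv_op k (g x) s" for x s
    proof -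
      have int: "integrable PI (\<lambda>y. of_real (\<Prod>j\<in>insert i J. k ((x(i := s)) j - y j)) * f y)"
        unfolding PI_def
      proof (rule integrable_mult_of_pth_integrals[OF pq])
        show "pth_integral q (Pi\<^sub>M (insert i J) (\<lambda>_. lborel)) (\<lambda>y. complex_of_real (\<Prod>j\<in>insert i J. k ((x(i := s)) j - y j))) < \<infinity>"
          by (rule tensor_kernel_finite[OF finI k fin])
        have [measurable]: "(\<lambda>y. \<Prod>j\<in>insert i J. k ((x(i := s)) j - y j)) \<in> borel_measurable (Pi\<^sub>M (insert i J) (\<lambda>_. lborel))"
        proof (rule borel_measurable_prod)
          fix j assume j: "j \<in> insert i J"
          have [measurable]: "(\<lambda>w. w j) \<in> borel_measurable (Pi\<^sub>M (insert i J) (\<lambda>_. lborel :: real measure))"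
            using measurable_component_singleton[OF j, of "\<lambda>_. lborel :: real measure"] by simp
          show "(\<lambda>y. k ((x(i := s)) j - y j)) \<in> borel_measurable (Pi\<^sub>M (insert i J) (\<lambda>_. lborel))" by measurable
        qed
        show "(\<lambda>y. complex_of_real (\<Prod>j\<in>insert i J. k ((x(i := s)) j - y j))) \<in> borel_measurable (Pi\<^sub>M (insert i J) (\<lambda>_. lborel))"
          by measurable
      qed (use False insert.prems in \<open>auto simp: PI_def less_top\<close>)
      have "T (x(i := s)) = (LINT t|lborel. LINT y|P. of_real (\<Prod>j\<in>insert i J. k ((x(i := s)) j - (y(i := t)) j)) * f (y(i := t)))"
        unfolding T_def tensor_op_def P_def
        by (rule product_integral_insert_rev[OF insert.hyps int[unfolded PI_def]])
      also have "\<dots> = (LINT t|lborel. LINT y|P. of_real (k (s - t)) * (of_real (\<Prod>j\<in>J. k (x j - y j)) * f (y(i := t))))"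
      proof (intro Bochner_Integration.integral_cong refl)
        fix t y
        have "(\<Prod>j\<in>J. k ((x(i := s)) j - (y(i := t)) j)) = (\<Prod>j\<in>J. k (x j - y j))"
          using insert.hyps by (intro prod.cong) auto
        then show "of_real (\<Prod>j\<in>insert i J. k ((x(i := s)) j - (y(i := t)) j)) * f (y(i := t))
          = of_real (k (s - t)) * (of_real (\<Prod>j\<in>J. k (x j - y j)) * f (y(i := t)))"
          using insert.hyps by (simp add: mult.assoc)
      qed
      also have "\<dots> = conv_op k (g x) s"
        by (simp add: conv_op_def g_def tensor_op_def P_def)
      finally show ?thesis .
    qed
    have "pth_integral p PI T = (\<integral>\<^sup>+x. \<integral>\<^sup>+s. ennreal (cmod (T (x(i := s))) powr p) \<partial>lborel \<partial>P)"
      unfolding pth_integral_def P_def PI_def using Tm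
      by (intro product_nn_integral_insert insert.hyps) (simp add: PI_def)
    also have "\<dots> = (\<integral>\<^sup>+x. pth_integral p lborel (conv_op k (g x)) \<partial>P)"
      unfolding T_eq pth_integral_def ..
    also have "\<dots> \<le> (\<integral>\<^sup>+x. ennreal C * pth_integral p lborel (g x) \<partial>P)"
    proof (rule nn_integral_mono)
      fix x assume x: "x \<in> space P"
      have "g x \<in> borel_measurable lborel"
        using measurable_compose[OF measurable_Pair1'[OF x] gm] by simp
      then show "pth_integral p lborel (conv_op k (g x)) \<le> ennreal C * pth_integral p lborel (g x)"
        by (intro bound) simp
    qed
    also have "\<dots> = ennreal C * (\<integral>\<^sup>+x. \<integral>\<^sup>+t. ennreal (cmod (g x t) powr p) \<partial>lborel \<partial>P)"
      unfolding pth_integral_def by (intro nn_integral_cmult) measurable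
    also have "(\<integral>\<^sup>+x. \<integral>\<^sup>+t. ennreal (cmod (g x t) powr p) \<partial>lborel \<partial>P) = (\<integral>\<^sup>+t. \<integral>\<^sup>+x. ennreal (cmod (g x t) powr p) \<partial>P \<partial>lborel)"
      unfolding P_def by (rule PJ.Fubini'[symmetric]) (use gm in \<open>simp add: split_beta P_def[symmetric]\<close>)
    also have "\<dots> \<le> (\<integral>\<^sup>+t. ennreal (C ^ card J) * (\<integral>\<^sup>+y. ennreal (cmod (f (y(i := t))) powr p) \<partial>P) \<partial>lborel)"
    proof (rule nn_integral_mono)
      fix t :: real
      have "(\<lambda>y. (y, t)) \<in> measurable P (P \<Otimes>\<^sub>M lborel)" by measurable
      from measurable_compose[OF measurable_compose[OF this upd] fm]
      have ft: "(\<lambda>y. f (y(i := t))) \<in> borel_measurable P" by simp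
      show "(\<integral>\<^sup>+x. ennreal (cmod (g x t) powr p) \<partial>P) \<le> ennreal (C ^ card J) * (\<integral>\<^sup>+y. ennreal (cmod (f (y(i := t))) powr p) \<partial>P)"
        using insert.IH[OF ft[unfolded P_def]] unfolding pth_integral_def g_def P_def .
    qed
    also have "\<dots> = ennreal (C ^ card J) * (\<integral>\<^sup>+t. \<integral>\<^sup>+y. ennreal (cmod (f (y(i := t))) powr p) \<partial>P \<partial>lborel)"
    proof (rule nn_integral_cmult)
      have "(\<lambda>(y, t). ennreal (cmod (f (y(i := t))) powr p)) \<in> borel_measurable (P \<Otimes>\<^sub>M lborel)"
        using measurable_compose[OF upd fm] by (simp add: split_beta)
      then show "(\<lambda>t. \<integral>\<^sup>+y. ennreal (cmod (f (y(i := t))) powr p) \<partial>P) \<in> borel_measurable lborel"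
        unfolding P_def by (intro J.borel_measurable_nn_integral measurable_pair_swap) (simp add: split_beta)
    qed
    also have "(\<integral>\<^sup>+t. \<integral>\<^sup>+y. ennreal (cmod (f (y(i := t))) powr p) \<partial>P \<partial>lborel) = pth_integral p PI f"
      unfolding pth_integral_def P_def PI_def using insert.prems
      by (intro product_nn_integral_insert_rev[symmetric] insert.hyps) simp
    also have "ennreal C * (ennreal (C ^ card J) * pth_integral p PI f) = ennreal (C ^ card (insert i J)) * pth_integral p PI f"
      using C insert.hyps by (simp add: ennreal_mult mult.assoc)
    finally show ?thesis unfolding T_def PI_def by (simp add: mult_left_mono)
  qed
qed

definition product_conv_op :: "(real \<Rightarrow> real) \<Rightarrow> ('a::euclidean_space \<Rightarrow> complex) \<Rightarrow> 'a \<Rightarrow> complex" where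
  "product_conv_op k f x = (LINT y|lborel. of_real (\<Prod>b\<in>Basis. k ((x - y) \<bullet> b)) * f y)"

text \<open>The parametrisation of a Euclidean space by its coordinates; it carries the product measure to
  Lebesgue measure.\<close>

definition of_coords :: "('a::euclidean_space \<Rightarrow> real) \<Rightarrow> 'a" where
  "of_coords x = (\<Sum>b\<in>Basis. x b *\<^sub>R b)"

lemma of_coords_inner[simp]: "b \<in> Basis \<Longrightarrow> of_coords x \<bullet> b = x b"
  by (simp add: of_coords_def)

lemma of_coords_measurable[measurable]: "of_coords \<in> measurable (Pi\<^sub>M Basis (\<lambda>_. lborel)) borel"
  unfolding of_coords_def by measurable

lemma lborel_eq_distr_of_coords: "lborel = distr (Pi\<^sub>M Basis (\<lambda>_. lborel)) borel of_coords"
  by (subst lborel_eq) (simp add: of_coords_def[abs_def])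

lemma product_conv_op_measurable[measurable]:
  assumes [measurable]: "k \<in> borel_measurable borel" "f \<in> borel_measurable borel"
  shows "product_conv_op k f \<in> borel_measurable borel"
  unfolding product_conv_op_def by measurable

lemma pth_integral_of_coords:
  assumes [measurable]: "f \<in> borel_measurable borel"
  shows "pth_integral p lborel f = pth_integral p (Pi\<^sub>M Basis (\<lambda>_. lborel)) (\<lambda>x. f (of_coords x))"
  unfolding pth_integral_def
  by (subst lborel_eq_distr_of_coords, subst nn_integral_distr) auto

lemma product_conv_op_of_coords:
  assumes [measurable]: "k \<in> borel_measurable borel" "f \<in> borel_measurable borel"
  shows "product_conv_op k f (of_coords x) = tensor_op k Basis (\<lambda>y. f (of_coords y)) x"
proof -
  have "product_conv_op k f (of_coords x)
    = (LINT y|distr (Pi\<^sub>M Basis (\<lambda>_. lborel)) borel of_coords. of_real (\<Prod>b\<in>Basis. k ((of_coords x - y) \<bullet> b)) * f y)"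
    unfolding product_conv_op_def by (subst lborel_eq_distr_of_coords) (rule refl)
  also have "\<dots> = (LINT y|Pi\<^sub>M Basis (\<lambda>_. lborel). of_real (\<Prod>b\<in>Basis. k ((of_coords x - of_coords y) \<bullet> b)) * f (of_coords y))"
    by (rule integral_distr) measurable
  also have "\<dots> = tensor_op k Basis (\<lambda>y. f (of_coords y)) x"
    unfolding tensor_op_def by (simp add: inner_diff_left)
  finally show ?thesis .
qed

theorem dirichlet_Lp_bound:
  fixes p :: real
  assumes p: "1 < p"
  shows "\<exists>C>0. \<forall>(f :: 'a::euclidean_space \<Rightarrow> complex) \<omega>. f \<in> borel_measurable borel \<longrightarrow> 0 < \<omega> \<longrightarrow>
     pth_integral p lborel (product_conv_op (dirichlet_kernel1 \<omega>) f) \<le> ennreal C * pth_integral p lborel f"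
proof -
  obtain C where C: "C > 0" and bound: "\<And>f \<omega>. f \<in> borel_measurable borel \<Longrightarrow> 0 < \<omega> \<Longrightarrow>
     pth_integral p lborel (conv_op (dirichlet_kernel1 \<omega>) f) \<le> ennreal C * pth_integral p lborel f"
    using dirichlet_Lp_bound_line[OF p] by blast
  define q where "q = p / (p - 1)"
  have pq: "1 < p" "1 < q" "1 / p + 1 / q = 1" using p by (auto simp: q_def field_simps)
  have "pth_integral p lborel (product_conv_op (dirichlet_kernel1 \<omega>) f) \<le> ennreal (C ^ DIM('a)) * pth_integral p lborel f"
    if [measurable]: "f \<in> borel_measurable borel" and om: "0 < \<omega>" for f :: "'a \<Rightarrow> complex" and \<omega>
  proof -
    have "pth_integral p lborel (product_conv_op (dirichlet_kernel1 \<omega>) f)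
      = pth_integral p (Pi\<^sub>M Basis (\<lambda>_. lborel)) (tensor_op (dirichlet_kernel1 \<omega>) Basis (\<lambda>y. f (of_coords y)))"
      by (simp add: pth_integral_of_coords product_conv_op_of_coords)
    also have "\<dots> \<le> ennreal (C ^ DIM('a)) * pth_integral p (Pi\<^sub>M Basis (\<lambda>_. lborel)) (\<lambda>y. f (of_coords y))"
      by (rule tensor_op_bound[OF pq _ dirichlet_kernel1_nn_integral_finite[OF om pq(2)] C])
         (auto intro: bound om)
    finally show ?thesis by (simp add: pth_integral_of_coords)
  qed
  then show ?thesis using C by (intro exI[of _ "C ^ DIM('a)"]) auto
qed

section \<open>Convergence for boxes\<close>

lemma dirichlet_kernel1_sinc: "dirichlet_kernel1 \<omega> t = \<omega> / pi * sinc (\<omega> * t)"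
  by (auto simp: dirichlet_kernel1_def)

text \<open>The function $y\mapsto-\mathrm{Si}(\omega(x-y))/\pi$ is an antiderivative of the kernel.\<close>

lemma conv_op_indicator:
  assumes "a \<le> b"
  shows "conv_op (dirichlet_kernel1 \<omega>) (indicator {a..b}) x = of_real ((Si (\<omega> * (x - a)) - Si (\<omega> * (x - b))) / pi)"
proof -
  have "conv_op (dirichlet_kernel1 \<omega>) (indicator {a..b}) x
      = (LINT y|lborel. complex_of_real (dirichlet_kernel1 \<omega> (x - y) * indicator {a..b} y))"
    unfolding conv_op_def by (intro Bochner_Integration.integral_cong) (auto simp: indicator_def)
  also have "\<dots> = of_real (LINT y|lborel. dirichlet_kernel1 \<omega> (x - y) * indicator {a..b} y)"
    by (rule integral_complex_of_real)
  also have "(LINT y|lborel. dirichlet_kernel1 \<omega> (x - y) * indicator {a..b} y)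
      = - Si (\<omega> * (x - b)) / pi - (- Si (\<omega> * (x - a)) / pi)"
  proof (rule integral_FTC_Icc_real[OF assms])
    fix y
    have "((\<lambda>y. - Si (\<omega> * (x - y)) / pi) has_real_derivative - (sinc (\<omega> * (x - y)) * (\<omega> * (0 - 1))) / pi) (at y)"
      by (intro DERIV_cdivide DERIV_minus DERIV_chain2[OF DERIV_Si] DERIV_cmult DERIV_diff DERIV_const DERIV_ident)
    then show "((\<lambda>y. - Si (\<omega> * (x - y)) / pi) has_real_derivative dirichlet_kernel1 \<omega> (x - y)) (at y)"
      by (simp add: dirichlet_kernel1_sinc mult_ac del: mult_eq_0_iff)
    show "isCont (\<lambda>y. dirichlet_kernel1 \<omega> (x - y)) y"
      unfolding dirichlet_kernel1_sinc
      by (intro continuous_intros isCont_o2[of y "\<lambda>y. \<omega> * (x - y)", OF _ isCont_sinc])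
  qed
  finally show ?thesis by (simp add: diff_divide_distrib)
qed

lemma Si_scaled_tendsto:
  assumes "t \<noteq> 0"
  shows "((\<lambda>\<omega>. Si (\<omega> * t)) \<longlongrightarrow> sgn t * (pi / 2)) at_top"
proof (cases "0 < t")
  case True
  have "filterlim (\<lambda>\<omega>. \<omega> * t) at_top at_top"
    using True by (intro filterlim_at_top_mult_tendsto_pos[OF tendsto_const _ filterlim_ident]) auto
  then show ?thesis using filterlim_compose[OF Si_at_top] True by simp
next
  case False
  have "filterlim (\<lambda>\<omega>. \<omega> * (- t)) at_top at_top"
    using False assms by (intro filterlim_at_top_mult_tendsto_pos[OF tendsto_const _ filterlim_ident]) auto
  from filterlim_compose[OF Si_at_top this]
  have "((\<lambda>\<omega>. - Si (\<omega> * (- t))) \<longlongrightarrow> - (pi / 2)) at_top" by (rule tendsto_minus)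
  moreover have "\<forall>\<^sub>F \<omega> in at_top. - Si (\<omega> * (- t)) = Si (\<omega> * t)"
    using eventually_ge_at_top[of 0]
  proof eventually_elim
    case (elim \<omega>)
    then have "0 \<le> \<omega> * (- t)" using False assms by (intro mult_nonneg_nonneg) auto
    from Si_neg[OF this] show ?case by simp
  qed
  ultimately have "((\<lambda>\<omega>. Si (\<omega> * t)) \<longlongrightarrow> - (pi / 2)) at_top" by (rule Lim_transform_eventually)
  then show ?thesis using False assms by simp
qed

lemma conv_op_indicator_tendsto:
  assumes ab: "a \<le> b" and x: "x \<noteq> a" "x \<noteq> b"
  shows "((\<lambda>\<omega>. conv_op (dirichlet_kernel1 \<omega>) (indicator {a..b}) x) \<longlongrightarrow> indicator {a..b} x) at_top"
proof -
  have "((\<lambda>\<omega>. complex_of_real ((Si (\<omega> * (x - a)) - Si (\<omega> * (x - b))) / pi))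
      \<longlongrightarrow> of_real ((sgn (x - a) * (pi / 2) - sgn (x - b) * (pi / 2)) / pi)) at_top"
    using x by (intro tendsto_intros Si_scaled_tendsto) auto
  moreover have "complex_of_real ((sgn (x - a) * (pi / 2) - sgn (x - b) * (pi / 2)) / pi) = indicator {a..b} x"
    using ab x by (auto simp: indicator_def sgn_if)
  ultimately show ?thesis unfolding conv_op_indicator[OF ab] by simp
qed

lemma bounded_compact_support_indicator: "bounded_compact_support (indicator {a..b})"
  unfolding bounded_compact_support_def
  by (intro conjI exI[of _ "\<bar>a\<bar> + \<bar>b\<bar> + 1"]) (auto simp: indicator_def abs_if split: if_splits)

text \<open>Near the interval the boundedness of the sine integral is used; far away the kernel is at most
  $2/(\pi|x|)$ on the interval. Both bounds are uniform in \<open>\<omega>\<close>.\<close>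

lemma conv_op_indicator_decay:
  assumes ab: "a \<le> b"
  obtains c where "\<And>\<omega> x. 0 < \<omega> \<Longrightarrow> cmod (conv_op (dirichlet_kernel1 \<omega>) (indicator {a..b}) x) \<le> c / (1 + \<bar>x\<bar>)"
proof -
  obtain B where B: "\<And>T. \<bar>Si T\<bar> \<le> B" using bounded_Si by blast
  have B0: "0 \<le> B" using order_trans[OF abs_ge_zero B] .
  define M where "M = 2 * B / pi"
  define R where "R = \<bar>a\<bar> + \<bar>b\<bar> + 1"
  define c where "c = M * (1 + 2 * R) + 2 * (b - a) / pi"
  have M0: "0 \<le> M" and R0: "0 < R" using B0 by (simp_all add: M_def R_def)
  have "cmod (conv_op (dirichlet_kernel1 \<omega>) (indicator {a..b}) x) * (1 + \<bar>x\<bar>) \<le> c" if om: "0 < \<omega>" for \<omega> x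
  proof -
    define S where "S = conv_op (dirichlet_kernel1 \<omega>) (indicator {a..b}) x"
    have SM: "cmod S \<le> M"
    proof -
      have "\<bar>Si (\<omega> * (x - a)) - Si (\<omega> * (x - b))\<bar> \<le> 2 * B"
        using B[of "\<omega> * (x - a)"] B[of "\<omega> * (x - b)"] by linarith
      then show ?thesis unfolding S_def conv_op_indicator[OF ab] norm_of_real
        by (simp add: M_def divide_right_mono)
    qed
    show ?thesis
    proof (cases "\<bar>x\<bar> \<le> 2 * R")
      case True
      then have "cmod S * (1 + \<bar>x\<bar>) \<le> M * (1 + 2 * R)" using SM M0 by (intro mult_mono) auto
      then show ?thesis using ab by (simp add: S_def c_def add_increasing2)
    next
      case False
      then have xp: "\<bar>x\<bar> > 0" using R0 by linarith
      have "cmod S \<le> (LINT y|lborel. 2 / (pi * \<bar>x\<bar>) * indicator {a..b} y)"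
        unfolding S_def conv_op_def
      proof (rule Bochner_Integration.integral_norm_bound_integral)
        show "integrable lborel (\<lambda>y. of_real (dirichlet_kernel1 \<omega> (x - y)) * indicator {a..b} y :: complex)"
          by (rule conv_op_integrable[OF bounded_compact_support_integrable[OF bounded_compact_support_indicator] dirichlet_kernel1_measurable
                dirichlet_kernel1_le[OF om]])
        show "integrable lborel (\<lambda>y. 2 / (pi * \<bar>x\<bar>) * indicator {a..b} y)"
          using ab by (intro integrable_mult_right integrable_real_indicator) auto
          fix y
          show "cmod (of_real (dirichlet_kernel1 \<omega> (x - y)) * indicator {a..b} y) \<le> 2 / (pi * \<bar>x\<bar>) * indicator {a..b} y"
          proof (cases "y \<in> {a..b}")
            case True
            then have "\<bar>y\<bar> \<le> R" by (auto simp: R_def abs_if)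
            then have far: "\<bar>x\<bar> / 2 \<le> \<bar>x - y\<bar>" using False by linarith
            then have ne: "x - y \<noteq> 0" using xp by auto
            have "\<bar>dirichlet_kernel1 \<omega> (x - y)\<bar> \<le> 1 / (pi * \<bar>x - y\<bar>)"
              using ne by (simp add: dirichlet_kernel1_def abs_mult divide_right_mono)
            also have "\<dots> \<le> 1 / (pi * (\<bar>x\<bar> / 2))"
              using far xp ne by (intro divide_left_mono mult_left_mono mult_pos_pos) auto
            finally show ?thesis using True by (simp add: norm_mult)
          qed simp
      qed
      also have "\<dots> = 2 / (pi * \<bar>x\<bar>) * (b - a)" using ab by simp
      finally have "cmod S * \<bar>x\<bar> \<le> 2 / (pi * \<bar>x\<bar>) * (b - a) * \<bar>x\<bar>" by (intro mult_right_mono) auto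
      also have "\<dots> = 2 * (b - a) / pi" using xp by simp
      finally have "cmod S * (1 + \<bar>x\<bar>) \<le> M + 2 * (b - a) / pi" using SM by (simp add: algebra_simps)
      also have "M \<le> M * (1 + 2 * R)" using M0 R0 by (simp add: algebra_simps)
      finally show ?thesis by (simp add: S_def c_def)
    qed
  qed
  then show ?thesis by (intro that[of c]) (simp add: pos_le_divide_eq add_pos_nonneg)
qed

lemma indicator_cbox_prod:
  fixes a b :: "'a::euclidean_space"
  shows "indicator (cbox a b) x = (\<Prod>i\<in>Basis. indicator {a \<bullet> i..b \<bullet> i} (x \<bullet> i) :: 'b::comm_semiring_1)"
proof (cases "x \<in> cbox a b")
  case True
  then show ?thesis by (auto simp: mem_box intro!: prod.neutral[symmetric])
next
  case False
  then obtain i where i: "i \<in> Basis" "x \<bullet> i \<notin> {a \<bullet> i..b \<bullet> i}" by (auto simp: mem_box)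
  then have "(\<Prod>i\<in>Basis. indicator {a \<bullet> i..b \<bullet> i} (x \<bullet> i) :: 'b) = 0"
    by (intro prod_zero bexI[of _ i]) auto
  then show ?thesis using False by simp
qed

lemma product_conv_op_indicator_cbox:
  fixes a b :: "'a::euclidean_space"
  assumes om: "0 < \<omega>"
  shows "product_conv_op (dirichlet_kernel1 \<omega>) (indicator (cbox a b)) x
     = (\<Prod>i\<in>Basis. conv_op (dirichlet_kernel1 \<omega>) (indicator {a \<bullet> i..b \<bullet> i}) (x \<bullet> i))"
proof -
  interpret product_sigma_finite "\<lambda>_::'a. lborel :: real measure" ..
  let ?k = "dirichlet_kernel1 \<omega>"
  have x: "x = of_coords (\<lambda>i. x \<bullet> i)" by (simp add: of_coords_def euclidean_representation)
  have "product_conv_op ?k (indicator (cbox a b)) x = tensor_op ?k Basis (\<lambda>y. indicator (cbox a b) (of_coords y)) (\<lambda>i. x \<bullet> i)"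
    by (subst x, rule product_conv_op_of_coords) auto
  also have "\<dots> = (LINT y|Pi\<^sub>M Basis (\<lambda>_. lborel). (\<Prod>i\<in>Basis. of_real (?k (x \<bullet> i - y i)) * indicator {a \<bullet> i..b \<bullet> i} (y i)))"
    unfolding tensor_op_def indicator_cbox_prod by (simp add: prod.distrib)
  also have "\<dots> = (\<Prod>i\<in>Basis. conv_op ?k (indicator {a \<bullet> i..b \<bullet> i}) (x \<bullet> i))"
    unfolding conv_op_def
    using product_integral_prod[of Basis "\<lambda>i t. of_real (?k (x \<bullet> i - t)) * indicator {a \<bullet> i..b \<bullet> i} t :: complex"]
      conv_op_integrable[OF bounded_compact_support_integrable[OF bounded_compact_support_indicator]
        dirichlet_kernel1_measurable dirichlet_kernel1_le[OF om]]
    by simp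
  finally show ?thesis .
qed

lemma AE_lborel_inner_neq:
  fixes i :: "'a::euclidean_space"
  assumes "i \<in> Basis"
  shows "AE x in lborel. x \<bullet> i \<noteq> c"
proof -
  have "negligible {x. x \<bullet> i = c}" by (rule negligible_standard_hyperplane[OF assms])
  moreover have "{x. x \<bullet> i = c} \<in> sets (lborel :: 'a measure)" by measurable
  ultimately have "{x. x \<bullet> i = c} \<in> null_sets lborel"
    by (simp add: negligible_iff_null_sets null_sets_completion_iff)
  then show ?thesis by (auto dest: AE_not_in)
qed

text \<open>Dominated convergence. The majorant is a product of functions $d_i/(1+|x_i|)$ which bound both the
  convolutions and the indicator of the box.\<close>

lemma cbox_convergence:
  fixes a b :: "'a::euclidean_space" and p :: real
  assumes p: "1 < p"
  shows "((\<lambda>\<omega>. pth_integral p lborel (\<lambda>x. product_conv_op (dirichlet_kernel1 \<omega>) (indicator (cbox a b)) x - indicator (cbox a b) x)) \<longlongrightarrow> 0) at_top"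
proof (cases "\<forall>i\<in>Basis. a \<bullet> i \<le> b \<bullet> i")
  case False
  then have "cbox a b = {}" by (auto simp: box_eq_empty not_le)
  then show ?thesis using p by (simp add: pth_integral_def product_conv_op_def)
next
  case True
  define u where "u = (\<lambda>\<omega> x. product_conv_op (dirichlet_kernel1 \<omega>) (indicator (cbox a b)) x - indicator (cbox a b) x)"
  have [measurable]: "u \<omega> \<in> borel_measurable borel" for \<omega> unfolding u_def by measurable
  have "\<forall>i\<in>Basis. \<exists>c. \<forall>\<omega> t. 0 < \<omega> \<longrightarrow> cmod (conv_op (dirichlet_kernel1 \<omega>) (indicator {a \<bullet> i..b \<bullet> i}) t) \<le> c / (1 + \<bar>t\<bar>)"
  proof
    fix i :: 'a assume "i \<in> Basis"
    then show "\<exists>c. \<forall>\<omega> t. 0 < \<omega> \<longrightarrow> cmod (conv_op (dirichlet_kernel1 \<omega>) (indicator {a \<bullet> i..b \<bullet> i}) t) \<le> c / (1 + \<bar>t\<bar>)"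
      using conv_op_indicator_decay[of "a \<bullet> i" "b \<bullet> i"] True by metis
  qed
  then obtain c where c: "\<And>i \<omega> t. i \<in> Basis \<Longrightarrow> 0 < \<omega> \<Longrightarrow>
      cmod (conv_op (dirichlet_kernel1 \<omega>) (indicator {a \<bullet> i..b \<bullet> i}) t) \<le> c i / (1 + \<bar>t\<bar>)"
    by metis
  define d where "d = (\<lambda>i. \<bar>c i\<bar> + (1 + \<bar>a \<bullet> i\<bar> + \<bar>b \<bullet> i\<bar>))"
  define w where "w = (\<lambda>i t. d i / (1 + \<bar>t\<bar>))"
  have w0: "0 \<le> w i t" for i t by (simp add: w_def d_def)
  have wm[measurable]: "w i \<in> borel_measurable borel" for i unfolding w_def by measurable
  define W where "W = (\<lambda>x. \<Prod>i\<in>Basis. w i (x \<bullet> i))"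
  have Wm[measurable]: "W \<in> borel_measurable borel" unfolding W_def by measurable
  have W0: "0 \<le> W x" for x unfolding W_def by (intro prod_nonneg) (simp add: w0)
  have convw: "cmod (conv_op (dirichlet_kernel1 \<omega>) (indicator {a \<bullet> i..b \<bullet> i}) t) \<le> w i t" if "i \<in> Basis" "0 < \<omega>" for i \<omega> t
    using c[OF that, of t] unfolding w_def
    by (rule order_trans) (auto simp: d_def intro!: divide_right_mono)
  have indw: "cmod (indicator {a \<bullet> i..b \<bullet> i} t) \<le> w i t" for i t
  proof (cases "t \<in> {a \<bullet> i..b \<bullet> i}")
    case True
    then have "1 + \<bar>t\<bar> \<le> d i" unfolding d_def by (auto simp: abs_if)
    then show ?thesis using True by (simp add: w_def pos_le_divide_eq add_pos_nonneg)
  qed (use w0 in simp)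
  have uW: "cmod (u \<omega> x) \<le> 2 * W x" if "0 < \<omega>" for \<omega> x
  proof -
    have "cmod (product_conv_op (dirichlet_kernel1 \<omega>) (indicator (cbox a b)) x) \<le> W x"
      unfolding product_conv_op_indicator_cbox[OF that] W_def prod_norm[symmetric]
      by (intro prod_mono) (auto intro: convw that)
    moreover have "cmod (indicator (cbox a b) x) \<le> W x"
      unfolding indicator_cbox_prod W_def prod_norm[symmetric] by (intro prod_mono) (auto intro: indw)
    ultimately show ?thesis unfolding u_def using norm_triangle_ineq4 by (smt (verit))
  qed
  have Wfin: "(\<integral>\<^sup>+x. ennreal ((2 * W x) powr p) \<partial>lborel) < \<infinity>"
  proof -
    have "(\<integral>\<^sup>+x. ennreal ((2 * W x) powr p) \<partial>lborel) = (\<integral>\<^sup>+x. ennreal (2 powr p) * (\<Prod>i\<in>Basis. ennreal (w i (x \<bullet> i) powr p)) \<partial>lborel)"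
      using W0 by (intro nn_integral_cong) (simp add: powr_mult ennreal_mult W_def prod_powr_distrib prod_ennreal prod_nonneg)
    also have "\<dots> = ennreal (2 powr p) * (\<Prod>i\<in>Basis. \<integral>\<^sup>+t. ennreal (w i t powr p) \<partial>lborel)"
      by (subst nn_integral_cmult) (simp_all add: nn_integral_lborel_prod[of "\<lambda>i t. ennreal (w i t powr p)"])
    also have "\<dots> < \<infinity>"
    proof -
      have "(\<integral>\<^sup>+t. ennreal (w i t powr p) \<partial>lborel) < \<infinity>" for i
      proof -
        have "\<bar>w i t\<bar> \<le> d i / (1 + \<bar>t\<bar>)" for t
          unfolding abs_of_nonneg[OF w0] by (simp add: w_def)
        from nn_integral_decay_finite[OF p this] show ?thesis by (simp only: abs_of_nonneg[OF w0])
      qed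
      then have "(\<Prod>i\<in>(Basis :: 'a set). \<integral>\<^sup>+t. ennreal (w i t powr p) \<partial>lborel) < \<infinity>"
        by (intro finite_induct[OF finite_Basis, where P = "\<lambda>I. (\<Prod>i\<in>I. \<integral>\<^sup>+t. ennreal (w i t powr p) \<partial>lborel) < \<infinity>"])
           (auto simp: ennreal_mult_less_top)
      then show ?thesis by (simp add: ennreal_mult_less_top)
    qed
    finally show ?thesis .
  qed
  have lim: "AE x in lborel. ((\<lambda>\<omega>. u \<omega> x) \<longlongrightarrow> 0) at_top"
  proof -
    have "AE x in lborel. \<forall>i\<in>(Basis :: 'a set). x \<bullet> i \<noteq> a \<bullet> i \<and> x \<bullet> i \<noteq> b \<bullet> i"
      by (intro AE_finite_allI AE_conjI AE_lborel_inner_neq) auto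
    then show ?thesis
    proof eventually_elim
      case (elim x)
      have "((\<lambda>\<omega>. \<Prod>i\<in>Basis. conv_op (dirichlet_kernel1 \<omega>) (indicator {a \<bullet> i..b \<bullet> i}) (x \<bullet> i))
         \<longlongrightarrow> (\<Prod>i\<in>Basis. indicator {a \<bullet> i..b \<bullet> i} (x \<bullet> i))) at_top"
        using True elim by (intro tendsto_prod conv_op_indicator_tendsto) auto
      then have "((\<lambda>\<omega>. (\<Prod>i\<in>Basis. conv_op (dirichlet_kernel1 \<omega>) (indicator {a \<bullet> i..b \<bullet> i}) (x \<bullet> i)) - indicator (cbox a b) x) \<longlongrightarrow> 0) at_top"
        unfolding indicator_cbox_prod by (rule LIM_zero)
      moreover have "\<forall>\<^sub>F \<omega> in at_top. (\<Prod>i\<in>Basis. conv_op (dirichlet_kernel1 \<omega>) (indicator {a \<bullet> i..b \<bullet> i}) (x \<bullet> i)) - indicator (cbox a b) x = u \<omega> x"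
        using eventually_gt_at_top[of 0] by eventually_elim (simp add: u_def product_conv_op_indicator_cbox)
      ultimately show ?case by (rule Lim_transform_eventually)
    qed
  qed
  have "((\<lambda>\<omega>. pth_integral p lborel (u \<omega>)) \<longlongrightarrow> 0) at_top"
  proof (rule tendsto_at_topI_sequentially)
    fix X :: "nat \<Rightarrow> real" assume X: "filterlim X at_top sequentially"
    \<comment> \<open>The domination needs positive frequencies for all indices and not only for almost all.\<close>
    define Y where "Y = (\<lambda>n. max 1 (X n))"
    have Y0: "0 < Y n" for n by (simp add: Y_def)
    have YX: "\<forall>\<^sub>F n in sequentially. Y n = X n"
      using filterlim_at_top[THEN iffD1, OF X, rule_format, of 1] by eventually_elim (simp add: Y_def)
    have Y: "filterlim Y at_top sequentially"
      by (rule filterlim_at_top_mono[OF X]) (simp add: Y_def)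
    have "(\<lambda>n. pth_integral p lborel (u (Y n))) \<longlonglongrightarrow> (\<integral>\<^sup>+x. 0 \<partial>(lborel :: 'a measure))"
      unfolding pth_integral_def
    proof (rule nn_integral_dominated_convergence[where w = "\<lambda>x. ennreal ((2 * W x) powr p)"])
      show "AE x in lborel. ennreal (cmod (u (Y n) x) powr p) \<le> ennreal ((2 * W x) powr p)" for n
        using p by (intro AE_I2 ennreal_leI powr_mono2 uW Y0) auto
      show "AE x in lborel. (\<lambda>n. ennreal (cmod (u (Y n) x) powr p)) \<longlonglongrightarrow> 0"
        using lim
      proof eventually_elim
        case (elim x)
        have "(\<lambda>n. u (Y n) x) \<longlonglongrightarrow> 0" by (rule filterlim_compose[OF elim Y])
        then have "(\<lambda>n. ennreal (cmod (u (Y n) x) powr p)) \<longlonglongrightarrow> ennreal (cmod 0 powr p)"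
          using p by (intro tendsto_intros tendsto_powr') auto
        then show ?case by simp
      qed
    qed (use Wfin in auto)
    then have "(\<lambda>n. pth_integral p lborel (u (Y n))) \<longlonglongrightarrow> 0" by simp
    then show "(\<lambda>n. pth_integral p lborel (u (X n))) \<longlonglongrightarrow> 0"
      by (rule Lim_transform_eventually) (use YX in eventually_elim, simp)
  qed
  then show ?thesis by (simp add: u_def)
qed

section \<open>Density of step functions\<close>

text \<open>The functions for which the theorem holds (restricted to Borel functions). They are shown to
  form a closed subspace of $L^p$ that contains the indicators of boxes.\<close>

definition Lp_converges :: "real \<Rightarrow> ('a::euclidean_space \<Rightarrow> complex) \<Rightarrow> bool" where
  "Lp_converges p f \<longleftrightarrow> f \<in> borel_measurable borel \<and> pth_integral p lborel f < \<infinity> \<and>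
     ((\<lambda>\<omega>. pth_integral p lborel (\<lambda>x. product_conv_op (dirichlet_kernel1 \<omega>) f x - f x)) \<longlongrightarrow> 0) at_top"

lemma dirichlet_integrable:
  fixes f :: "'a::euclidean_space \<Rightarrow> complex"
  assumes p: "1 < p" and om: "0 < \<omega>" and [measurable]: "f \<in> borel_measurable borel" and fin: "pth_integral p lborel f < \<infinity>"
  shows "integrable lborel (\<lambda>y. of_real (\<Prod>b\<in>Basis. dirichlet_kernel1 \<omega> ((x - y) \<bullet> b)) * f y)"
proof -
  define q where "q = p / (p - 1)"
  have pq: "1 < p" "1 < q" "1 / p + 1 / q = 1" using p by (auto simp: q_def field_simps)
  show ?thesis
  proof (rule integrable_mult_of_pth_integrals[OF pq])
    have "pth_integral q lborel (\<lambda>y. complex_of_real (\<Prod>b\<in>Basis. dirichlet_kernel1 \<omega> ((x - y) \<bullet> b)))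
      = pth_integral q (Pi\<^sub>M Basis (\<lambda>_. lborel)) (\<lambda>y. complex_of_real (\<Prod>b\<in>Basis. dirichlet_kernel1 \<omega> ((x - of_coords y) \<bullet> b)))"
      by (rule pth_integral_of_coords) measurable
    also have "\<dots> = pth_integral q (Pi\<^sub>M Basis (\<lambda>_. lborel)) (\<lambda>y. complex_of_real (\<Prod>b\<in>Basis. dirichlet_kernel1 \<omega> (x \<bullet> b - y b)))"
      by (simp add: inner_diff_left)
    also have "\<dots> < \<infinity>"
      by (rule tensor_kernel_finite[OF finite_Basis dirichlet_kernel1_measurable dirichlet_kernel1_nn_integral_finite[OF om pq(2)]])
    finally show "pth_integral q lborel (\<lambda>y. complex_of_real (\<Prod>b\<in>Basis. dirichlet_kernel1 \<omega> ((x - y) \<bullet> b))) < \<infinity>" .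
  qed (use fin in auto)
qed

lemma product_conv_op_add:
  assumes "1 < p" "0 < \<omega>" "f \<in> borel_measurable borel" "pth_integral p lborel f < \<infinity>"
    "g \<in> borel_measurable borel" "pth_integral p lborel g < \<infinity>"
  shows "product_conv_op (dirichlet_kernel1 \<omega>) (\<lambda>x. f x + g x) x = product_conv_op (dirichlet_kernel1 \<omega>) f x + product_conv_op (dirichlet_kernel1 \<omega>) g x"
  using dirichlet_integrable[OF assms(1,2,3,4)] dirichlet_integrable[OF assms(1,2,5,6)]
  by (simp add: product_conv_op_def distrib_left)

lemma product_conv_op_scale: "product_conv_op k (\<lambda>x. c * f x) x = c * product_conv_op k f x"
  unfolding product_conv_op_def integral_mult_right_zero[symmetric] by (simp add: mult_ac)

lemma Lp_converges_add:
  assumes p: "1 < p" and f: "Lp_converges p f" and g: "Lp_converges p g"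
  shows "Lp_converges p (\<lambda>x. f x + g x)"
proof -
  note F = f[unfolded Lp_converges_def] and G = g[unfolded Lp_converges_def]
  have [measurable]: "f \<in> borel_measurable borel" "g \<in> borel_measurable borel" using F G by auto
  have lim: "((\<lambda>\<omega>. pth_integral p lborel (\<lambda>x. product_conv_op (dirichlet_kernel1 \<omega>) (\<lambda>x. f x + g x) x - (f x + g x))) \<longlongrightarrow> 0) at_top"
  proof (rule tendsto_sandwich[OF _ _ tendsto_const])
    have "((\<lambda>\<omega>. ennreal (2 powr p) * (pth_integral p lborel (\<lambda>x. product_conv_op (dirichlet_kernel1 \<omega>) f x - f x)
        + pth_integral p lborel (\<lambda>x. product_conv_op (dirichlet_kernel1 \<omega>) g x - g x))) \<longlongrightarrow> ennreal (2 powr p) * (0 + 0)) at_top"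
      using F G by (intro ennreal_tendsto_cmult tendsto_add) auto
    then show "((\<lambda>\<omega>. ennreal (2 powr p) * (pth_integral p lborel (\<lambda>x. product_conv_op (dirichlet_kernel1 \<omega>) f x - f x)
        + pth_integral p lborel (\<lambda>x. product_conv_op (dirichlet_kernel1 \<omega>) g x - g x))) \<longlongrightarrow> 0) at_top" by simp
    show "\<forall>\<^sub>F \<omega> in at_top. pth_integral p lborel (\<lambda>x. product_conv_op (dirichlet_kernel1 \<omega>) (\<lambda>x. f x + g x) x - (f x + g x))
       \<le> ennreal (2 powr p) * (pth_integral p lborel (\<lambda>x. product_conv_op (dirichlet_kernel1 \<omega>) f x - f x)
        + pth_integral p lborel (\<lambda>x. product_conv_op (dirichlet_kernel1 \<omega>) g x - g x))"
      using eventually_gt_at_top[of 0]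
    proof eventually_elim
      case (elim \<omega>)
      have "product_conv_op (dirichlet_kernel1 \<omega>) (\<lambda>x. f x + g x) x - (f x + g x)
         = (product_conv_op (dirichlet_kernel1 \<omega>) f x - f x) + (product_conv_op (dirichlet_kernel1 \<omega>) g x - g x)" for x
        using F G by (simp add: product_conv_op_add[OF p elim])
      then show ?case using p by (simp only:) (intro pth_integral_add_le; simp)
    qed
  qed simp
  show ?thesis unfolding Lp_converges_def
    using F G lim p by (auto intro!: pth_integral_add_finite[simplified])
qed

lemma Lp_converges_scale:
  assumes f: "Lp_converges p f"
  shows "Lp_converges p (\<lambda>x. c * f x)"
proof -
  note F = f[unfolded Lp_converges_def]
  have [measurable]: "f \<in> borel_measurable borel" using F by auto
  have "product_conv_op (dirichlet_kernel1 \<omega>) (\<lambda>x. c * f x) x - c * f x = c * (product_conv_op (dirichlet_kernel1 \<omega>) f x - f x)" for \<omega> x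
    by (simp add: product_conv_op_scale right_diff_distrib)
  then have "pth_integral p lborel (\<lambda>x. product_conv_op (dirichlet_kernel1 \<omega>) (\<lambda>x. c * f x) x - c * f x)
      = ennreal (cmod c powr p) * pth_integral p lborel (\<lambda>x. product_conv_op (dirichlet_kernel1 \<omega>) f x - f x)" for \<omega>
    by (simp only:) (rule pth_integral_scale, measurable)
  moreover have "((\<lambda>\<omega>. ennreal (cmod c powr p) * pth_integral p lborel (\<lambda>x. product_conv_op (dirichlet_kernel1 \<omega>) f x - f x)) \<longlongrightarrow> ennreal (cmod c powr p) * 0) at_top"
    using F by (intro ennreal_tendsto_cmult) auto
  ultimately show ?thesis unfolding Lp_converges_def using F
    by (simp add: pth_integral_scale ennreal_mult_less_top)
qed

lemma Lp_converges_zero: "0 < p \<Longrightarrow> Lp_converges p (\<lambda>x. 0)"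
  by (simp add: Lp_converges_def pth_integral_def product_conv_op_def)

lemma Lp_converges_sum:
  assumes p: "1 < p" and "\<And>i. i \<in> I \<Longrightarrow> Lp_converges p (f i)"
  shows "Lp_converges p (\<lambda>x. \<Sum>i\<in>I. f i x)"
  using assms(2)
proof (induction I rule: infinite_finite_induct)
  case (insert i I)
  then show ?case using Lp_converges_add[OF p, of "f i" "\<lambda>x. \<Sum>i\<in>I. f i x"] by simp
qed (use p Lp_converges_zero[of p] in auto)

text \<open>The uniform bound enters here:
  $S_\omega f-f=S_\omega(f-g_n)+(S_\omega g_n-g_n)+(g_n-f)$, where the first and the last term are
  small for large $n$, uniformly in \<open>\<omega>\<close>.\<close>

lemma Lp_converges_closed:
  fixes f :: "'a::euclidean_space \<Rightarrow> complex"
  assumes p: "1 < p" and g: "\<And>n::nat. Lp_converges p (g n)"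
    and fm[measurable]: "f \<in> borel_measurable borel" and fin: "pth_integral p lborel f < \<infinity>"
    and lim: "(\<lambda>n. pth_integral p lborel (\<lambda>x. f x - g n x)) \<longlonglongrightarrow> 0"
  shows "Lp_converges p f"
proof -
  obtain C where C: "C > 0" and bound: "\<And>(f :: 'a \<Rightarrow> complex) \<omega>. f \<in> borel_measurable borel \<Longrightarrow> 0 < \<omega> \<Longrightarrow>
     pth_integral p lborel (product_conv_op (dirichlet_kernel1 \<omega>) f) \<le> ennreal C * pth_integral p lborel f"
    using dirichlet_Lp_bound[OF p] by blast
  note G = g[unfolded Lp_converges_def]
  have gm[measurable]: "g n \<in> borel_measurable borel" for n using G by auto
  define \<delta> where "\<delta> = (\<lambda>n. pth_integral p lborel (\<lambda>x. f x - g n x))"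
  define E where "E = (\<lambda>n \<omega>. pth_integral p lborel (\<lambda>x. product_conv_op (dirichlet_kernel1 \<omega>) (g n) x - g n x))"
  define c where "c = ennreal (2 powr p)"
  have cfin: "c < \<infinity>" by (simp add: c_def)
  have main: "pth_integral p lborel (\<lambda>x. product_conv_op (dirichlet_kernel1 \<omega>) f x - f x) \<le> c * (c * (ennreal C * \<delta> n + E n \<omega>) + \<delta> n)"
    if om: "0 < \<omega>" for n \<omega>
  proof -
    define h where "h = (\<lambda>x. f x - g n x)"
    have hm[measurable]: "h \<in> borel_measurable borel" unfolding h_def by measurable
    have "pth_integral p lborel (\<lambda>x. - g n x) = pth_integral p lborel (g n)"
      by (simp add: pth_integral_def)
    then have "pth_integral p lborel (\<lambda>x. f x + (- g n x)) < \<infinity>"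
      using G p fin by (intro pth_integral_add_finite) auto
    then have hfin: "pth_integral p lborel h < \<infinity>" by (simp add: h_def)
    have f_eq: "f = (\<lambda>x. h x + g n x)" by (simp add: h_def)
    have Tf: "product_conv_op (dirichlet_kernel1 \<omega>) f x = product_conv_op (dirichlet_kernel1 \<omega>) h x + product_conv_op (dirichlet_kernel1 \<omega>) (g n) x" for x
      unfolding f_eq by (rule product_conv_op_add[OF p om hm hfin]) (use G in auto)
    define A where "A = (\<lambda>x. product_conv_op (dirichlet_kernel1 \<omega>) h x + (product_conv_op (dirichlet_kernel1 \<omega>) (g n) x - g n x))"
    have Am[measurable]: "A \<in> borel_measurable borel" unfolding A_def by measurable
    have "pth_integral p lborel (\<lambda>x. product_conv_op (dirichlet_kernel1 \<omega>) f x - f x) = pth_integral p lborel (\<lambda>x. A x + (- h x))"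
      unfolding Tf A_def by (simp add: h_def algebra_simps)
    also have "\<dots> \<le> c * (pth_integral p lborel A + pth_integral p lborel (\<lambda>x. - h x))"
      unfolding c_def using p by (intro pth_integral_add_le) auto
    also have "pth_integral p lborel (\<lambda>x. - h x) = \<delta> n"
      by (simp add: pth_integral_def \<delta>_def h_def norm_minus_commute)
    also have "pth_integral p lborel A \<le> c * (pth_integral p lborel (product_conv_op (dirichlet_kernel1 \<omega>) h) + E n \<omega>)"
      unfolding c_def A_def E_def using p by (intro pth_integral_add_le) auto
    also have "pth_integral p lborel (product_conv_op (dirichlet_kernel1 \<omega>) h) \<le> ennreal C * \<delta> n"
      unfolding \<delta>_def h_def[symmetric] by (rule bound[OF hm om])
    finally show ?thesis by (simp add: mult_left_mono add_right_mono)
  qed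
  have "((\<lambda>\<omega>. pth_integral p lborel (\<lambda>x. product_conv_op (dirichlet_kernel1 \<omega>) f x - f x)) \<longlongrightarrow> 0) at_top"
  proof (rule order_tendstoI)
    fix e :: ennreal assume e: "0 < e"
    have "(\<lambda>n. c * (c * (ennreal C * \<delta> n + 0) + \<delta> n)) \<longlonglongrightarrow> c * (c * (ennreal C * 0 + 0) + 0)"
      using lim cfin unfolding \<delta>_def[symmetric] by (intro ennreal_tendsto_cmult tendsto_add tendsto_const) auto
    then have "\<forall>\<^sub>F n in sequentially. c * (c * (ennreal C * \<delta> n + 0) + \<delta> n) < e"
      using e by (intro order_tendstoD(2)) auto
    then obtain n where n: "c * (c * (ennreal C * \<delta> n + 0) + \<delta> n) < e"
      unfolding eventually_sequentially by blast
    have "((\<lambda>\<omega>. c * (c * (ennreal C * \<delta> n + E n \<omega>) + \<delta> n)) \<longlongrightarrow> c * (c * (ennreal C * \<delta> n + 0) + \<delta> n)) at_top"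
      using G[of n] cfin unfolding E_def by (intro ennreal_tendsto_cmult tendsto_add tendsto_const) auto
    then have "\<forall>\<^sub>F \<omega> in at_top. c * (c * (ennreal C * \<delta> n + E n \<omega>) + \<delta> n) < e"
      using n by (rule order_tendstoD(2))
    then show "\<forall>\<^sub>F \<omega> in at_top. pth_integral p lborel (\<lambda>x. product_conv_op (dirichlet_kernel1 \<omega>) f x - f x) < e"
      using eventually_gt_at_top[of 0] by eventually_elim (rule le_less_trans[OF main])
  qed simp
  then show ?thesis unfolding Lp_converges_def using fin by simp
qed

text \<open>Dominated convergence in $L^p$ supplies the approximation that \<open>Lp_converges_closed\<close> asks for. All
  further limits (disjoint unions, exhaustion by boxes, simple functions) have this form.\<close>

lemma Lp_converges_dominated:
  fixes f :: "'a::euclidean_space \<Rightarrow> complex"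
  assumes p: "1 < p" and g: "\<And>n::nat. Lp_converges p (g n)"
    and fm[measurable]: "f \<in> borel_measurable borel" and fin: "pth_integral p lborel f < \<infinity>"
    and lim: "\<And>x. (\<lambda>n. g n x) \<longlonglongrightarrow> f x" and dom: "\<And>n x. cmod (g n x) \<le> c * cmod (f x)"
  shows "Lp_converges p f"
proof (rule Lp_converges_closed[OF p g fm fin])
  have gm[measurable]: "g n \<in> borel_measurable borel" for n using g by (simp add: Lp_converges_def)
  have "(\<lambda>n. pth_integral p lborel (\<lambda>x. f x - g n x)) \<longlonglongrightarrow> (\<integral>\<^sup>+x. 0 \<partial>(lborel :: 'a measure))"
    unfolding pth_integral_def
  proof (rule nn_integral_dominated_convergence[where w = "\<lambda>x. ennreal (cmod (of_real (1 + \<bar>c\<bar>) * f x) powr p)"])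
    show "AE x in lborel. ennreal (cmod (f x - g n x) powr p) \<le> ennreal (cmod (of_real (1 + \<bar>c\<bar>) * f x) powr p)" for n
    proof (intro AE_I2 ennreal_leI powr_mono2)
      fix x
      have "cmod (f x - g n x) \<le> cmod (f x) + cmod (g n x)" by (rule norm_triangle_ineq4)
      also have "\<dots> \<le> cmod (f x) + \<bar>c\<bar> * cmod (f x)"
        using dom[of n x] by (intro add_left_mono order_trans[OF dom] mult_right_mono) auto
      also have "\<dots> = cmod (of_real (1 + \<bar>c\<bar>) * f x)" unfolding norm_mult norm_of_real by (simp add: algebra_simps)
      finally show "cmod (f x - g n x) \<le> cmod (of_real (1 + \<bar>c\<bar>) * f x)" .
    qed (use p in auto)
    show "(\<integral>\<^sup>+x. ennreal (cmod (of_real (1 + \<bar>c\<bar>) * f x) powr p) \<partial>lborel) < \<infinity>"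
      using pth_integral_scale[of f lborel p "of_real (1 + \<bar>c\<bar>)"] fin
      by (simp add: pth_integral_def ennreal_mult_less_top del: of_real_add)
    show "AE x in lborel. (\<lambda>n. ennreal (cmod (f x - g n x) powr p)) \<longlonglongrightarrow> 0"
    proof (rule AE_I2)
      fix x
      have "(\<lambda>n. ennreal (cmod (f x - g n x) powr p)) \<longlonglongrightarrow> ennreal (cmod (f x - f x) powr p)"
        using p by (intro tendsto_intros tendsto_powr' lim) auto
      then show "(\<lambda>n. ennreal (cmod (f x - g n x) powr p)) \<longlonglongrightarrow> 0" by simp
    qed
  qed auto
  then show "(\<lambda>n. pth_integral p lborel (\<lambda>x. f x - g n x)) \<longlonglongrightarrow> 0" by simp
qed

lemma Lp_converges_cbox:
  assumes "1 < p"
  shows "Lp_converges p (indicator (cbox a b))"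
  unfolding Lp_converges_def using cbox_convergence[OF assms, of a b]
  by (auto simp: pth_integral_indicator emeasure_lborel_cbox_eq)

lemma sets_borel_eq_cboxes:
  "sets (borel :: 'a::euclidean_space measure) = sigma_sets UNIV (range (\<lambda>(a, b). cbox a b))"
proof -
  have "sets (borel :: 'a measure) = sigma_sets UNIV {S. open S}" by (simp add: borel_def)
  also have "\<dots> = sigma_sets UNIV (range (\<lambda>(a, b). cbox a b))"
  proof (rule sigma_sets_eqI)
    fix S :: "'a set" assume "S \<in> {S. open S}"
    then obtain \<D> where D: "countable \<D>" "\<And>X. X \<in> \<D> \<Longrightarrow> \<exists>a b. X = cbox a b" "\<Union>\<D> = S"
      using open_countable_Union_open_cbox[of S] by (metis mem_Collect_eq)
    have "X \<in> sigma_sets UNIV (range (\<lambda>(a, b). cbox a b))" if "X \<in> \<D>" for X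
      using D(2)[OF that] by (intro sigma_sets.Basic) auto
    then show "S \<in> sigma_sets UNIV (range (\<lambda>(a, b). cbox a b))"
      using sigma_sets_UNION[OF D(1)] D(3) by blast
  next
    fix B :: "'a set" assume "B \<in> range (\<lambda>(a, b). cbox a b)"
    then have "closed B" by (auto simp: closed_cbox)
    then have "UNIV - (UNIV - B) \<in> sigma_sets UNIV {S. open S}"
      by (intro sigma_sets.Compl sigma_sets.Basic) (auto simp: open_Diff)
    then show "B \<in> sigma_sets UNIV {S. open S}" by (simp add: Diff_Diff_Int)
  qed
  finally show ?thesis .
qed

text \<open>Boxes are stable under intersection and generate the Borel sets, so the induction principle for
  Dynkin systems applies. Intersecting with a fixed box keeps all measures finite, in particular
  those of complements.\<close>

lemma Lp_converges_indicator_Int_cbox: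
  fixes A :: "'a::euclidean_space set"
  assumes p: "1 < p" and A: "A \<in> sets borel"
  shows "Lp_converges p (indicator (A \<inter> cbox u v))"
proof -
  have "Int_stable (range (\<lambda>(a, b). cbox a b :: 'a set))"
  proof (rule Int_stableI)
    fix X Y :: "'a set" assume "X \<in> range (\<lambda>(a, b). cbox a b)" "Y \<in> range (\<lambda>(a, b). cbox a b)"
    then obtain a b c d where "X = cbox a b" "Y = cbox c d" by auto
    then show "X \<inter> Y \<in> range (\<lambda>(a, b). cbox a b)" by (auto simp: Int_interval)
  qed
  moreover have "range (\<lambda>(a, b). cbox a b :: 'a set) \<subseteq> Pow UNIV" by simp
  moreover have "A \<in> sigma_sets UNIV (range (\<lambda>(a, b). cbox a b))" using A by (simp add: sets_borel_eq_cboxes)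
  ultimately show ?thesis
  proof (induction rule: sigma_sets_induct_disjoint)
    case (basic B)
    then obtain a b where "B = cbox a b" by auto
    then have "\<exists>c d. B \<inter> cbox u v = cbox c d" by (auto simp: Int_interval)
    then show ?case using Lp_converges_cbox[OF p] by auto
  next
    case empty
    then show ?case using Lp_converges_zero[of p] p by (simp add: indicator_def)
  next
    case (compl B)
    have "indicator ((UNIV - B) \<inter> cbox u v) = (\<lambda>x. indicator (cbox u v) x + (-1) * indicator (B \<inter> cbox u v) x :: complex)"
      by (auto simp: indicator_def fun_eq_iff)
    then show ?case
      using Lp_converges_add[OF p Lp_converges_cbox[OF p] Lp_converges_scale[OF compl(2), of "-1"]] by simp
  next
    case (union B)
    have Bm: "B i \<in> sets borel" for i using union(2) by (auto simp: sets_borel_eq_cboxes)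
    let ?U = "(\<Union>i. B i) \<inter> cbox u v"
    have sum_eq: "(\<Sum>i<n. indicator (B i \<inter> cbox u v) x) = (indicator ((\<Union>i<n. B i) \<inter> cbox u v) x :: complex)" for n :: nat and x
    proof -
      have "disjoint_family_on (\<lambda>i. B i \<inter> cbox u v) {..<n}"
        using union(1) by (auto simp: disjoint_family_on_def)
      then have "(indicator (\<Union>i<n. B i \<inter> cbox u v) x :: complex) = (\<Sum>i<n. indicator (B i \<inter> cbox u v) x)"
        by (intro indicator_UN_disjoint) auto
      then show ?thesis by (simp add: Int_UN_distrib2)
    qed
    show ?case
    proof (rule Lp_converges_dominated[OF p, where c = 1 and g = "\<lambda>n x. \<Sum>i<n. indicator (B i \<inter> cbox u v) x"])
      show "Lp_converges p (\<lambda>x. \<Sum>i<n. indicator (B i \<inter> cbox u v) x)" for n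
        by (intro Lp_converges_sum[OF p] union(3))
      have "emeasure lborel ?U \<le> emeasure lborel (cbox u v)" by (intro emeasure_mono) auto
      also have "\<dots> < \<infinity>" by (simp add: emeasure_lborel_cbox_eq)
      finally show "pth_integral p lborel (indicator ?U) < \<infinity>"
        using Bm by (subst pth_integral_indicator) auto
      show "(\<lambda>n. \<Sum>i<n. indicator (B i \<inter> cbox u v) x) \<longlonglongrightarrow> (indicator ?U x :: complex)" for x
      proof (cases "x \<in> ?U")
        case True
        then obtain i where i: "x \<in> B i" by auto
        have "\<forall>\<^sub>F n in sequentially. indicator ((\<Union>i<n. B i) \<inter> cbox u v) x = (indicator ?U x :: complex)"
          using eventually_gt_at_top[of i]
        proof eventually_elim
          case (elim n)
          then have "x \<in> (\<Union>i<n. B i)" using i by blast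
          then show ?case using True by (simp add: indicator_def)
        qed
        then show ?thesis unfolding sum_eq by (rule tendsto_eventually)
      next
        case False
        then have "indicator ((\<Union>i<n. B i) \<inter> cbox u v) x = (indicator ?U x :: complex)" for n
          by (auto simp: indicator_def)
        then show ?thesis unfolding sum_eq by simp
      qed
      show "cmod (\<Sum>i<n. indicator (B i \<inter> cbox u v) x) \<le> 1 * cmod (indicator ?U x)" for n x
        unfolding sum_eq by (auto simp: indicator_def)
    qed (use Bm in auto)
  qed
qed

lemma Lp_converges_indicator:
  fixes A :: "'a::euclidean_space set"
  assumes p: "1 < p" and A[measurable]: "A \<in> sets borel" and fin: "emeasure lborel A < \<infinity>"
  shows "Lp_converges p (indicator A)"
proof -
  define W where "W = (\<lambda>n::nat. cbox (- (\<Sum>b\<in>Basis. real n *\<^sub>R b)) (\<Sum>b\<in>Basis. real n *\<^sub>R b) :: 'a set)"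
  show ?thesis
  proof (rule Lp_converges_dominated[OF p, where c = 1 and g = "\<lambda>n. indicator (A \<inter> W n)"])
    show "Lp_converges p (indicator (A \<inter> W n))" for n
      unfolding W_def by (rule Lp_converges_indicator_Int_cbox[OF p A])
    show "pth_integral p lborel (indicator A) < \<infinity>" using fin by (simp add: pth_integral_indicator)
    show "(\<lambda>n. indicator (A \<inter> W n) x) \<longlonglongrightarrow> (indicator A x :: complex)" for x
    proof (rule tendsto_eventually)
      show "\<forall>\<^sub>F n in sequentially. indicator (A \<inter> W n) x = (indicator A x :: complex)"
        using eventually_ge_at_top[of "nat \<lceil>norm x\<rceil>"]
      proof eventually_elim
        case (elim n)
        then have "norm x \<le> real n" by (simp add: nat_le_iff ceiling_le_iff)
        then have "- real n \<le> x \<bullet> b \<and> x \<bullet> b \<le> real n" if "b \<in> Basis" for b using Basis_le_norm[OF that, of x] by linarith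
        then have "x \<in> W n" by (simp add: W_def mem_box)
        then show ?case by (simp add: indicator_def)
      qed
    qed
    show "cmod (indicator (A \<inter> W n) x) \<le> 1 * cmod (indicator A x)" for n x by (auto simp: indicator_def)
  qed auto
qed

text \<open>A nonzero value is attained only on a set of finite measure.\<close>

lemma Lp_converges_simple_function:
  fixes f :: "'a::euclidean_space \<Rightarrow> complex"
  assumes p: "1 < p" and f: "simple_function lborel f" and fin: "pth_integral p lborel f < \<infinity>"
  shows "Lp_converges p f"
proof -
  have rep: "f x = (\<Sum>z\<in>range f. z * indicator (f -` {z}) x)" for x
  proof -
    have "(\<Sum>z\<in>range f. z * indicator (f -` {z}) x) = (\<Sum>z\<in>range f. if z = f x then z else 0)"
      by (intro sum.cong) (auto simp: indicator_def)
    then show ?thesis using simple_functionD(1)[OF f] by simp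
  qed
  have "Lp_converges p (\<lambda>x. z * indicator (f -` {z}) x)" for z
  proof (cases "z = 0")
    case True
    then show ?thesis using Lp_converges_zero[of p] p by simp
  next
    case False
    have m: "f -` {z} \<in> sets borel" using simple_functionD(2)[OF f, of "{z}"] by simp
    have "ennreal (cmod z powr p) * emeasure lborel (f -` {z}) = pth_integral p lborel (\<lambda>x. z * indicator (f -` {z}) x)"
      using m by (subst pth_integral_scale) (auto simp: pth_integral_indicator)
    also have "\<dots> \<le> pth_integral p lborel f"
      using p by (intro pth_integral_mono) (auto simp: indicator_def)
    finally have "ennreal (cmod z powr p) * emeasure lborel (f -` {z}) < \<infinity>" using fin by (rule le_less_trans)
    then have "emeasure lborel (f -` {z}) < \<infinity>" using False by (auto simp: ennreal_mult_less_top)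
    then show ?thesis by (intro Lp_converges_scale Lp_converges_indicator[OF p m])
  qed
  then have "Lp_converges p (\<lambda>x. \<Sum>z\<in>range f. z * indicator (f -` {z}) x)" by (intro Lp_converges_sum[OF p])
  then show ?thesis by (simp add: rep[symmetric])
qed

theorem Lp_converges_of_Lp:
  fixes f :: "'a::euclidean_space \<Rightarrow> complex"
  assumes p: "1 < p" and f: "f \<in> borel_measurable borel" and fin: "pth_integral p lborel f < \<infinity>"
  shows "Lp_converges p f"
proof -
  have "f \<in> borel_measurable lborel" using f by simp
  from borel_measurable_implies_sequence_metric[OF this, of 0]
  obtain F where F: "\<And>i. simple_function lborel (F i)" "\<And>x. (\<lambda>i. F i x) \<longlonglongrightarrow> f x"
      "\<And>i x. cmod (F i x) \<le> 2 * cmod (f x)"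
    by (auto simp: dist_norm)
  have Fin: "pth_integral p lborel (F i) < \<infinity>" for i
  proof -
    have "pth_integral p lborel (F i) \<le> pth_integral p lborel (\<lambda>x. 2 * f x)"
      using p F(3) by (intro pth_integral_mono) (auto simp: norm_mult)
    also have "\<dots> < \<infinity>" using f fin by (subst pth_integral_scale) (auto simp: ennreal_mult_less_top)
    finally show ?thesis .
  qed
  show ?thesis
    by (rule Lp_converges_dominated[OF p Lp_converges_simple_function[OF p F(1) Fin] f fin F(2,3)])
qed

section \<open>Functions on real vectors and the completed Lebesgue measure\<close>

lemma prod_Basis_vec: "(\<Prod>b\<in>Basis. g (x \<bullet> b)) = (\<Prod>j\<in>UNIV. g (x $ j))" for x :: "real ^ 'n"
proof -
  have B: "Basis = range (\<lambda>j::'n. axis j (1::real))" by (auto simp: Basis_vec_def)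
  have "inj (\<lambda>j::'n. axis j (1::real))" by (auto simp: inj_on_def axis_eq_axis)
  then show ?thesis unfolding B by (subst prod.reindex) (auto simp: inner_axis)
qed

lemma dirichlet_kernel_eq: "dirichlet_kernel \<omega> x = (\<Prod>b\<in>Basis. dirichlet_kernel1 \<omega> (x \<bullet> b))"
  using prod_Basis_vec[of "dirichlet_kernel1 \<omega>" x]
  by (simp add: dirichlet_kernel_def dirichlet_kernel1_def)

text \<open>A measurable function for the completed measure is almost everywhere equal to a Borel function. This
  reduces the theorem to Borel functions, for which product measures are available.\<close>

lemma complex_borel_representative:
  fixes f :: "'a::euclidean_space \<Rightarrow> complex"
  assumes f: "f \<in> borel_measurable lebesgue"
  obtains g where "g \<in> borel_measurable borel" "AE x in lebesgue. f x = g x"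
proof -
  have "(\<lambda>x. Re (f x)) \<in> borel_measurable lebesgue" "(\<lambda>x. Im (f x)) \<in> borel_measurable lebesgue"
    using f by measurable
  then obtain u v where uv: "u \<in> borel_measurable lborel" "v \<in> borel_measurable lborel"
      "AE x in lborel. Re (f x) = u x" "AE x in lborel. Im (f x) = v x"
    by (auto dest!: completion_ex_borel_measurable_real)
  show thesis
  proof (rule that[of "\<lambda>x. of_real (u x) + \<i> * of_real (v x)"])
    show "(\<lambda>x. complex_of_real (u x) + \<i> * of_real (v x)) \<in> borel_measurable borel"
      using uv(1,2) by simp
    have "AE x in lborel. f x = of_real (u x) + \<i> * of_real (v x)"
      using uv(3,4) by eventually_elim (simp add: complex_eq_iff)
    then show "AE x in lebesgue. f x = of_real (u x) + \<i> * of_real (v x)" by (rule AE_completion)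
  qed
qed

lemma dirichlet_op_eq_product_conv_op:
  fixes f g :: "real ^ 'n \<Rightarrow> complex"
  assumes f: "f \<in> borel_measurable lebesgue" and g[measurable]: "g \<in> borel_measurable borel"
    and eq: "AE x in lebesgue. f x = g x"
  shows "dirichlet_op \<omega> f x = product_conv_op (dirichlet_kernel1 \<omega>) g x"
proof -
  have k: "(\<lambda>y. complex_of_real (dirichlet_kernel \<omega> (x - y))) \<in> borel_measurable borel"
    unfolding dirichlet_kernel_eq by measurable
  have k': "(\<lambda>y. complex_of_real (dirichlet_kernel \<omega> (x - y))) \<in> borel_measurable lebesgue"
    using k by (intro measurable_completion) simp
  have g': "g \<in> borel_measurable lebesgue" by (intro measurable_completion) simp
  have "dirichlet_op \<omega> f x = (LINT y|lebesgue. of_real (dirichlet_kernel \<omega> (x - y)) * g y)"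
    unfolding dirichlet_op_def Defs.convolution_def
  proof (rule integral_cong_AE)
    show "AE y in lebesgue. of_real (dirichlet_kernel \<omega> (x - y)) * f y = of_real (dirichlet_kernel \<omega> (x - y)) * g y"
      using eq by eventually_elim simp
  qed (intro borel_measurable_times k' f g')+
  also have "\<dots> = (LINT y|lborel. of_real (dirichlet_kernel \<omega> (x - y)) * g y)"
    using k by (intro integral_completion) simp
  also have "\<dots> = product_conv_op (dirichlet_kernel1 \<omega>) g x"
    unfolding product_conv_op_def dirichlet_kernel_eq ..
  finally show ?thesis .
qed

lemma pth_integral_lebesgue:
  assumes [measurable]: "g \<in> borel_measurable borel" and eq: "AE x in lebesgue. f x = g x"
  shows "pth_integral p lebesgue f = pth_integral p lborel g"
proof -
  have "pth_integral p lebesgue f = pth_integral p lebesgue g"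
    unfolding pth_integral_def by (rule nn_integral_cong_AE) (use eq in eventually_elim, simp)
  then show ?thesis unfolding pth_integral_def by (simp add: nn_integral_completion)
qed

lemma Lp_norm_pth_integral:
  "Lp_norm p f = (if pth_integral p lebesgue f = \<infinity> then \<infinity> else ennreal (enn2real (pth_integral p lebesgue f) powr (1 / p)))"
  by (simp add: Lp_norm_def pth_integral_def Let_def)

theorem theorem19p4:
  fixes p :: real and f :: "real ^ 'n \<Rightarrow> complex"
  assumes "1 < p"
    and "f \<in> Lp_space p"
  shows "((\<lambda>\<omega>. Lp_norm p (\<lambda>x. dirichlet_op \<omega> f x - f x)) \<longlongrightarrow> 0) at_top"
proof -
  have f: "f \<in> borel_measurable lebesgue" and fin: "pth_integral p lebesgue f < \<infinity>"
    using assms(2) by (auto simp: Lp_space_def Lp_norm_pth_integral less_top split: if_splits)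
  obtain g where g[measurable]: "g \<in> borel_measurable borel" and eq: "AE x in lebesgue. f x = g x"
    using complex_borel_representative[OF f] .
  have "Lp_converges p g"
    using fin by (intro Lp_converges_of_Lp[OF assms(1) g]) (simp add: pth_integral_lebesgue[OF g eq])
  then have lim: "((\<lambda>\<omega>. pth_integral p lborel (\<lambda>x. product_conv_op (dirichlet_kernel1 \<omega>) g x - g x)) \<longlongrightarrow> 0) at_top"
    by (simp add: Lp_converges_def)
  define J where "J = (\<lambda>\<omega>. pth_integral p lebesgue (\<lambda>x. dirichlet_op \<omega> f x - f x))"
  have "J = (\<lambda>\<omega>. pth_integral p lborel (\<lambda>x. product_conv_op (dirichlet_kernel1 \<omega>) g x - g x))"
    unfolding J_def dirichlet_op_eq_product_conv_op[OF f g eq]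
    by (intro ext pth_integral_lebesgue) (measurable, use eq in eventually_elim, simp)
  then have J: "(J \<longlongrightarrow> 0) at_top" using lim by simp
  have "((\<lambda>\<omega>. enn2real (J \<omega>)) \<longlongrightarrow> 0) at_top" using J by (intro tendsto_enn2real) simp_all
  then have "((\<lambda>\<omega>. ennreal (enn2real (J \<omega>) powr (1 / p))) \<longlongrightarrow> ennreal (0 powr (1 / p))) at_top"
    using assms(1) by (intro tendsto_ennrealI tendsto_powr') (auto intro!: always_eventually)
  moreover have "\<forall>\<^sub>F \<omega> in at_top. ennreal (enn2real (J \<omega>) powr (1 / p)) = Lp_norm p (\<lambda>x. dirichlet_op \<omega> f x - f x)"
    using order_tendstoD(2)[OF J, of \<infinity>] by (auto simp: Lp_norm_pth_integral J_def elim!: eventually_mono)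
  ultimately show ?thesis by (auto intro: Lim_transform_eventually)
qed

end
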